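(* Let $\alpha,\beta,\gamma>0$ satisfy $\varkappa=\beta-\frac{\gamma}{\alpha}>0$, and let the kernel $g$ satisfy assumptions (g1), (g2), (g3) listed in the context. Then for every $(u_0,v_0,w_0)\in\mathcal H=H^1\times H^1\times H$ the Cauchy problem $$\partial_{ttt}u(t)+\alpha\,\partial_{tt}u(t)+\beta A\partial_t u(t)+\gamma Au(t)-\int_0^t g(s)Au(t-s)\,ds=0,\qquad u(0)=u_0,\ \partial_t u(0)=v_0,\ \partial_{tt}u(0)=w_0,$$ admits a unique global weak solution $u$, i.e. a unique $u$ defined on $[0,\infty)$ which is a weak solution on $[0,T]$ for every $T>0$. Moreover, there exists $M\ge 1$, independent of the initial data, such that the energy $$\mathsf E(t)=\|u(t)\|_1^2+\|\partial_t u(t)\|_1^2+\|\partial_{tt}u(t)\|^2+\int_0^t -g'(s)\|u(t)-u(t-s)\|_1^2\,ds$$ satisfies $\mathsf E(t)\le M\,\mathsf E(0)$ for every $t\ge 0$.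
   Context: $(H,\langle\cdot,\cdot\rangle,\|\cdot\|)$ is a real Hilbert space and $A$ is a strictly positive selfadjoint operator on $H$ with domain $\mathfrak D(A)\subset H$ (so that $\langle Au,u\rangle\ge\lambda\|u\|^2$ for some $\lambda>0$). For $\sigma\ge0$, $H^\sigma=\mathfrak D(A^{\sigma/2})$ with $\langle u,v\rangle_\sigma=\langle A^{\sigma/2}u,A^{\sigma/2}v\rangle$ and $\|u\|_\sigma=\|A^{\sigma/2}u\|$ (index omitted when $\sigma=0$); $H^{-\sigma}$ is the dual of $H^\sigma$, and $\langle\cdot,\cdot\rangle$ also denotes the duality pairing between them. $\mathcal H=H^1\times H^1\times H$ with norm $\|(u,v,w)\|_{\mathcal H}^2=\|u\|_1^2+\|v\|_1^2+\|w\|^2$. Assumptions on the kernel $g:(0,\infty)\to\mathbb R$, not identically zero: (g1) $g$ and its derivative $g'$ are summable on $(0,\infty)$ and absolutely continuous on $(0,\infty)$ (i.e. on every compact subinterval of $(0,\infty)$; $g'$ may be unbounded near $0$), and $\kappa=\int_0^\infty g(s)\,ds<\gamma$. (g2) $g(s)\ge0$ and $g'(s)\le0$ for every $s>0$. (g3) There is $\delta>0$, which may be and is taken with $\delta<\alpha$, such that $(\alpha-\delta)g'(s)-g''(s)\le0$ for a.e. $s>0$. Weak solution on $[0,T]$: a function $u$ such that (i) $(u,\partial_tu,\partial_{tt}u)\in\mathcal C([0,T],\mathcal H)$; (ii) the initial conditions hold; (iii) for every $\zeta\in H^1$ and a.e. $t\in[0,T]$, $$\langle\partial_{ttt}u(t),\zeta\rangle+\alpha\langle\partial_{tt}u(t),\zeta\rangle+\beta\langle\partial_tu(t),\zeta\rangle_1+\gamma\langle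 u(t),\zeta\rangle_1-\int_0^tg(s)\langle u(t-s),\zeta\rangle_1\,ds=0.$$ *)

theory Defs
  imports "HOL-Analysis.Analysis"
begin

section \<open>Unbounded operators\<close>

text \<open>An unbounded operator on \<open>H\<close> is identified with its graph, a set of pairs \<open>(u, T u)\<close>
  with \<open>u\<close> in the domain. The domain is then \<^const>\<open>Domain\<close> and the product of operators, with
  its natural domain, is relational composition.\<close>

type_synonym 'a operator = "('a \<times> 'a) set"

definition linear_operator :: "'a::real_vector operator \<Rightarrow> bool" where
  "linear_operator T \<longleftrightarrow> subspace T \<and> single_valued T"

definition op_apply :: "'a operator \<Rightarrow> 'a \<Rightarrow> 'a" where
  "op_apply T u = (THE y. (u, y) \<in> T)"

definition adjoint_operator :: "'a::real_inner operator \<Rightarrow> 'a operator" where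
  "adjoint_operator T = {(v, w). \<forall>(u, y)\<in>T. y \<bullet> v = u \<bullet> w}"

definition selfadjoint :: "'a::real_inner operator \<Rightarrow> bool" where
  "selfadjoint T \<longleftrightarrow>
     linear_operator T \<and> closure (Domain T) = UNIV \<and> adjoint_operator T = T"

definition nonneg_operator :: "'a::real_inner operator \<Rightarrow> bool" where
  "nonneg_operator T \<longleftrightarrow> (\<forall>(u, y)\<in>T. 0 \<le> y \<bullet> u)"

definition strictly_positive :: "'a::real_inner operator \<Rightarrow> bool" where
  "strictly_positive T \<longleftrightarrow> (\<exists>c>0. \<forall>(u, y)\<in>T. c * (norm u)\<^sup>2 \<le> y \<bullet> u)"

text \<open>The square root \<open>A\<^sup>1\<^sup>/\<^sup>2\<close>: the unique nonnegative selfadjoint operator whose square, as an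
  operator with its natural domain, is \<open>A\<close>.\<close>

definition sqrt_operator :: "'a::real_inner operator \<Rightarrow> 'a operator" where
  "sqrt_operator A = (THE S. selfadjoint S \<and> nonneg_operator S \<and> S O S = A)"


section \<open>The spaces \<open>H\<^sup>1\<close>, \<open>H\<^sup>-\<^sup>1\<close> and the phase space\<close>

definition H1 :: "'a::real_inner operator \<Rightarrow> 'a set" where
  "H1 A = Domain (sqrt_operator A)"

definition inner1 :: "'a::real_inner operator \<Rightarrow> 'a \<Rightarrow> 'a \<Rightarrow> real" where
  "inner1 A u v = op_apply (sqrt_operator A) u \<bullet> op_apply (sqrt_operator A) v"

definition norm1 :: "'a::real_inner operator \<Rightarrow> 'a \<Rightarrow> real" where
  "norm1 A u = norm (op_apply (sqrt_operator A) u)"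

text \<open>Only the values on \<open>H\<^sup>1\<close> of an element of the dual are meaningful; the duality pairing of
  \<open>\<phi>\<close> and \<open>\<zeta>\<close> is \<open>\<phi> \<zeta>\<close>.\<close>

definition H1_dual :: "'a::real_inner operator \<Rightarrow> ('a \<Rightarrow> real) set" where
  "H1_dual A = {\<phi>.
     (\<forall>u\<in>H1 A. \<forall>v\<in>H1 A. \<phi> (u + v) = \<phi> u + \<phi> v) \<and>
     (\<forall>c. \<forall>u\<in>H1 A. \<phi> (c *\<^sub>R u) = c * \<phi> u) \<and>
     (\<exists>C. \<forall>u\<in>H1 A. \<bar>\<phi> u\<bar> \<le> C * norm1 A u)}"

definition phase_space :: "'a::real_inner operator \<Rightarrow> ('a \<times> 'a \<times> 'a) set" where
  "phase_space A = H1 A \<times> H1 A \<times> UNIV"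

definition phase_norm :: "'a::real_inner operator \<Rightarrow> 'a \<times> 'a \<times> 'a \<Rightarrow> real" where
  "phase_norm A = (\<lambda>(u, v, w). sqrt ((norm1 A u)\<^sup>2 + (norm1 A v)\<^sup>2 + (norm w)\<^sup>2))"

definition continuous_into_phase_space ::
    "'a::real_inner operator \<Rightarrow> real set \<Rightarrow> (real \<Rightarrow> 'a \<times> 'a \<times> 'a) \<Rightarrow> bool" where
  "continuous_into_phase_space A I z \<longleftrightarrow>
     (\<forall>t\<in>I. z t \<in> phase_space A \<and>
        ((\<lambda>s. phase_norm A (z s - z t)) \<longlongrightarrow> 0) (at t within I))"


section \<open>The memory kernel\<close>

definition abs_continuous_on :: "real set \<Rightarrow> (real \<Rightarrow> real) \<Rightarrow> bool" where
  "abs_continuous_on S f \<longleftrightarrow>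
     (\<forall>\<epsilon>>0. \<exists>\<eta>>0. \<forall>(n::nat) a b.
        (\<forall>i<n. a i \<le> b i \<and> {a i..b i} \<subseteq> S) \<longrightarrow>
        disjoint_family_on (\<lambda>i. {a i<..<b i}) {..<n} \<longrightarrow>
        (\<Sum>i<n. b i - a i) < \<eta> \<longrightarrow>
        (\<Sum>i<n. \<bar>f (b i) - f (a i)\<bar>) < \<epsilon>)"

text \<open>Kernels are functions on \<open>(0,\<infinity>)\<close>; their values on \<open>(-\<infinity>,0]\<close> play no role. A locally
  absolutely continuous \<open>g\<close> with locally absolutely continuous \<open>g'\<close> is \<open>C\<^sup>1\<close>, so \<open>g'\<close> is the
  classical derivative at every point.\<close>

definition kernel_g1 :: "(real \<Rightarrow> real) \<Rightarrow> real \<Rightarrow> bool" where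
  "kernel_g1 g \<gamma> \<longleftrightarrow>
     set_integrable lborel {0<..} g \<and>
     set_integrable lborel {0<..} (deriv g) \<and>
     (\<forall>s>0. g differentiable (at s)) \<and>
     (\<forall>a b. 0 < a \<longrightarrow> a \<le> b \<longrightarrow>
        abs_continuous_on {a..b} g \<and> abs_continuous_on {a..b} (deriv g)) \<and>
     (LINT s:{0<..}|lborel. g s) < \<gamma>"

definition kernel_g2 :: "(real \<Rightarrow> real) \<Rightarrow> bool" where
  "kernel_g2 g \<longleftrightarrow> (\<forall>s>0. 0 \<le> g s \<and> deriv g s \<le> 0)"

definition kernel_g3 :: "(real \<Rightarrow> real) \<Rightarrow> real \<Rightarrow> bool" where
  "kernel_g3 g \<alpha> \<longleftrightarrow>
     (\<exists>\<delta>>0. \<delta> < \<alpha> \<and>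
        (AE s in lborel. 0 < s \<longrightarrow> (\<alpha> - \<delta>) * deriv g s - deriv (deriv g) s \<le> 0))"


section \<open>Weak solutions\<close>

text \<open>\<open>\<xi>\<close> is the time derivative of \<open>w\<close> on \<open>[0,T]\<close> as an \<open>H\<^sup>-\<^sup>1\<close>-valued function, in the sense of
  the fundamental theorem of calculus tested against \<open>H\<^sup>1\<close>. Consequently \<open>w\<close> paired with any
  element of \<open>H\<^sup>1\<close> is absolutely continuous; mere differentiability almost everywhere would not
  be enough for uniqueness.\<close>

definition has_dual_derivative ::
    "'a::real_inner operator \<Rightarrow> real \<Rightarrow> (real \<Rightarrow> 'a) \<Rightarrow> (real \<Rightarrow> 'a \<Rightarrow> real) \<Rightarrow> bool" where
  "has_dual_derivative A T w \<xi> \<longleftrightarrow>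
     (\<forall>t\<in>{0..T}. \<xi> t \<in> H1_dual A) \<and>
     (\<forall>\<zeta>\<in>H1 A. set_integrable lborel {0..T} (\<lambda>t. \<xi> t \<zeta>) \<and>
        (\<forall>t\<in>{0..T}. w t \<bullet> \<zeta> - w 0 \<bullet> \<zeta> = (LINT s:{0..t}|lborel. \<xi> s \<zeta>)))"

text \<open>Weak solution on \<open>[0,T]\<close> with initial data \<open>(u\<^sub>0, v\<^sub>0, w\<^sub>0)\<close>; here \<open>v\<close>, \<open>w\<close>, \<open>\<xi>\<close> are
  \<open>\<partial>\<^sub>t u\<close>, \<open>\<partial>\<^sub>t\<^sub>t u\<close>, \<open>\<partial>\<^sub>t\<^sub>t\<^sub>t u\<close>. The derivatives \<open>v\<close> and \<open>w\<close> are limits of difference quotients in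
  \<open>H\<close>, one-sided at the endpoints; as \<open>v\<close> is continuous into \<open>H\<^sup>1\<close>, \<open>u\<close> is then also
  differentiable into \<open>H\<^sup>1\<close>.\<close>

definition weak_solution ::
    "'a::real_inner operator \<Rightarrow> real \<Rightarrow> real \<Rightarrow> real \<Rightarrow> (real \<Rightarrow> real) \<Rightarrow>
     'a \<times> 'a \<times> 'a \<Rightarrow> real \<Rightarrow> (real \<Rightarrow> 'a) \<Rightarrow> bool" where
  "weak_solution A \<alpha> \<beta> \<gamma> g z\<^sub>0 T u \<longleftrightarrow> (\<exists>v w \<xi>.
     (\<forall>t\<in>{0..T}. (u has_vector_derivative v t) (at t within {0..T})) \<and>
     (\<forall>t\<in>{0..T}. (v has_vector_derivative w t) (at t within {0..T})) \<and>
     has_dual_derivative A T w \<xi> \<and>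
     continuous_into_phase_space A {0..T} (\<lambda>t. (u t, v t, w t)) \<and>
     (u 0, v 0, w 0) = z\<^sub>0 \<and>
     (\<forall>\<zeta>\<in>H1 A. AE t in lborel. t \<in> {0..T} \<longrightarrow>
        \<xi> t \<zeta> + \<alpha> * (w t \<bullet> \<zeta>) + \<beta> * inner1 A (v t) \<zeta> + \<gamma> * inner1 A (u t) \<zeta>
          - (LINT s:{0..t}|lborel. g s * inner1 A (u (t - s)) \<zeta>) = 0))"

definition global_weak_solution ::
    "'a::real_inner operator \<Rightarrow> real \<Rightarrow> real \<Rightarrow> real \<Rightarrow> (real \<Rightarrow> real) \<Rightarrow>
     'a \<times> 'a \<times> 'a \<Rightarrow> (real \<Rightarrow> 'a) \<Rightarrow> bool" where
  "global_weak_solution A \<alpha> \<beta> \<gamma> g z\<^sub>0 u \<longleftrightarrow> (\<forall>T>0. weak_solution A \<alpha> \<beta> \<gamma> g z\<^sub>0 T u)"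

definition time_deriv :: "(real \<Rightarrow> 'a::real_normed_vector) \<Rightarrow> real \<Rightarrow> 'a" where
  "time_deriv u t = vector_derivative u (at t within {0..})"

text \<open>The memory term is a genuine (convergent) integral for weak solutions, because \<open>g'\<close> is
  summable and \<open>u\<close> is continuous into \<open>H\<^sup>1\<close>.\<close>

definition energy ::
    "'a::real_inner operator \<Rightarrow> (real \<Rightarrow> real) \<Rightarrow> (real \<Rightarrow> 'a) \<Rightarrow> real \<Rightarrow> real" where
  "energy A g u t =
     (norm1 A (u t))\<^sup>2 + (norm1 A (time_deriv u t))\<^sup>2 + (norm (time_deriv (time_deriv u) t))\<^sup>2
     + (LINT s:{0..t}|lborel. - deriv g s * (norm1 A (u t - u (t - s)))\<^sup>2)"

end

theory Submission
  imports Defs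
begin

text \<open>Since \<open>A\<close> has a bounded inverse, \<open>R = A\<^sup>-\<^sup>1\<^sup>/\<^sup>2\<close> is a bounded injective operator with range \<open>H\<^sup>1\<close>, and
  writing \<open>u = R p\<close>, \<open>\<partial>\<^sub>t u = R q\<close>, \<open>\<partial>\<^sub>t\<^sub>t u = w\<close> turns the problem into \<open>p' = q\<close>, \<open>(R q)' = w\<close>,
  \<open>(R w)' = g * p - \<alpha> R w - \<beta> q - \<gamma> p\<close>. A spectral projection of \<open>R\<close> on whose range \<open>R\<close> is
  boundedly invertible commutes with this system and turns it into a linear Volterra equation,
  solvable by Picard iteration, whose solutions are \<open>C\<^sup>1\<close>. With \<open>z = w + \<alpha> R q\<close> and
  \<open>\<eta> = p(t) - p(t - s)\<close> the functional
  \<open>|z|\<^sup>2 + \<beta>|q|\<^sup>2 + 2\<gamma>\<langle>p,q\<rangle> + \<gamma>\<alpha>|p|\<^sup>2 - 2\<langle>g*p,q\<rangle> + (g - \<alpha>\<integral>g)|p|\<^sup>2 + \<integral>(\<alpha>g - g')|\<eta>|\<^sup>2\<close>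
  has the derivative \<open>-2(\<alpha>\<beta> - \<gamma>)|q|\<^sup>2 - (\<alpha>g - g')|p|\<^sup>2 - \<integral>(g'' - \<alpha>g')|\<eta>|\<^sup>2 \<le> 0\<close> and is bounded below by
  \<open>|z|\<^sup>2 + (\<beta> - \<gamma>/\<alpha>)|q|\<^sup>2 + ((\<gamma> - \<kappa>)/\<alpha>)|q + \<alpha>p|\<^sup>2 - \<integral>g'|\<eta>|\<^sup>2\<close>, which controls the energy. As
  \<open>g'\<close> may be singular at \<open>0\<close> and \<open>g''\<close> exists only almost everywhere, this is applied with \<open>g\<close>
  replaced by its averages over \<open>[s + h, s + 2h]\<close>. The resulting bound passes to the limit along the
  projections for every weak solution; it gives uniqueness, and for existence it makes the solutions
  with projected data a Cauchy sequence.\<close>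

section \<open>Absolutely continuous functions\<close>

text \<open>The equation holds in the dual of H^1, while the multiplier behind the energy identity,
  the second time derivative of u plus \<alpha> times the first, lies only in H: a weak solution
  cannot be tested with it. On the range of a projection where R is invertible this obstacle
  disappears, and as the projection commutes with the system it can be applied to an arbitrary weak
  solution. The order of limits matters: the error from the smoothed kernel is paired with the H^1
  coordinate of the multiplier, which is controlled only for a fixed projection, so the kernel is
  restored first and the projection removed afterwards. The averages start at s + h so that the
  smoothed kernel is C^2 up to 0 even if g' is unbounded there. The sign condition for its second
  derivative compares increments of g' with increments of g; (g3) has to be integrated for this,
  which rests on the fundamental theorem of calculus for absolutely continuous functions. Since the
  square root of A is a definite description, its representation by R includes uniqueness among all
  nonnegative selfadjoint roots.\<close>

definition nonoverlapping :: "('i \<Rightarrow> real) \<Rightarrow> ('i \<Rightarrow> real) \<Rightarrow> 'i set \<Rightarrow> real set \<Rightarrow> bool" where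
  "nonoverlapping a b I S \<longleftrightarrow> finite I \<and> (\<forall>i\<in>I. a i \<le> b i \<and> {a i..b i} \<subseteq> S) \<and>
     disjoint_family_on (\<lambda>i. {a i<..<b i}) I"

text \<open>Families indexed by a Sigma set or by the intervals themselves occur below, while
  absolute continuity speaks of indices {..<n}. The equation for every h transfers lengths and
  increments alike.\<close>

lemma nonoverlapping_reindex:
  assumes "nonoverlapping a b I S"
  obtains a' b' n where "nonoverlapping a' b' {..<n::nat} S"
    "\<And>h::real \<Rightarrow> real \<Rightarrow> real. (\<Sum>i<n. h (a' i) (b' i)) = (\<Sum>i\<in>I. h (a i) (b i))"
proof -
  have fin: "finite I" using assms by (simp add: nonoverlapping_def)
  then obtain e where e: "bij_betw e {..<card I} I"
    by (metis atLeast0LessThan ex_bij_betw_nat_finite)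
  have inj: "i \<noteq> j \<Longrightarrow> i < card I \<Longrightarrow> j < card I \<Longrightarrow> e i \<noteq> e j" for i j
    using e by (auto simp: bij_betw_def inj_on_def)
  have mem: "i < card I \<Longrightarrow> e i \<in> I" for i using e by (auto simp: bij_betw_def)
  show thesis
  proof
    show "nonoverlapping (a \<circ> e) (b \<circ> e) {..<card I} S"
      using assms mem inj unfolding nonoverlapping_def disjoint_family_on_def by auto
    show "(\<Sum>i<card I. h ((a \<circ> e) i) ((b \<circ> e) i)) = (\<Sum>i\<in>I. h (a i) (b i))" for h :: "real \<Rightarrow> real \<Rightarrow> real"
      using sum.reindex_bij_betw[OF e, of "\<lambda>i. h (a i) (b i)"] by simp
  qed
qed

lemma abs_continuous_on_iff_nonoverlapping:
  "abs_continuous_on S f \<longleftrightarrow> (\<forall>\<epsilon>>0. \<exists>\<eta>>0. \<forall>(n::nat) a b. nonoverlapping a b {..<n} S \<longrightarrow>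
        (\<Sum>i<n. b i - a i) < \<eta> \<longrightarrow> (\<Sum>i<n. \<bar>f (b i) - f (a i)\<bar>) < \<epsilon>)"
  unfolding abs_continuous_on_def nonoverlapping_def by (simp add: imp_conjL Ball_def)

lemma sum_lengths_le_measure:
  assumes "nonoverlapping a b I S" "S \<in> lmeasurable"
  shows "(\<Sum>i\<in>I. b i - a i) \<le> measure lebesgue S"
proof -
  have "(\<Sum>i\<in>I. b i - a i) = (\<Sum>i\<in>I. measure lebesgue {a i<..<b i})"
    using assms(1) by (intro sum.cong) (auto simp: nonoverlapping_def)
  also have "\<dots> = measure lebesgue (\<Union>i\<in>I. {a i<..<b i})"
    using assms(1) by (subst measure_UNION') (auto simp: nonoverlapping_def disjoint_family_on_def pairwise_def disjnt_def)
  also have "\<dots> \<le> measure lebesgue S"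
    using assms by (intro measure_mono_fmeasurable) (force simp: nonoverlapping_def subset_iff)+
  finally show ?thesis .
qed

section \<open>Total variation of an absolutely continuous function\<close>

lemma nonoverlapping_mono: "nonoverlapping a b I S \<Longrightarrow> S \<subseteq> T \<Longrightarrow> nonoverlapping a b I T"
  unfolding nonoverlapping_def by blast

lemma nonoverlapping_clamp_left:
  assumes "nonoverlapping a b I {x..z}" "x \<le> y"
  shows "nonoverlapping (\<lambda>i. min (a i) y) (\<lambda>i. min (b i) y) I {x..y}"
proof -
  have "{min (a i) y<..<min (b i) y} \<subseteq> {a i<..<b i}" for i by auto
  then have "disjoint_family_on (\<lambda>i. {min (a i) y<..<min (b i) y}) I"
    using assms(1) unfolding nonoverlapping_def disjoint_family_on_def by fast
  moreover have "\<forall>i\<in>I. a i \<le> b i \<and> x \<le> a i" 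
    using assms(1) unfolding nonoverlapping_def by fastforce
  ultimately show ?thesis using assms unfolding nonoverlapping_def by fastforce
qed

lemma nonoverlapping_clamp_right:
  assumes "nonoverlapping a b I {x..z}" "y \<le> z"
  shows "nonoverlapping (\<lambda>i. max (a i) y) (\<lambda>i. max (b i) y) I {y..z}"
proof -
  have "{max (a i) y<..<max (b i) y} \<subseteq> {a i<..<b i}" for i by auto
  then have "disjoint_family_on (\<lambda>i. {max (a i) y<..<max (b i) y}) I"
    using assms(1) unfolding nonoverlapping_def disjoint_family_on_def by fast
  moreover have "\<forall>i\<in>I. a i \<le> b i \<and> b i \<le> z" 
    using assms(1) unfolding nonoverlapping_def by fastforce
  ultimately show ?thesis using assms unfolding nonoverlapping_def by fastforce
qed

text \<open>The families need not cover [x,y]. The supremum is the usual total variation all the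
  same, and no family has to be completed to a partition.\<close>

definition variation_sums :: "(real \<Rightarrow> real) \<Rightarrow> real \<Rightarrow> real \<Rightarrow> real set" where
  "variation_sums f x y = {\<Sum>i<n. \<bar>f (b i) - f (a i)\<bar> | (n::nat) a b. nonoverlapping a b {..<n} {x..y}}"

definition variation :: "(real \<Rightarrow> real) \<Rightarrow> real \<Rightarrow> real \<Rightarrow> real" where
  "variation f x y = Sup (variation_sums f x y)"

lemma variation_sumsI:
  assumes "nonoverlapping a b I {x..y}"
  shows "(\<Sum>i\<in>I. \<bar>f (b i) - f (a i)\<bar>) \<in> variation_sums f x y"
proof -
  obtain a' b' n where n: "nonoverlapping a' b' {..<n::nat} {x..y}"
    "\<And>h::real \<Rightarrow> real \<Rightarrow> real. (\<Sum>i<n. h (a' i) (b' i)) = (\<Sum>i\<in>I. h (a i) (b i))"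
    using nonoverlapping_reindex[OF assms] by metis
  show ?thesis unfolding variation_sums_def
    using n(1) n(2)[of "\<lambda>u v. \<bar>f v - f u\<bar>"] by force
qed

lemma variation_sums_nonempty: "variation_sums f x y \<noteq> {}"
  using variation_sumsI[of "\<lambda>_. x" "\<lambda>_. x" "{}::nat set" x y f]
  by (auto simp: nonoverlapping_def disjoint_family_on_def)

lemma variation_sums_split:
  assumes "s \<in> variation_sums f x z" "x \<le> y" "y \<le> z"
  obtains s1 s2 where "s1 \<in> variation_sums f x y" "s2 \<in> variation_sums f y z" "s \<le> s1 + s2"
proof -
  obtain n a b where s: "s = (\<Sum>i<n::nat. \<bar>f (b i) - f (a i)\<bar>)" and no: "nonoverlapping a b {..<n} {x..z}"
    using assms(1) unfolding variation_sums_def by blast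
  let ?s1 = "\<Sum>i<n. \<bar>f (min (b i) y) - f (min (a i) y)\<bar>"
  let ?s2 = "\<Sum>i<n. \<bar>f (max (b i) y) - f (max (a i) y)\<bar>"
  \<comment> \<open>An interval that contains y is cut there and the triangle inequality applies;
    for any other interval one of the two clamped copies is degenerate and contributes 0.\<close>
  have "s \<le> ?s1 + ?s2"
    unfolding s sum.distrib[symmetric]
    using no by (intro sum_mono) (auto simp: nonoverlapping_def min_def max_def)
  then show thesis
    using that variation_sumsI[OF nonoverlapping_clamp_left[OF no assms(2)], of f]
      variation_sumsI[OF nonoverlapping_clamp_right[OF no assms(3)], of f] by simp
qed

text \<open>Let \<eta> be the threshold of absolute continuity for \<epsilon> = 1. An interval
  shorter than m \<eta> consists of m pieces shorter than \<eta>, each of variation at most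
  1.\<close>

lemma bdd_above_variation_sums:
  assumes "abs_continuous_on {a..b} f" "a \<le> x" "x \<le> y" "y \<le> b"
  shows "bdd_above (variation_sums f x y)"
proof -
  obtain \<eta> where \<eta>: "\<eta> > 0" "\<And>(n::nat) c d. nonoverlapping c d {..<n} {a..b} \<Longrightarrow>
        (\<Sum>i<n. d i - c i) < \<eta> \<Longrightarrow> (\<Sum>i<n. \<bar>f (d i) - f (c i)\<bar>) < 1"
    using assms(1) unfolding abs_continuous_on_iff_nonoverlapping by (meson zero_less_one)
  have *: "\<lbrakk>a \<le> x; x \<le> y; y \<le> b; y - x < real m * \<eta>; s \<in> variation_sums f x y\<rbrakk> \<Longrightarrow> s \<le> real m" for m x y s
  proof (induction m arbitrary: x y s)
    case (Suc m)
    show ?case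
    proof (cases "m = 0")
      case True
      obtain n c d where s: "s = (\<Sum>i<n::nat. \<bar>f (d i) - f (c i)\<bar>)" and no: "nonoverlapping c d {..<n} {x..y}"
        using Suc.prems unfolding variation_sums_def by blast
      have "(\<Sum>i<n. d i - c i) \<le> y - x"
        using sum_lengths_le_measure[OF no] Suc.prems by simp
      then show ?thesis
        using \<eta>(2)[OF nonoverlapping_mono[OF no]] Suc.prems True s by fastforce
    next
      case False
      \<comment> \<open>Of m + 1 equal pieces the last one is split off and the induction hypothesis
        covers the rest. For m = 0 the rest would be a point, whose length is not strictly below 0;
        hence the separate case.\<close>
      define w where "w = x + (y - x) * (m / (m + 1))"
      have p: "0 \<le> real m / (real m + 1)" "real m / (real m + 1) \<le> 1" by auto
      have w: "x \<le> w" "w \<le> y"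
      proof -
        show "x \<le> w" using p(1) Suc.prems by (simp add: w_def)
        have "(y - x) * (m / (m + 1)) \<le> (y - x) * 1" using p(2) Suc.prems by (intro mult_left_mono) auto
        then show "w \<le> y" unfolding w_def by simp
      qed
      have "w - x = (y - x) / (real m + 1) * m" by (simp add: w_def)
      also have "\<dots> < \<eta> * m"
        using Suc.prems False by (intro mult_strict_right_mono) (auto simp: field_simps)
      finally have 1: "w - x < m * \<eta>" by (simp add: mult.commute)
      have "y - w = (y - x) / (real m + 1)" by (simp add: w_def field_simps)
      also have "\<dots> < \<eta>"
        using Suc.prems by (auto simp: field_simps)
      finally have 2: "y - w < \<eta>" .
      obtain s1 s2 where s12: "s1 \<in> variation_sums f x w" "s2 \<in> variation_sums f w y" "s \<le> s1 + s2"
        using variation_sums_split[OF Suc.prems(5) w] by metis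
      have "s1 \<le> m" using Suc.IH[OF _ w(1) _ 1 s12(1)] Suc.prems w by simp
      moreover have "s2 \<le> 1"
      proof -
        obtain n c d where s: "s2 = (\<Sum>i<n::nat. \<bar>f (d i) - f (c i)\<bar>)" and no: "nonoverlapping c d {..<n} {w..y}"
          using s12(2) unfolding variation_sums_def by blast
        have "(\<Sum>i<n. d i - c i) \<le> y - w"
          using sum_lengths_le_measure[OF no] w by simp
        then show ?thesis
          using \<eta>(2)[OF nonoverlapping_mono[OF no]] Suc.prems w 2 s by fastforce
      qed
      ultimately show ?thesis using s12(3) by simp
    qed
  qed simp
  obtain m::nat where "(y - x) / \<eta> < real m" using reals_Archimedean2 by blast
  then have "y - x < real m * \<eta>" using \<eta>(1) by (simp add: field_simps)
  then show ?thesis using *[OF assms(2-4)] by (auto intro!: bdd_aboveI)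
qed

lemma variation_subadditive:
  assumes "abs_continuous_on {a..b} f" "a \<le> x" "x \<le> y" "y \<le> z" "z \<le> b"
  shows "variation f x z \<le> variation f x y + variation f y z"
  unfolding variation_def
proof (rule cSup_least[OF variation_sums_nonempty])
  fix s assume "s \<in> variation_sums f x z"
  then obtain s1 s2 where s12: "s1 \<in> variation_sums f x y" "s2 \<in> variation_sums f y z" "s \<le> s1 + s2"
    using variation_sums_split assms by metis
  have "s1 \<le> Sup (variation_sums f x y)" "s2 \<le> Sup (variation_sums f y z)"
    using s12 assms by (auto intro!: cSup_upper bdd_above_variation_sums[OF assms(1)])
  then show "s \<le> Sup (variation_sums f x y) + Sup (variation_sums f y z)" using s12 by simp
qed

text \<open>The interval [x,y] is appended to a family on [a,x]. With V the variation from a, the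
  inequality makes both V and V - f nondecreasing, which is what the splitting of f into monotone
  parts needs.\<close>

lemma variation_add_increment_le:
  assumes "abs_continuous_on {a..b} f" "a \<le> x" "x \<le> y" "y \<le> b"
  shows "variation f a x + \<bar>f y - f x\<bar> \<le> variation f a y"
proof -
  have "variation f a x \<le> variation f a y - \<bar>f y - f x\<bar>"
    unfolding variation_def[of f a x]
  proof (rule cSup_least[OF variation_sums_nonempty])
    fix s assume "s \<in> variation_sums f a x"
    then obtain n c d where s: "s = (\<Sum>i<n::nat. \<bar>f (d i) - f (c i)\<bar>)" and no: "nonoverlapping c d {..<n} {a..x}"
      unfolding variation_sums_def by blast
    have sub: "c i \<le> d i \<and> a \<le> c i \<and> d i \<le> x" if "i < n" for i
      using no that unfolding nonoverlapping_def by fastforce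
    have "nonoverlapping (c(n := x)) (d(n := y)) {..<Suc n} {a..y}"
      unfolding nonoverlapping_def
    proof (intro conjI ballI)
      show "disjoint_family_on (\<lambda>i. {(c(n := x)) i<..<(d(n := y)) i}) {..<Suc n}"
        unfolding disjoint_family_on_def
      proof (intro ballI impI)
        fix i j assume ij: "i \<in> {..<Suc n}" "j \<in> {..<Suc n}" "i \<noteq> j"
        consider "i < n" "j < n" | "i = n" "j < n" | "i < n" "j = n" using ij by fastforce
        then show "{(c(n := x)) i<..<(d(n := y)) i} \<inter> {(c(n := x)) j<..<(d(n := y)) j} = {}"
        proof cases
          case 1 then show ?thesis using no ij unfolding nonoverlapping_def disjoint_family_on_def by auto
        next
          case 2 then show ?thesis using sub[of j] by auto
        next
          case 3 then show ?thesis using sub[of i] by auto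
        qed
      qed
    qed (use sub assms in \<open>force simp: less_Suc_eq\<close>)+
    then have "(\<Sum>i\<in>{..<Suc n}. \<bar>f ((d(n := y)) i) - f ((c(n := x)) i)\<bar>) \<in> variation_sums f a y"
      by (rule variation_sumsI)
    moreover have "(\<Sum>i\<in>{..<Suc n}. \<bar>f ((d(n := y)) i) - f ((c(n := x)) i)\<bar>) = s + \<bar>f y - f x\<bar>"
      by (simp add: s)
    ultimately have "s + \<bar>f y - f x\<bar> \<le> variation f a y"
      unfolding variation_def using assms by (intro cSup_upper bdd_above_variation_sums[OF assms(1)]) auto
    then show "s \<le> variation f a y - \<bar>f y - f x\<bar>" by simp
  qed
  then show ?thesis by simp
qed

text \<open>Each given interval is refined by a family that almost exhausts its variation. The
  refinements together form one nonoverlapping family whose total length does not exceed the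
  original one, so the absolute continuity of f applies to it.\<close>

lemma abs_continuous_on_variation:
  assumes f: "abs_continuous_on {a..b} f"
  shows "abs_continuous_on {a..b} (variation f a)"
  unfolding abs_continuous_on_iff_nonoverlapping
proof (intro allI impI)
  fix \<epsilon> :: real assume "\<epsilon> > 0"
  then obtain \<eta> where \<eta>: "\<eta> > 0" "\<And>(n::nat) c d. nonoverlapping c d {..<n} {a..b} \<Longrightarrow>
        (\<Sum>i<n. d i - c i) < \<eta> \<Longrightarrow> (\<Sum>i<n. \<bar>f (d i) - f (c i)\<bar>) < \<epsilon>/2"
    using f unfolding abs_continuous_on_iff_nonoverlapping by (meson half_gt_zero)
  show "\<exists>\<eta>>0. \<forall>(n::nat) c d. nonoverlapping c d {..<n} {a..b} \<longrightarrow>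
        (\<Sum>i<n. d i - c i) < \<eta> \<longrightarrow> (\<Sum>i<n. \<bar>variation f a (d i) - variation f a (c i)\<bar>) < \<epsilon>"
  proof (intro exI[of _ \<eta>] conjI allI impI \<eta>(1))
    fix n :: nat and c d assume no: "nonoverlapping c d {..<n} {a..b}" and len: "(\<Sum>i<n. d i - c i) < \<eta>"
    have sub: "c i \<le> d i \<and> a \<le> c i \<and> d i \<le> b" if "i < n" for i
      using no that unfolding nonoverlapping_def by fastforce
    \<comment> \<open>The n deficits add up to at most \<epsilon>/2; the summand 1 covers n =
      0.\<close>
    define \<delta> where "\<delta> = \<epsilon> / (2 * (real n + 1))"
    have \<delta>: "\<delta> > 0" using \<open>\<epsilon> > 0\<close> by (simp add: \<delta>_def)
    have "\<exists>m a' b'. nonoverlapping a' b' {..<m::nat} {c i..d i} \<and>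
        variation f (c i) (d i) - \<delta> < (\<Sum>j<m. \<bar>f (b' j) - f (a' j)\<bar>)" if "i < n" for i
    proof -
      have "\<exists>s\<in>variation_sums f (c i) (d i). variation f (c i) (d i) - \<delta> < s"
        unfolding variation_def using sub[OF that] \<delta>
        by (subst less_cSup_iff[symmetric])
          (auto simp: variation_sums_nonempty intro: bdd_above_variation_sums[OF f])
      then show ?thesis unfolding variation_sums_def by blast
    qed
    then obtain m a' b' where ab: "\<And>i. i < n \<Longrightarrow> nonoverlapping (a' i) (b' i) {..<m i::nat} {c i..d i}"
      "\<And>i. i < n \<Longrightarrow> variation f (c i) (d i) - \<delta> < (\<Sum>j<m i. \<bar>f (b' i j) - f (a' i j)\<bar>)"
      by metis
    let ?I = "SIGMA i:{..<n}. {..<m i}"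
    have in_cd: "a' i j \<le> b' i j \<and> {a' i j<..<b' i j} \<subseteq> {c i<..<d i} \<and> c i \<le> a' i j \<and> b' i j \<le> d i" if "i < n" "j < m i" for i j
    proof -
      have "a' i j \<le> b' i j" "{a' i j..b' i j} \<subseteq> {c i..d i}"
        using ab(1)[OF that(1)] that(2) unfolding nonoverlapping_def by auto
      then show ?thesis by auto
    qed
    have "nonoverlapping (\<lambda>(i,j). a' i j) (\<lambda>(i,j). b' i j) ?I {a..b}"
      unfolding nonoverlapping_def
    proof (intro conjI ballI)
      show "disjoint_family_on (\<lambda>x. {case x of (i, j) \<Rightarrow> a' i j<..<case x of (i, j) \<Rightarrow> b' i j}) ?I"
        unfolding disjoint_family_on_def
      proof (intro ballI impI)
        fix x y assume "x \<in> ?I" "y \<in> ?I" "x \<noteq> y"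
        then obtain i j i' j' where ij: "i < n" "j < m i" "i' < n" "j' < m i'" "i = i' \<longrightarrow> j \<noteq> j'"
          and xy: "x = (i, j)" "y = (i', j')" by (cases x, cases y) auto
        have "{a' i j<..<b' i j} \<inter> {a' i' j'<..<b' i' j'} = {}"
        proof (cases "i = i'")
          case True
          then show ?thesis using ab(1)[OF ij(1)] ij unfolding nonoverlapping_def disjoint_family_on_def by auto
        next
          case False
          have "{c i<..<d i} \<inter> {c i'<..<d i'} = {}"
            using no ij False unfolding nonoverlapping_def disjoint_family_on_def by auto
          then show ?thesis using in_cd[OF ij(1,2)] in_cd[OF ij(3,4)] by blast
        qed
        then show "{case x of (i, j) \<Rightarrow> a' i j<..<case x of (i, j) \<Rightarrow> b' i j} \<inter>
            {case y of (i, j) \<Rightarrow> a' i j<..<case y of (i, j) \<Rightarrow> b' i j} = {}"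
          by (simp add: xy)
      qed
    next
      show "finite ?I" by auto
      fix x assume "x \<in> ?I"
      then obtain i j where ij: "x = (i, j)" "i < n" "j < m i" by auto
      show "(case x of (i, j) \<Rightarrow> a' i j) \<le> (case x of (i, j) \<Rightarrow> b' i j)"
        using in_cd ij by simp
      show "{case x of (i, j) \<Rightarrow> a' i j..case x of (i, j) \<Rightarrow> b' i j} \<subseteq> {a..b}"
        using in_cd[OF ij(2,3)] sub[OF ij(2)] ij(1) by auto
    qed
    from nonoverlapping_reindex[OF this] obtain a'' b'' N where N: "nonoverlapping a'' b'' {..<N::nat} {a..b}"
      "\<And>h::real \<Rightarrow> real \<Rightarrow> real. (\<Sum>i<N. h (a'' i) (b'' i)) = (\<Sum>i\<in>?I. h (case i of (i,j) \<Rightarrow> a' i j) (case i of (i,j) \<Rightarrow> b' i j))"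
      by metis
    have N': "(\<Sum>i<N. h (a'' i) (b'' i)) = (\<Sum>i<n. \<Sum>j<m i. h (a' i j) (b' i j))" for h :: "real \<Rightarrow> real \<Rightarrow> real"
      unfolding N(2) by (subst sum.Sigma) (auto intro!: sum.cong)
    have "(\<Sum>i<N. b'' i - a'' i) \<le> (\<Sum>i<n. d i - c i)"
      unfolding N'[of "\<lambda>u v. v - u"]
    proof (rule sum_mono)
      fix i assume "i \<in> {..<n}"
      then show "(\<Sum>j<m i. b' i j - a' i j) \<le> d i - c i"
        using sum_lengths_le_measure[OF ab(1)[of i]] sub[of i] by simp
    qed
    then have small: "(\<Sum>i<n. \<Sum>j<m i. \<bar>f (b' i j) - f (a' i j)\<bar>) < \<epsilon>/2"
      using \<eta>(2)[OF N(1)] len N'[of "\<lambda>u v. \<bar>f v - f u\<bar>"] by linarith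
    have "(\<Sum>i<n. \<bar>variation f a (d i) - variation f a (c i)\<bar>) \<le> (\<Sum>i<n. (\<Sum>j<m i. \<bar>f (b' i j) - f (a' i j)\<bar>) + \<delta>)"
    proof (rule sum_mono)
      fix i assume "i \<in> {..<n}"
      then have i: "i < n" by simp
      have "variation f a (d i) - variation f a (c i) \<le> variation f (c i) (d i)"
        using variation_subadditive[OF f, of a "c i" "d i"] sub[OF i] by auto
      moreover have "variation f a (c i) \<le> variation f a (d i)"
        using variation_add_increment_le[OF f, of "c i" "d i"] sub[OF i] by auto
      ultimately show "\<bar>variation f a (d i) - variation f a (c i)\<bar> \<le> (\<Sum>j<m i. \<bar>f (b' i j) - f (a' i j)\<bar>) + \<delta>"
        using ab(2)[OF i] by simp
    qed
    also have "\<dots> = (\<Sum>i<n. \<Sum>j<m i. \<bar>f (b' i j) - f (a' i j)\<bar>) + n * \<delta>"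
      by (simp add: sum.distrib)
    also have "\<dots> < \<epsilon>/2 + \<epsilon>/2"
    proof -
      have "n * \<delta> \<le> \<epsilon>/2" using \<open>\<epsilon> > 0\<close> by (simp add: \<delta>_def field_simps)
      then show ?thesis using small by linarith
    qed
    finally show "(\<Sum>i<n. \<bar>variation f a (d i) - variation f a (c i)\<bar>) < \<epsilon>" by simp
  qed
qed

lemma abs_continuous_on_diff:
  assumes "abs_continuous_on S f" "abs_continuous_on S g"
  shows "abs_continuous_on S (\<lambda>x. f x - g x)"
  unfolding abs_continuous_on_iff_nonoverlapping
proof (intro allI impI)
  fix \<epsilon> :: real assume "\<epsilon> > 0"
  then obtain \<eta>1 where \<eta>1: "\<eta>1 > 0" "\<And>(n::nat) c d. nonoverlapping c d {..<n} S \<Longrightarrow>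
        (\<Sum>i<n. d i - c i) < \<eta>1 \<Longrightarrow> (\<Sum>i<n. \<bar>f (d i) - f (c i)\<bar>) < \<epsilon>/2"
    using assms(1) unfolding abs_continuous_on_iff_nonoverlapping by (meson half_gt_zero)
  obtain \<eta>2 where \<eta>2: "\<eta>2 > 0" "\<And>(n::nat) c d. nonoverlapping c d {..<n} S \<Longrightarrow>
        (\<Sum>i<n. d i - c i) < \<eta>2 \<Longrightarrow> (\<Sum>i<n. \<bar>g (d i) - g (c i)\<bar>) < \<epsilon>/2"
    using assms(2) \<open>\<epsilon> > 0\<close> unfolding abs_continuous_on_iff_nonoverlapping by (meson half_gt_zero)
  show "\<exists>\<eta>>0. \<forall>(n::nat) c d. nonoverlapping c d {..<n} S \<longrightarrow>
        (\<Sum>i<n. d i - c i) < \<eta> \<longrightarrow> (\<Sum>i<n. \<bar>f (d i) - g (d i) - (f (c i) - g (c i))\<bar>) < \<epsilon>"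
  proof (intro exI[of _ "min \<eta>1 \<eta>2"] conjI allI impI)
    fix n :: nat and c d assume no: "nonoverlapping c d {..<n} S" and len: "(\<Sum>i<n. d i - c i) < min \<eta>1 \<eta>2"
    have "(\<Sum>i<n. \<bar>f (d i) - g (d i) - (f (c i) - g (c i))\<bar>) \<le> (\<Sum>i<n. \<bar>f (d i) - f (c i)\<bar> + \<bar>g (d i) - g (c i)\<bar>)"
      by (rule sum_mono) auto
    also have "\<dots> < \<epsilon>/2 + \<epsilon>/2"
      unfolding sum.distrib using \<eta>1(2)[OF no] \<eta>2(2)[OF no] len by simp
    finally show "(\<Sum>i<n. \<bar>f (d i) - g (d i) - (f (c i) - g (c i))\<bar>) < \<epsilon>" by simp
  qed (use \<eta>1 \<eta>2 in simp)
qed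

lemma abs_continuous_on_imp_continuous_on:
  assumes "abs_continuous_on {a..b} f"
  shows "continuous_on {a..b} f"
  unfolding continuous_on_iff
proof (intro ballI allI impI)
  fix x \<epsilon> :: real assume "x \<in> {a..b}" "\<epsilon> > 0"
  then obtain \<eta> where \<eta>: "\<eta> > 0" "\<And>(n::nat) c d. nonoverlapping c d {..<n} {a..b} \<Longrightarrow>
        (\<Sum>i<n. d i - c i) < \<eta> \<Longrightarrow> (\<Sum>i<n. \<bar>f (d i) - f (c i)\<bar>) < \<epsilon>"
    using assms unfolding abs_continuous_on_iff_nonoverlapping by meson
  show "\<exists>d>0. \<forall>x'\<in>{a..b}. dist x' x < d \<longrightarrow> dist (f x') (f x) < \<epsilon>"
  proof (intro exI[of _ \<eta>] conjI ballI impI \<eta>(1))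
    fix y assume y: "y \<in> {a..b}" "dist y x < \<eta>"
    have "nonoverlapping (\<lambda>_. min x y) (\<lambda>_. max x y) {..<1::nat} {a..b}"
      using y \<open>x \<in> {a..b}\<close> by (auto simp: nonoverlapping_def disjoint_family_on_def)
    from \<eta>(2)[OF this] show "dist (f y) (f x) < \<epsilon>"
      using y by (cases "x \<le> y") (auto simp: dist_real_def min_def max_def)
  qed
qed

section \<open>Stieltjes measures and densities of monotone functions\<close>

lemma nonoverlapping_clamp:
  assumes "nonoverlapping c d I S" "a \<le> b"
  shows "nonoverlapping (\<lambda>i. max a (min b (c i))) (\<lambda>i. max a (min b (d i))) I {a..b}"
    and "(\<Sum>i\<in>I. max a (min b (d i)) - max a (min b (c i))) \<le> (\<Sum>i\<in>I. d i - c i)"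
proof -
  have cd: "\<forall>i\<in>I. c i \<le> d i" using assms by (auto simp: nonoverlapping_def)
  have "{max a (min b (c i))<..<max a (min b (d i))} \<subseteq> {c i<..<d i}" for i by auto
  then have "disjoint_family_on (\<lambda>i. {max a (min b (c i))<..<max a (min b (d i))}) I"
    using assms(1) unfolding nonoverlapping_def disjoint_family_on_def by fast
  then show "nonoverlapping (\<lambda>i. max a (min b (c i))) (\<lambda>i. max a (min b (d i))) I {a..b}"
    using assms cd unfolding nonoverlapping_def by fastforce
  show "(\<Sum>i\<in>I. max a (min b (d i)) - max a (min b (c i))) \<le> (\<Sum>i\<in>I. d i - c i)"
  proof (rule sum_mono)
    fix i assume "i \<in> I"
    then have "c i \<le> d i" using cd by auto
    then show "max a (min b (d i)) - max a (min b (c i)) \<le> d i - c i" by linarith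
  qed
qed

text \<open>A Lebesgue null set is covered by nonoverlapping closed intervals of total length below
  \<eta>. Absolute continuity bounds the Stieltjes measure of every finite part of the cover by
  \<epsilon>, and continuity from below extends this to the whole cover.\<close>

lemma absolutely_continuous_interval_measure:
  fixes G :: "real \<Rightarrow> real"
  assumes mono: "\<And>x y. x \<le> y \<Longrightarrow> G x \<le> G y" and cont: "continuous_on UNIV G"
    and ac: "abs_continuous_on UNIV G"
  shows "absolutely_continuous lborel (interval_measure G)"
  unfolding absolutely_continuous_def
proof
  have Icc: "emeasure (interval_measure G) {x..y} = ennreal (G y - G x)" if "x \<le> y" for x y
    using that emeasure_interval_measure_Icc[OF that mono cont] by simp
  fix N :: "real set" assume N: "N \<in> null_sets lborel"
  then have Nb: "N \<in> sets borel" and Nl: "emeasure lborel N = 0" by (auto simp: null_sets_def)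
  \<comment> \<open>The covering theorem is applied to bounded sets, so N is exhausted by
    boxes.\<close>
  have "N \<inter> cbox (- real m) (real m) \<in> null_sets (interval_measure G)" for m :: nat
  proof -
    let ?S = "N \<inter> cbox (- real m) (real m)"
    have Sb: "?S \<in> sets borel" using Nb by auto
    have "emeasure lborel ?S \<le> emeasure lborel N" using Nb by (intro emeasure_mono) auto
    then have "?S \<in> null_sets lborel" using Nl Sb by (auto simp: null_sets_def)
    then have Sl: "?S \<in> null_sets lebesgue" by (rule null_sets_completionI)
    then have Slm: "?S \<in> lmeasurable" "measure lebesgue ?S = 0"
      using Sl by (auto simp: null_sets_def fmeasurable_def measure_def)
    have "emeasure (interval_measure G) ?S \<le> ennreal \<epsilon>" if "\<epsilon> > 0" for \<epsilon>
    proof -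
      obtain \<eta> where \<eta>: "\<eta> > 0" "\<And>(n::nat) c d. nonoverlapping c d {..<n} UNIV \<Longrightarrow>
        (\<Sum>i<n. d i - c i) < \<eta> \<Longrightarrow> (\<Sum>i<n. \<bar>G (d i) - G (c i)\<bar>) < \<epsilon>"
        using ac \<open>\<epsilon> > 0\<close> unfolding abs_continuous_on_iff_nonoverlapping by meson
      obtain \<D> where D: "countable \<D>"
        "\<And>K. K \<in> \<D> \<Longrightarrow> K \<subseteq> cbox (- real m) (real m) \<and> K \<noteq> {} \<and> (\<exists>c d. K = cbox c d)"
        "pairwise (\<lambda>A B. interior A \<inter> interior B = {}) \<D>"
        "?S \<subseteq> \<Union>\<D>" "\<Union>\<D> \<in> lmeasurable" "measure lebesgue (\<Union>\<D>) \<le> measure lebesgue ?S + \<eta>/2"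
        using measurable_outer_intervals_bounded[OF Slm(1), of "- real m" "real m" "\<eta>/2"] \<eta>(1)
        by (smt (verit) Int_lower2 half_gt_zero)
      define l r where "l K = Inf K" and "r K = Sup K" for K :: "real set"
      have K: "K = {l K..r K} \<and> l K \<le> r K" if "K \<in> \<D>" for K
        using D(2)[OF that] by (auto simp: l_def r_def)
      have fin: "emeasure (interval_measure G) (\<Union>\<F>) \<le> ennreal \<epsilon>" if F: "finite \<F>" "\<F> \<subseteq> \<D>" for \<F>
      proof -
        have no: "nonoverlapping l r \<F> (\<Union>\<D>)"
          unfolding nonoverlapping_def
        proof (intro conjI ballI F(1))
          show "disjoint_family_on (\<lambda>i. {l i<..<r i}) \<F>"
            unfolding disjoint_family_on_def
          proof (intro ballI impI)
            fix A B assume AB: "A \<in> \<F>" "B \<in> \<F>" "A \<noteq> B"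
            then have "interior A \<inter> interior B = {}" using D(3) F(2) by (auto simp: pairwise_def)
            moreover have "interior A = {l A<..<r A}" "interior B = {l B<..<r B}"
              using K AB F(2) by (metis interior_atLeastAtMost_real subsetD)+
            ultimately show "{l A<..<r A} \<inter> {l B<..<r B} = {}" by simp
          qed
        qed (use K F(2) in blast)+
        have "(\<Sum>i\<in>\<F>. r i - l i) < \<eta>"
          using sum_lengths_le_measure[OF no D(5)] D(6) Slm(2) \<eta>(1) by linarith
        moreover obtain a' b' n where n: "nonoverlapping a' b' {..<n::nat} UNIV"
          "\<And>h::real \<Rightarrow> real \<Rightarrow> real. (\<Sum>i<n. h (a' i) (b' i)) = (\<Sum>i\<in>\<F>. h (l i) (r i))"
          using nonoverlapping_reindex[OF nonoverlapping_mono[OF no subset_UNIV]] by metis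
        ultimately have sm: "(\<Sum>i\<in>\<F>. \<bar>G (r i) - G (l i)\<bar>) < \<epsilon>"
          using \<eta>(2)[OF n(1)] n(2)[of "\<lambda>u v. v - u"] n(2)[of "\<lambda>u v. \<bar>G v - G u\<bar>"] by simp
        have Fb: "A \<in> sets (interval_measure G)" if "A \<in> \<F>" for A
          using K[of A] that F(2) by (metis borel_closed closed_atLeastAtMost sets_interval_measure subsetD)
        have "emeasure (interval_measure G) (\<Union>\<F>) = emeasure (interval_measure G) (\<Union>A\<in>\<F>. A)" by simp
        also have "\<dots> \<le> (\<Sum>A\<in>\<F>. emeasure (interval_measure G) A)"
          using Fb F(1) by (intro emeasure_subadditive_finite) auto
        also have "\<dots> = (\<Sum>A\<in>\<F>. ennreal (G (r A) - G (l A)))"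
          using K F(2) by (intro sum.cong refl) (metis Icc subsetD)
        also have "\<dots> = ennreal (\<Sum>A\<in>\<F>. G (r A) - G (l A))"
          using K F(2) mono by (intro sum_ennreal) (auto simp: subset_iff)
        also have "\<dots> \<le> ennreal \<epsilon>"
          using sm sum_mono[of \<F> "\<lambda>i. G (r i) - G (l i)" "\<lambda>i. \<bar>G (r i) - G (l i)\<bar>"] 
          by (intro ennreal_leI) force
        finally show ?thesis .
      qed
      show ?thesis
      proof (cases "\<D> = {}")
        case True
        then have "?S = {}" using D(4) by simp
        then show ?thesis by simp
      next
        case False
        \<comment> \<open>The enumeration repeats elements when the cover is finite; only the
          increasing unions of finite subfamilies matter.\<close>
        let ?A = "\<lambda>n. \<Union>(from_nat_into \<D> ` {..<n::nat})"
        have sub: "from_nat_into \<D> ` {..<n} \<subseteq> \<D>" for n using from_nat_into[OF False] by blast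
        have "(\<Union>n. ?A n) = \<Union>\<D>"
        proof -
          have "\<Union>\<D> = \<Union>(range (from_nat_into \<D>))" using False D(1) by simp
          also have "\<dots> = (\<Union>n. ?A n)" by auto
          finally show ?thesis by simp
        qed
        moreover have Am: "?A n \<in> sets (interval_measure G)" for n
        proof -
          have "A \<in> sets borel" if "A \<in> \<D>" for A
            using K[OF that] by (metis borel_closed closed_atLeastAtMost)
          then show ?thesis using sub[of n] by (auto intro!: sets.finite_UN)
        qed
        moreover have "(SUP n. emeasure (interval_measure G) (?A n)) = emeasure (interval_measure G) (\<Union>n. ?A n)"
          using Am by (intro SUP_emeasure_incseq) (auto simp: incseq_def image_mono Union_mono less_le_trans)
        moreover have DU: "\<Union>\<D> \<in> sets (interval_measure G)"
          by (metis (no_types, lifting) Am \<open>(\<Union>n. ?A n) = \<Union>\<D>\<close> sets.countable_UN image_subset_iff)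
        ultimately have "emeasure (interval_measure G) (\<Union>\<D>) = (SUP n. emeasure (interval_measure G) (?A n))"
          by simp
        also have "\<dots> \<le> ennreal \<epsilon>" using fin sub by (intro SUP_least) auto
        finally show ?thesis
          using emeasure_mono[OF D(4) DU] by simp
      qed
    qed
    then have "emeasure (interval_measure G) ?S \<le> 0 + ennreal \<epsilon>" if "\<epsilon> > 0" for \<epsilon> using that by simp
    then have "emeasure (interval_measure G) ?S \<le> 0"
      by (rule ennreal_le_epsilon)
    then show ?thesis using Sb by (auto simp: null_sets_def)
  qed
  then have "(\<Union>m::nat. N \<inter> cbox (- real m) (real m)) \<in> null_sets (interval_measure G)"
    by (rule null_sets_UN)
  moreover have "(\<Union>m::nat. N \<inter> cbox (- real m) (real m)) = N"
  proof -
    have "\<exists>m::nat. x \<in> cbox (- real m) (real m)" for x :: real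
    proof -
      obtain m :: nat where "\<bar>x\<bar> \<le> real m" using real_arch_simple by blast
      then have "x \<in> cbox (- real m) (real m)" by (auto simp: abs_le_iff)
      then show ?thesis by blast
    qed
    then show ?thesis by blast
  qed
  ultimately show "N \<in> null_sets (interval_measure G)" by simp
qed

lemma abs_continuous_mono_imp_indefinite_integral:
  assumes ac: "abs_continuous_on {a..b} f" and ab: "a \<le> b"
    and mono: "\<And>x y. a \<le> x \<Longrightarrow> x \<le> y \<Longrightarrow> y \<le> b \<Longrightarrow> f x \<le> f y"
  obtains \<phi> where "\<And>x. x \<in> {a..b} \<Longrightarrow> (\<phi> has_integral (f x - f a)) {a..x}"
proof -
  \<comment> \<open>A Stieltjes measure needs a function on the whole line. The constant extension
    stays monotone, and it stays absolutely continuous because its increments are those of f over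
    clamped intervals, which are no longer than the given ones.\<close>
  define G where "G x = f (max a (min b x))" for x
  have acG: "abs_continuous_on UNIV G"
    unfolding abs_continuous_on_iff_nonoverlapping
  proof (intro allI impI)
    fix \<epsilon> :: real assume "\<epsilon> > 0"
    then obtain \<eta> where \<eta>: "\<eta> > 0" "\<And>(n::nat) c d. nonoverlapping c d {..<n} {a..b} \<Longrightarrow>
        (\<Sum>i<n. d i - c i) < \<eta> \<Longrightarrow> (\<Sum>i<n. \<bar>f (d i) - f (c i)\<bar>) < \<epsilon>"
      using ac unfolding abs_continuous_on_iff_nonoverlapping by meson
    show "\<exists>\<eta>>0. \<forall>(n::nat) c d. nonoverlapping c d {..<n} UNIV \<longrightarrow>
        (\<Sum>i<n. d i - c i) < \<eta> \<longrightarrow> (\<Sum>i<n. \<bar>G (d i) - G (c i)\<bar>) < \<epsilon>"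
      unfolding G_def
      by (intro exI[of _ \<eta>] conjI allI impI \<eta>(1) \<eta>(2) nonoverlapping_clamp(1)[OF _ ab])
        (auto dest: nonoverlapping_clamp(2)[OF _ ab])
  qed
  have contG: "continuous_on UNIV G"
    unfolding G_def
    by (rule continuous_on_compose2[OF abs_continuous_on_imp_continuous_on[OF ac]])
      (use ab in \<open>auto intro!: continuous_intros\<close>)
  have monoG: "G x \<le> G y" if "x \<le> y" for x y
    unfolding G_def using that ab by (intro mono) auto
  have rc: "\<And>x. continuous (at_right x) G"
    using contG by (simp add: continuous_on_eq_continuous_at continuous_at_imp_continuous_at_within)
  from absolutely_continuous_interval_measure[OF monoG contG acG]
  obtain h where h: "h \<in> borel_measurable lborel" "density lborel h = interval_measure G"
    using sigma_finite_measure.Radon_Nikodym[OF sigma_finite_lborel, of "interval_measure G"] by auto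
  define \<phi> where "\<phi> x = enn2real (h x)" for x
  have \<phi>m: "\<phi> \<in> borel_measurable lborel" using h(1) unfolding \<phi>_def by simp
  have nn: "(\<integral>\<^sup>+ t. h t * indicator {a<..x} t \<partial>lborel) = ennreal (f x - f a)" if "x \<in> {a..b}" for x
  proof -
    have "(\<integral>\<^sup>+ t. h t * indicator {a<..x} t \<partial>lborel) = emeasure (density lborel h) {a<..x}"
      using h(1) by (subst emeasure_density) auto
    also have "\<dots> = ennreal (G x - G a)"
      unfolding h(2) using that by (intro emeasure_interval_measure_Ioc monoG rc) auto
    finally show ?thesis using that by (simp add: G_def)
  qed
  \<comment> \<open>\<open>enn2real\<close> sends \<infinity> to 0, so passing to a real density
    loses no mass only because h is finite almost everywhere on (a,b].\<close>
  have fin: "AE t in lborel. t \<in> {a<..b} \<longrightarrow> h t < \<infinity>"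
  proof -
    have "AE t in lborel. h t * indicator {a<..b} t \<noteq> \<infinity>"
      using nn[of b] ab h(1) by (intro nn_integral_PInf_AE) auto
    then show ?thesis by eventually_elim (auto simp: less_top)
  qed
  have "(\<phi> has_integral (f x - f a)) {a..x}" if x: "x \<in> {a..b}" for x
  proof -
    have "(\<integral>\<^sup>+ t. ennreal (\<phi> t * indicator {a<..x} t) \<partial>lborel) = (\<integral>\<^sup>+ t. h t * indicator {a<..x} t \<partial>lborel)"
    proof (rule nn_integral_cong_AE)
      show "AE t in lborel. ennreal (\<phi> t * indicator {a<..x} t) = h t * indicator {a<..x} t"
        using fin by eventually_elim (use x in \<open>auto simp: \<phi>_def indicator_def\<close>)
    qed
    then have nx: "(\<integral>\<^sup>+ t. ennreal (\<phi> t * indicator {a<..x} t) \<partial>lborel) = ennreal (f x - f a)"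
      using nn[OF x] by simp
    have "((\<lambda>t. \<phi> t * indicator {a<..x} t) has_integral (f x - f a)) UNIV"
    proof (rule nn_integral_has_integral[OF _ _ nx])
      show "(\<lambda>t. \<phi> t * indicator {a<..x} t) \<in> borel_measurable borel"
        using \<phi>m by simp
      show "0 \<le> \<phi> t * indicator {a<..x} t" for t by (simp add: \<phi>_def)
      show "0 \<le> f x - f a" using x mono[of a x] by simp
    qed
    then have "((\<lambda>t. if t \<in> {a<..x} then \<phi> t else 0) has_integral (f x - f a)) UNIV"
      by (rule has_integral_eq[rotated]) (auto simp: indicator_def)
    then have "(\<phi> has_integral (f x - f a)) {a<..x}" by (simp only: has_integral_restrict_UNIV)
    then show ?thesis
      by (rule has_integral_spike_set_eq[THEN iffD1, rotated 2]) (auto intro: negligible_subset[of "{a}"])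
  qed
  then show thesis by (rule that)
qed

text \<open>\<open>integrable_ccontinuous_explicit\<close> concerns averages over [x, x + h] only.
  The left-hand difference quotients of f at x are such averages of the reflected integrand at
  -x.\<close>

lemma indefinite_integral_deriv_ae:
  assumes ab: "a \<le> b" and \<phi>: "\<And>x. x \<in> {a..b} \<Longrightarrow> (\<phi> has_integral (f x - f a)) {a..x}"
  obtains N where "negligible N" "\<And>x. x \<in> {a<..<b} - N \<Longrightarrow> (f has_real_derivative \<phi> x) (at x)"
proof -
  \<comment> \<open>The zero extension is integrable on every box, as the differentiation theorem
    demands.\<close>
  define \<psi> where "\<psi> x = (if x \<in> {a..b} then \<phi> x else 0)" for x
  have "\<phi> integrable_on {a..b}" using \<phi>[of b] ab by auto
  then have "\<psi> integrable_on UNIV"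
    unfolding \<psi>_def by (simp only: integrable_restrict_UNIV)
  then have int: "\<psi> integrable_on cbox c d" for c d by (rule integrable_on_subcbox) auto
  have int': "(\<lambda>x. \<psi> (- x)) integrable_on cbox c d" for c d
    using Henstock_Kurzweil_Integration.integrable_reflect_real[of \<psi> "-c" "-d", THEN iffD2] int[of "-d" "-c"]
    by (simp only: minus_minus box_real)
  have incr: "integral {x..y} \<psi> = f y - f x" if "a \<le> x" "x \<le> y" "y \<le> b" for x y
  proof -
    have "(\<phi> has_integral (f y - f a)) {a..y}" "(\<phi> has_integral (f x - f a)) {a..x}" using \<phi> that by auto
    then have "integral {a..x} \<phi> + integral {x..y} \<phi> = integral {a..y} \<phi>"
      using that by (intro Henstock_Kurzweil_Integration.integral_combine) auto
    moreover have "integral {a..x} \<phi> = f x - f a" "integral {a..y} \<phi> = f y - f a" 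
      using \<phi> that by (auto intro!: integral_unique)
    moreover have "integral {x..y} \<phi> = integral {x..y} \<psi>"
      using that by (intro integral_cong) (auto simp: \<psi>_def)
    ultimately show ?thesis by simp
  qed
  obtain N1 where N1: "negligible N1" "\<And>x e. \<lbrakk>x \<notin> N1; 0 < e\<rbrakk> \<Longrightarrow>
     \<exists>d>0. \<forall>h. 0 < h \<and> h < d \<longrightarrow> norm(integral (cbox x (x + h *\<^sub>R One)) \<psi> /\<^sub>R h ^ DIM(real) - \<psi> x) < e"
    using integrable_ccontinuous_explicit[OF int] by blast
  obtain N2 where N2: "negligible N2" "\<And>x e. \<lbrakk>x \<notin> N2; 0 < e\<rbrakk> \<Longrightarrow>
     \<exists>d>0. \<forall>h. 0 < h \<and> h < d \<longrightarrow> norm(integral (cbox x (x + h *\<^sub>R One)) (\<lambda>x. \<psi> (- x)) /\<^sub>R h ^ DIM(real) - \<psi> (- x)) < e"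
    using integrable_ccontinuous_explicit[OF int'] by blast
  show thesis
  proof
    show "negligible (N1 \<union> uminus ` N2)"
      using N1(1) N2(1) by (auto intro!: negligible_Un negligible_differentiable_image_negligible derivative_intros)
    fix x assume x: "x \<in> {a<..<b} - (N1 \<union> uminus ` N2)"
    then have x2: "- x \<notin> N2" by (metis DiffE UnI2 image_eqI verit_minus_simplify(4))
    have "((\<lambda>h. (f (x + h) - f x) / h) \<longlongrightarrow> \<phi> x) (at 0)"
      unfolding LIM_eq
    proof (intro allI impI)
      fix e :: real assume "0 < e"
      obtain d1 where d1: "d1 > 0" "\<And>h. 0 < h \<and> h < d1 \<Longrightarrow> \<bar>integral {x..x+h} \<psi> / h - \<psi> x\<bar> < e"
        using N1(2)[OF _ \<open>0 < e\<close>, of x] x by (auto simp: divide_inverse_commute)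
      obtain d2 where d2: "d2 > 0" "\<And>h. 0 < h \<and> h < d2 \<Longrightarrow> \<bar>integral {-x..-x+h} (\<lambda>x. \<psi> (- x)) / h - \<psi> x\<bar> < e"
        using N2(2)[OF x2 \<open>0 < e\<close>] by (auto simp: divide_inverse_commute)
      show "\<exists>s>0. \<forall>h. h \<noteq> 0 \<and> norm (h - 0) < s \<longrightarrow> norm ((f (x + h) - f x) / h - \<phi> x) < e"
      proof (intro exI[of _ "Min {d1, d2, x - a, b - x}"] conjI allI impI)
        show "0 < Min {d1, d2, x - a, b - x}" using d1 d2 x by auto
        fix h :: real assume h: "h \<noteq> 0 \<and> norm (h - 0) < Min {d1, d2, x - a, b - x}"
        have \<psi>x: "\<psi> x = \<phi> x" using x by (auto simp: \<psi>_def)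
        show "norm ((f (x + h) - f x) / h - \<phi> x) < e"
        proof (cases "h > 0")
          case True
          then show ?thesis using d1(2)[of h] h x incr[of x "x + h"] \<psi>x by auto
        next
          case False
          have "integral {-x..-x+(-h)} (\<lambda>x. \<psi> (- x)) = integral {x+h..x} \<psi>"
            using Henstock_Kurzweil_Integration.integral_reflect_real[of x "x + h" \<psi>] by simp
          also have "\<dots> = f x - f (x + h)" using False h x by (intro incr) auto
          finally have "integral {-x..-x+(-h)} (\<lambda>x. \<psi> (- x)) / (-h) = (f (x + h) - f x) / h"
            using h by (simp add: field_simps)
          then show ?thesis using d2(2)[of "-h"] False h \<psi>x by auto
        qed
      qed
    qed
    then show "(f has_real_derivative \<phi> x) (at x)" by (simp add: DERIV_def)
  qed
qed

text \<open>Both terms of \<open>f = V - (V - f)\<close>, with \<open>V\<close> the variation of \<open>f\<close>, are monotone and absolutely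
  continuous, so they are indefinite integrals of Radon-Nikodym densities, and Lebesgue's
  differentiation theorem identifies the difference of the densities with the derivative.\<close>

theorem abs_continuous_deriv_has_integral:
  assumes ac: "abs_continuous_on {a..b} f" and ab: "a \<le> b"
  shows "(deriv f has_integral (f b - f a)) {a..b}"
proof -
  have monoV: "variation f a x \<le> variation f a y" "variation f a x - f x \<le> variation f a y - f y"
    if "a \<le> x" "x \<le> y" "y \<le> b" for x y
    using variation_add_increment_le[OF ac that] by auto
  obtain \<phi>1 where \<phi>1: "\<And>x. x \<in> {a..b} \<Longrightarrow> (\<phi>1 has_integral (variation f a x - variation f a a)) {a..x}"
    using abs_continuous_mono_imp_indefinite_integral[OF abs_continuous_on_variation[OF ac] ab monoV(1)] by blast
  obtain \<phi>2 where \<phi>2: "\<And>x. x \<in> {a..b} \<Longrightarrow> (\<phi>2 has_integral ((variation f a x - f x) - (variation f a a - f a))) {a..x}"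
    using abs_continuous_mono_imp_indefinite_integral
      [OF abs_continuous_on_diff[OF abs_continuous_on_variation[OF ac] ac] ab monoV(2)] by blast
  have \<phi>: "((\<lambda>x. \<phi>1 x - \<phi>2 x) has_integral (f x - f a)) {a..x}" if "x \<in> {a..b}" for x
    using has_integral_diff[OF \<phi>1[OF that] \<phi>2[OF that]] by (simp add: algebra_simps)
  obtain N where N: "negligible N" "\<And>x. x \<in> {a<..<b} - N \<Longrightarrow> (f has_real_derivative (\<phi>1 x - \<phi>2 x)) (at x)"
    using indefinite_integral_deriv_ae[OF ab \<phi>] by blast
  show ?thesis
  proof (rule has_integral_spike[OF _ _ \<phi>])
    show "negligible (N \<union> {a, b})" using N(1) by (simp add: negligible_Un)
    show "deriv f x = \<phi>1 x - \<phi>2 x" if "x \<in> {a..b} - (N \<union> {a, b})" for x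
      using that by (intro DERIV_imp_deriv N(2)) auto
  qed (use ab in auto)
qed

section \<open>Bounded positive operators\<close>

lemmas blinfun_compose_simps =
  bounded_bilinear.add_left[OF bounded_bilinear_blinfun_compose]
  bounded_bilinear.add_right[OF bounded_bilinear_blinfun_compose]
  bounded_bilinear.diff_left[OF bounded_bilinear_blinfun_compose]
  bounded_bilinear.diff_right[OF bounded_bilinear_blinfun_compose]
  bounded_bilinear.scaleR_left[OF bounded_bilinear_blinfun_compose]
  bounded_bilinear.scaleR_right[OF bounded_bilinear_blinfun_compose]

lemma blinfun_compose_id [simp]: "id_blinfun o\<^sub>L a = a" "a o\<^sub>L id_blinfun = a"
  by (auto intro: blinfun_eqI)

lemma blinfun_compose_assoc: "(a o\<^sub>L b) o\<^sub>L c = a o\<^sub>L (b o\<^sub>L c)"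
  by (auto intro: blinfun_eqI)

section \<open>Orthogonal projection and the inverse of a strictly positive operator\<close>

lemma orthogonal_projection_exists:
  fixes M :: "'a::{real_inner, complete_space} set"
  assumes M: "subspace M" "closed M"
  obtains m where "m \<in> M" "\<And>y. y \<in> M \<Longrightarrow> (x - m) \<bullet> y = 0"
proof -
  define D where "D = (\<lambda>m. (norm (x - m))\<^sup>2) ` M"
  define d where "d = Inf D"
  have "0 \<in> M" using M(1) by (rule subspace_0)
  then have Dne: "D \<noteq> {}" and bdd: "bdd_below D" by (auto simp: D_def intro!: bdd_belowI[of _ 0])
  have d_le: "d \<le> (norm (x - m))\<^sup>2" if "m \<in> M" for m
    unfolding d_def using that bdd by (intro cInf_lower) (auto simp: D_def)
  have "\<exists>m\<in>M. (norm (x - m))\<^sup>2 < d + 1 / (real n + 1)" for n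
  proof -
    have "Inf D < d + 1 / (real n + 1)" unfolding d_def by (simp add: add_pos_nonneg)
    then show ?thesis using cInf_lessD[OF Dne, of "d + 1 / (real n + 1)"] by (auto simp: D_def)
  qed
  then obtain s where s: "\<And>n. s n \<in> M" "\<And>n. (norm (x - s n))\<^sup>2 < d + 1 / (real n + 1)" by metis
  \<comment> \<open>Parallelogram identity for x - s n and x - s k; the midpoint of s n and s k lies
    in M, so its squared distance from x is at least d.\<close>
  have par: "(norm (s n - s k))\<^sup>2 \<le> 2 / (real n + 1) + 2 / (real k + 1)" for n k
  proof -
    have mid: "(1/2) *\<^sub>R (s n + s k) \<in> M" using s(1) M(1) by (intro subspace_scale subspace_add)
    have "(norm (s n - s k))\<^sup>2 = 2 * (norm (x - s n))\<^sup>2 + 2 * (norm (x - s k))\<^sup>2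
        - 4 * (norm (x - (1/2) *\<^sub>R (s n + s k)))\<^sup>2"
      by (simp add: power2_norm_eq_inner inner_simps inner_commute algebra_simps)
    then show ?thesis using d_le[OF mid] s(2)[of n] s(2)[of k] by (simp add: algebra_simps)
  qed
  have "Cauchy s"
    unfolding Cauchy_def
  proof (intro allI impI)
    fix e :: real assume "e > 0"
    then obtain N :: nat where N: "4 / e\<^sup>2 < real N" using reals_Archimedean2 by blast
    have small: "2 / (real n + 1) < e\<^sup>2 / 2" if "n \<ge> N" for n
    proof -
      have "4 / e\<^sup>2 < real n + 1" using N that by linarith
      then show ?thesis using \<open>e > 0\<close> by (simp add: field_simps)
    qed
    show "\<exists>N. \<forall>m\<ge>N. \<forall>n\<ge>N. dist (s m) (s n) < e"
    proof (intro exI[of _ N] allI impI)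
      fix m n assume "m \<ge> N" "n \<ge> N"
      then have "(norm (s m - s n))\<^sup>2 < e\<^sup>2" using par[of m n] small[of m] small[of n] by linarith
      then show "dist (s m) (s n) < e" using \<open>e > 0\<close> by (simp add: dist_norm power_less_imp_less_base)
    qed
  qed
  then obtain m where lim: "s \<longlonglongrightarrow> m" using Cauchy_convergent convergent_def by blast
  have mM: "m \<in> M" using closed_sequentially[OF M(2)] s(1) lim by blast
  have "(\<lambda>n. (norm (x - s n))\<^sup>2) \<longlonglongrightarrow> (norm (x - m))\<^sup>2" by (intro tendsto_intros lim)
  moreover have "(\<lambda>n. d + 1 / (real n + 1)) \<longlonglongrightarrow> d + 0"
    using LIMSEQ_inverse_real_of_nat by (intro tendsto_intros) (simp add: inverse_eq_divide add.commute)
  ultimately have "(norm (x - m))\<^sup>2 \<le> d"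
    using s(2) by (intro LIMSEQ_le) (auto intro: less_imp_le)
  then have min: "(norm (x - m))\<^sup>2 \<le> (norm (x - m'))\<^sup>2" if "m' \<in> M" for m' using d_le[OF that] by linarith
  show thesis
  proof (rule that[OF mM])
    fix y assume y: "y \<in> M"
    show "(x - m) \<bullet> y = 0"
    proof (cases "y = 0")
      case False
      \<comment> \<open>The minimizer of |x - m - t y|^2 in t; unless t = 0 it would lead to a point
        closer to x than m.\<close>
      define t where "t = ((x - m) \<bullet> y) / (y \<bullet> y)"
      have "m + t *\<^sub>R y \<in> M" using mM y M(1) by (intro subspace_add subspace_scale)
      from min[OF this] have "0 \<le> t * t * (y \<bullet> y) - 2 * t * ((x - m) \<bullet> y)"
        by (simp add: power2_norm_eq_inner inner_simps inner_commute algebra_simps)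
      also have "\<dots> = - (((x - m) \<bullet> y)\<^sup>2 / (y \<bullet> y))"
        using False by (simp add: t_def field_simps power2_eq_square)
      finally have "y \<bullet> y \<le> 0 \<or> (x - m) \<bullet> y = 0" by (simp add: divide_le_0_iff)
      then show ?thesis using False inner_gt_zero_iff[of y] by linarith
    qed simp
  qed
qed

lemma closed_subspace_eq_UNIV:
  fixes M :: "'a::{real_inner, complete_space} set"
  assumes "subspace M" "closed M" "\<And>z. (\<And>y. y \<in> M \<Longrightarrow> z \<bullet> y = 0) \<Longrightarrow> z = 0"
  shows "M = UNIV"
proof -
  have "x \<in> M" for x
  proof -
    obtain m where "m \<in> M" "\<And>y. y \<in> M \<Longrightarrow> (x - m) \<bullet> y = 0"
      using orthogonal_projection_exists[OF assms(1,2)] by blast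
    then have "x - m = 0" by (intro assms(3))
    then show ?thesis using \<open>m \<in> M\<close> by simp
  qed
  then show ?thesis by blast
qed

text \<open>Strict positivity gives c |u| \<le> |y| on the graph, hence injectivity and a closed
  range. A vector orthogonal to the range lies in the kernel of the adjoint, which is A itself, so
  the range is everything.\<close>

lemma strictly_positive_selfadjoint_inverse:
  fixes A :: "'a::{real_inner, complete_space} operator"
  assumes sa: "selfadjoint A" and sp: "strictly_positive A"
  obtains b where "bounded_linear b" "\<And>u y. (u, y) \<in> A \<longleftrightarrow> u = b y"
    "\<And>x y. b x \<bullet> y = x \<bullet> b y" "\<And>y. 0 \<le> b y \<bullet> y"
proof -
  obtain c where c: "c > 0" "\<And>u y. (u, y) \<in> A \<Longrightarrow> c * (norm u)\<^sup>2 \<le> y \<bullet> u"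
    using sp unfolding strictly_positive_def by (metis (mono_tags, lifting) case_prodD)
  have sub: "subspace A" and sv: "single_valued A" and adj: "adjoint_operator A = A"
    using sa by (auto simp: selfadjoint_def linear_operator_def)
  have A_iff: "(v, w) \<in> A \<longleftrightarrow> (\<forall>u y. (u, y) \<in> A \<longrightarrow> y \<bullet> v = u \<bullet> w)" for v w
  proof -
    have "(v, w) \<in> A \<longleftrightarrow> (v, w) \<in> adjoint_operator A" by (simp only: adj)
    then show ?thesis by (auto simp: adjoint_operator_def)
  qed
  have bound: "c * norm u \<le> norm y" if "(u, y) \<in> A" for u y
  proof (cases "u = 0")
    case False
    have "c * (norm u)\<^sup>2 \<le> norm y * norm u"
      using c(2)[OF that] norm_cauchy_schwarz[of y u] by linarith
    then show ?thesis using False by (simp add: power2_eq_square)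
  qed simp
  have "subspace (Range A)"
  proof (rule subspaceI)
    show "0 \<in> Range A" using subspace_0[OF sub] by (auto simp: zero_prod_def)
    fix x y assume "x \<in> Range A" "y \<in> Range A"
    then obtain a b where "(a, x) \<in> A" "(b, y) \<in> A" by blast
    from subspace_add[OF sub this] show "x + y \<in> Range A" by auto
  next
    fix k x assume "x \<in> Range A"
    then obtain a where "(a, x) \<in> A" by blast
    from subspace_scale[OF sub this, of k] show "k *\<^sub>R x \<in> Range A" by auto
  qed
  moreover have "closed (Range A)"
    unfolding closed_sequential_limits
  proof (intro allI impI, elim conjE)
    fix s l assume "\<forall>n. s n \<in> Range A" and lim: "s \<longlonglongrightarrow> l"
    then have "\<forall>n. \<exists>u. (u, s n) \<in> A" by blast
    then obtain u where u: "\<And>n. (u n, s n) \<in> A" by metis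
    have "Cauchy u"
      unfolding Cauchy_def
    proof (intro allI impI)
      fix e :: real assume "e > 0"
      then have "0 < c * e" using c(1) by simp
      then obtain N where N: "\<And>m n. m \<ge> N \<Longrightarrow> n \<ge> N \<Longrightarrow> dist (s m) (s n) < c * e"
        using metric_CauchyD[OF LIMSEQ_imp_Cauchy[OF lim]] by blast
      have "dist (u m) (u n) < e" if "m \<ge> N" "n \<ge> N" for m n
      proof -
        have "(u m - u n, s m - s n) \<in> A" using subspace_diff[OF sub u u, of m n] by simp
        from bound[OF this] have "c * norm (u m - u n) < c * e" using N[OF that] by (simp add: dist_norm)
        then show ?thesis using c(1) by (simp add: dist_norm)
      qed
      then show "\<exists>N. \<forall>m\<ge>N. \<forall>n\<ge>N. dist (u m) (u n) < e" by blast
    qed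
    then have "convergent u" by (rule Cauchy_convergent)
    then obtain v where v: "u \<longlonglongrightarrow> v" by (auto simp: convergent_def)
    \<comment> \<open>The adjoint relation is preserved under limits of graph elements, so a
      selfadjoint operator is closed.\<close>
    have "(v, l) \<in> A"
    proof (rule A_iff[THEN iffD2], intro allI impI)
      fix a y assume ay: "(a, y) \<in> A"
      have "(\<lambda>n. y \<bullet> u n) \<longlonglongrightarrow> y \<bullet> v" "(\<lambda>n. a \<bullet> s n) \<longlonglongrightarrow> a \<bullet> l"
        by (intro tendsto_intros v lim)+
      moreover have "y \<bullet> u n = a \<bullet> s n" for n using A_iff[THEN iffD1, OF u[of n]] ay by blast
      ultimately show "y \<bullet> v = a \<bullet> l" using LIMSEQ_unique by simp
    qed
    then show "l \<in> Range A" by blast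
  qed
  moreover have "z = 0" if "\<And>y. y \<in> Range A \<Longrightarrow> z \<bullet> y = 0" for z
  proof -
    have "(z, 0) \<in> A" by (rule A_iff[THEN iffD2]) (use that in \<open>auto simp: inner_commute\<close>)
    from bound[OF this] have "c * norm z \<le> 0" by simp
    then show "z = 0" using c(1) by (simp add: mult_le_0_iff)
  qed
  ultimately have range: "Range A = UNIV" by (rule closed_subspace_eq_UNIV)
  have inj: "u = v" if "(u, y) \<in> A" "(v, y) \<in> A" for u v y
  proof -
    have "(u - v, 0) \<in> A" using subspace_diff[OF sub that] by simp
    from bound[OF this] have "c * norm (u - v) \<le> 0" by simp
    then show ?thesis using c(1) by (simp add: mult_le_0_iff)
  qed
  define b where "b y = (THE u. (u, y) \<in> A)" for y
  have b: "(b y, y) \<in> A" for y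
  proof -
    obtain u where "(u, y) \<in> A" using range by blast
    then show ?thesis unfolding b_def using inj by (metis theI)
  qed
  have lin: "bounded_linear b"
  proof (rule bounded_linear_intro[of b "1/c"])
    show "b (x + y) = b x + b y" for x y
      using inj[OF b] subspace_add[OF sub b[of x] b[of y]] by simp
    show "b (r *\<^sub>R x) = r *\<^sub>R b x" for r x
      using inj[OF b] subspace_scale[OF sub b[of x], of r] by simp
    show "norm (b x) \<le> norm x * (1 / c)" for x
      using bound[OF b[of x]] c(1) by (simp add: field_simps)
  qed
  show thesis
  proof (rule that[OF lin])
    show "(u, y) \<in> A \<longleftrightarrow> u = b y" for u y using b inj by blast
    show "b x \<bullet> y = x \<bullet> b y" for x y
      using A_iff[THEN iffD1, OF b[of y]] b[of x] by metis
    show "0 \<le> b y \<bullet> y" for y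
      using order_trans[OF _ c(2)[OF b[of y]], of 0] c(1) by (simp add: inner_commute)
  qed
qed

section \<open>Positive bounded operators and their square roots\<close>

definition positive_blinfun :: "('a::real_inner \<Rightarrow>\<^sub>L 'a) \<Rightarrow> bool" where
  "positive_blinfun T \<longleftrightarrow> (\<forall>x y. T x \<bullet> y = x \<bullet> T y) \<and> (\<forall>x. 0 \<le> T x \<bullet> x)"

lemma positive_blinfunD:
  assumes "positive_blinfun T"
  shows "T x \<bullet> y = x \<bullet> T y" "0 \<le> T x \<bullet> x" "0 \<le> x \<bullet> T x"
  using assms by (auto simp: positive_blinfun_def inner_commute)

text \<open>The quadratic polynomial given by T(x + t y) \<bullet> (x + t y) in t is nonnegative, so
  its discriminant is not positive.\<close>

lemma positive_blinfun_cauchy_schwarz: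
  assumes "positive_blinfun T"
  shows "(T x \<bullet> y)\<^sup>2 \<le> (T x \<bullet> x) * (T y \<bullet> y)"
proof -
  let ?a = "T x \<bullet> x" and ?b = "T x \<bullet> y" and ?c = "T y \<bullet> y"
  have q: "0 \<le> ?a + 2 * t * ?b + t\<^sup>2 * ?c" for t
  proof -
    have "T y \<bullet> x = ?b" using assms by (simp add: positive_blinfun_def inner_commute)
    then have "T (x + t *\<^sub>R y) \<bullet> (x + t *\<^sub>R y) = ?a + 2 * t * ?b + t\<^sup>2 * ?c"
      by (simp add: blinfun.bilinear_simps inner_simps power2_eq_square algebra_simps)
    then show ?thesis using positive_blinfunD(2)[OF assms, of "x + t *\<^sub>R y"] by simp
  qed
  have c: "0 \<le> ?c" by (rule positive_blinfunD[OF assms])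
  show ?thesis
  proof (cases "?c = 0")
    case True
    have "?b = 0"
    proof (rule ccontr)
      assume "?b \<noteq> 0"
      \<comment> \<open>At this t the linear polynomial that is left takes the value -1.\<close>
      then show False using q[of "- (?a + 1) / (2 * ?b)"] True by (simp add: field_simps)
    qed
    then show ?thesis using True by simp
  next
    case False
    have "0 \<le> ?c * (?a + 2 * (- ?b / ?c) * ?b + (- ?b / ?c)\<^sup>2 * ?c)"
      using q c by (intro mult_nonneg_nonneg)
    also have "\<dots> = ?a * ?c - ?b\<^sup>2" using False by (simp add: field_simps power2_eq_square)
    finally show ?thesis by simp
  qed
qed

lemma positive_blinfun_eq_0:
  assumes "positive_blinfun T" "T x \<bullet> x = 0"
  shows "T x = 0"
  using positive_blinfun_cauchy_schwarz[OF assms(1), of x "T x"] assms(2) by simp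

text \<open>Cauchy-Schwarz for the form of T, applied to x and T x, bounds |T x|^4 by |x|^2 |T
  x|^2.\<close>

lemma positive_contraction_norm_le_1:
  fixes T :: "'a::real_inner \<Rightarrow>\<^sub>L 'a"
  assumes "positive_blinfun T" "\<And>x. T x \<bullet> x \<le> x \<bullet> x"
  shows "norm T \<le> 1"
proof (rule norm_blinfun_bound)
  fix x
  let ?y = "T x"
  have "(?y \<bullet> ?y)\<^sup>2 \<le> (?y \<bullet> x) * (T ?y \<bullet> ?y)"
    by (rule positive_blinfun_cauchy_schwarz[OF assms(1)])
  also have "\<dots> \<le> (x \<bullet> x) * (?y \<bullet> ?y)"
    using assms(2) by (intro mult_mono positive_blinfunD(2)[OF assms(1)]) auto
  finally have "?y \<bullet> ?y \<le> x \<bullet> x"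
    by (cases "?y = 0") (auto simp: power2_eq_square)
  then show "norm ?y \<le> 1 * norm x" by (simp add: norm_eq_sqrt_inner)
qed simp

text \<open>The iteration \<open>Y \<mapsto> (X + Y\<^sup>2)/2\<close> with \<open>X = I - B\<close> converges in operator norm, being
  dominated by the same iteration for the real number \<open>1\<close>; its limit \<open>Y\<close> satisfies
  \<open>(I - Y)\<^sup>2 = B\<close>.\<close>

lemma positive_contraction_sqrt:
  fixes B :: "'a::{real_inner, banach} \<Rightarrow>\<^sub>L 'a"
  assumes B: "positive_blinfun B" "\<And>x. B x \<bullet> x \<le> x \<bullet> x"
  obtains S where "positive_blinfun S" "S o\<^sub>L S = B" "\<And>C. C o\<^sub>L B = B o\<^sub>L C \<Longrightarrow> C o\<^sub>L S = S o\<^sub>L C"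
proof -
  define X where "X = id_blinfun - B"
  have X: "positive_blinfun X"
    using B by (auto simp: X_def positive_blinfun_def blinfun.bilinear_simps inner_simps)
  have nX: "norm X \<le> 1"
    using B(1) by (intro positive_contraction_norm_le_1[OF X])
      (auto simp: X_def positive_blinfun_def blinfun.bilinear_simps inner_simps)
  define Y where "Y = rec_nat (0 :: 'a \<Rightarrow>\<^sub>L 'a) (\<lambda>_ y. (1/2) *\<^sub>R (X + (y o\<^sub>L y)))"
  define r where "r = rec_nat (0 :: real) (\<lambda>_ y. (1/2) * (1 + y * y))"
  have Y: "Y 0 = 0" "Y (Suc n) = (1/2) *\<^sub>R (X + (Y n o\<^sub>L Y n))" for n by (simp_all add: Y_def)
  have r: "r 0 = 0" "r (Suc n) = (1/2) * (1 + r n * r n)" for n by (simp_all add: r_def)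
  have r01: "0 \<le> r n \<and> r n \<le> 1" for n
    by (induction n) (auto simp: r mult_le_one)
  have nY: "norm (Y n) \<le> r n" for n
  proof (induction n)
    case (Suc n)
    have "norm (X + (Y n o\<^sub>L Y n)) \<le> norm X + norm (Y n) * norm (Y n)"
      using norm_triangle_ineq[of X "Y n o\<^sub>L Y n"] norm_blinfun_compose[of "Y n" "Y n"] by linarith
    also have "\<dots> \<le> 1 + r n * r n" using nX Suc r01[of n] by (intro add_mono mult_mono) auto
    finally show ?case by (simp add: Y r)
  qed (simp add: Y r)
  have dY: "norm (Y (Suc n) - Y n) \<le> r (Suc n) - r n" for n
  proof (induction n)
    case 0 then show ?case using nX by (simp add: Y r)
  next
    case (Suc n)
    let ?D = "Y (Suc n) - Y n"
    \<comment> \<open>This form of p^2 - q^2 does not require p and q to commute. Taking norms turns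
      it into the same expression in the real sequence, so the increments of Y are dominated by
      those of r.\<close>
    have alg: "a - b = (1/2) *\<^sub>R ((p o\<^sub>L (p - q)) + ((p - q) o\<^sub>L q))"
      if "a = (1/2) *\<^sub>R (X + (p o\<^sub>L p))" "b = (1/2) *\<^sub>R (X + (q o\<^sub>L q))" for a b p q
      by (simp add: that blinfun_compose_simps scaleR_diff_right scaleR_add_right)
    have e: "Y (Suc (Suc n)) - Y (Suc n) = (1/2) *\<^sub>R ((Y (Suc n) o\<^sub>L ?D) + (?D o\<^sub>L Y n))"
      by (rule alg[OF Y(2) Y(2)])
    have "norm (Y (Suc (Suc n)) - Y (Suc n)) \<le> (1/2) * (norm (Y (Suc n)) * norm ?D + norm ?D * norm (Y n))"
      unfolding e using norm_triangle_ineq[of "Y (Suc n) o\<^sub>L ?D" "?D o\<^sub>L Y n"]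
        norm_blinfun_compose[of "Y (Suc n)" ?D] norm_blinfun_compose[of ?D "Y n"] by simp
    also have "\<dots> \<le> (1/2) * (r (Suc n) * (r (Suc n) - r n) + (r (Suc n) - r n) * r n)"
    proof -
      have "0 \<le> r (Suc n) - r n" using Suc norm_ge_zero[of ?D] by linarith
      then show ?thesis
        using mult_mono[OF nY[of "Suc n"] Suc] mult_mono[OF Suc nY[of n]] r01 by simp
    qed
    also have "\<dots> = r (Suc (Suc n)) - r (Suc n)"
    proof -
      have alg: "(1/2) * (p * (p - q) + (p - q) * q) = a - b"
        if "a = (1/2) * (1 + p * p)" "b = (1/2) * (1 + q * q)" for a b p q :: real
        by (simp add: that algebra_simps)
      show ?thesis by (rule alg[OF r(2) r(2)])
    qed
    finally show ?case .
  qed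
  have dYm: "norm (Y (n + k) - Y n) \<le> r (n + k) - r n" for n k
  proof (induction k)
    case (Suc k)
    have "norm (Y (n + Suc k) - Y n) \<le> norm (Y (Suc (n + k)) - Y (n + k)) + norm (Y (n + k) - Y n)"
      using norm_triangle_ineq[of "Y (Suc (n + k)) - Y (n + k)" "Y (n + k) - Y n"] by simp
    then show ?case using dY[of "n + k"] Suc by simp
  qed simp
  have "incseq r"
  proof (rule incseq_SucI)
    show "r n \<le> r (Suc n)" for n using order_trans[OF norm_ge_zero dY[of n]] by simp
  qed
  then have "convergent r" using r01 by (intro Bseq_monoseq_convergent BseqI'[of _ 1]) (auto simp: incseq_imp_monoseq)
  then have "Cauchy r" by (simp add: Cauchy_convergent_iff)
  have "Cauchy Y"
    unfolding Cauchy_altdef2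
  proof (intro allI impI)
    fix e :: real assume "e > 0"
    then obtain N where N: "\<And>n. n \<ge> N \<Longrightarrow> dist (r n) (r N) < e"
      using \<open>Cauchy r\<close> unfolding Cauchy_altdef2 by blast
    have "dist (Y n) (Y N) < e" if "n \<ge> N" for n
      using dYm[of N "n - N"] N[OF that] that by (simp add: dist_norm)
    then show "\<exists>N. \<forall>n\<ge>N. dist (Y n) (Y N) < e" by blast
  qed
  then have "convergent Y" by (rule Cauchy_convergent)
  then obtain Z where Z: "Y \<longlonglongrightarrow> Z" by (auto simp: convergent_def)
  have Zeq: "Z = (1/2) *\<^sub>R (X + (Z o\<^sub>L Z))"
  proof (rule LIMSEQ_unique)
    show "(\<lambda>n. Y (Suc n)) \<longlonglongrightarrow> Z" using Z by (rule LIMSEQ_Suc)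
    show "(\<lambda>n. Y (Suc n)) \<longlonglongrightarrow> (1/2) *\<^sub>R (X + (Z o\<^sub>L Z))"
      unfolding Y by (intro tendsto_intros bounded_bilinear.tendsto[OF bounded_bilinear_blinfun_compose] Z)
  qed
  have nZ: "norm Z \<le> 1"
    using nY r01 by (intro LIMSEQ_le_const2[OF tendsto_norm[OF Z]]) (meson order_trans)
  have Ysym: "(Y n) x \<bullet> y = x \<bullet> (Y n) y" for n x y
  proof (induction n arbitrary: x y)
    case (Suc n)
    have "(Y n) ((Y n) x) \<bullet> y = x \<bullet> (Y n) ((Y n) y)"
      using Suc by metis
    then show ?case
      using positive_blinfunD(1)[OF X, of x y] by (simp add: Y blinfun.bilinear_simps inner_simps)
  qed (simp add: Y)
  have Zsym: "Z x \<bullet> y = x \<bullet> Z y" for x y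
  proof (rule LIMSEQ_unique)
    show "(\<lambda>n. (Y n) x \<bullet> y) \<longlonglongrightarrow> Z x \<bullet> y" 
      by (intro tendsto_intros blinfun.tendsto Z)
    show "(\<lambda>n. (Y n) x \<bullet> y) \<longlonglongrightarrow> x \<bullet> Z y" 
      unfolding Ysym by (intro tendsto_intros blinfun.tendsto Z)
  qed
  show thesis
  proof (rule that[of "id_blinfun - Z"])
    have "Z x \<bullet> x \<le> x \<bullet> x" for x
    proof -
      have "Z x \<bullet> x \<le> norm (Z x) * norm x" by (rule norm_cauchy_schwarz)
      also have "\<dots> \<le> norm x * norm x"
        using norm_blinfun[of Z x] mult_right_mono[OF nZ, of "norm x"] by (intro mult_right_mono) auto
      finally show ?thesis by (simp add: dot_square_norm power2_eq_square)
    qed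
    then show "positive_blinfun (id_blinfun - Z)"
      using Zsym by (auto simp: positive_blinfun_def blinfun.bilinear_simps inner_simps)
    have "2 *\<^sub>R Z = X + (Z o\<^sub>L Z)" by (subst Zeq) simp
    then have "Z o\<^sub>L Z = 2 *\<^sub>R Z - X" by simp
    then show "(id_blinfun - Z) o\<^sub>L (id_blinfun - Z) = B"
      by (simp add: blinfun_compose_simps X_def scaleR_2)
    fix C assume C: "C o\<^sub>L B = B o\<^sub>L C"
    then have CX: "C o\<^sub>L X = X o\<^sub>L C"
      by (simp add: X_def blinfun_compose_simps )
    have CY: "C o\<^sub>L Y n = Y n o\<^sub>L C" for n
    proof (induction n)
      case (Suc n)
      have "C o\<^sub>L (Y n o\<^sub>L Y n) = (Y n o\<^sub>L Y n) o\<^sub>L C"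
        using Suc by (metis blinfun_compose_assoc)
      then show ?case using CX
        by (simp add: Y blinfun_compose_simps )
    qed (simp add: Y)
    have "C o\<^sub>L Z = Z o\<^sub>L C"
    proof (rule LIMSEQ_unique)
      show "(\<lambda>n. C o\<^sub>L Y n) \<longlonglongrightarrow> (C o\<^sub>L Z)"
        by (intro tendsto_intros bounded_bilinear.tendsto[OF bounded_bilinear_blinfun_compose] Z)
      show "(\<lambda>n. C o\<^sub>L Y n) \<longlonglongrightarrow> (Z o\<^sub>L C)"
        unfolding CY by (intro tendsto_intros bounded_bilinear.tendsto[OF bounded_bilinear_blinfun_compose] Z)
    qed
    then show "C o\<^sub>L (id_blinfun - Z) = (id_blinfun - Z) o\<^sub>L C"
      by (simp add: blinfun_compose_simps )
  qed
qed

lemma positive_blinfun_sqrt: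
  fixes B :: "'a::{real_inner, banach} \<Rightarrow>\<^sub>L 'a"
  assumes B: "positive_blinfun B"
  obtains S where "positive_blinfun S" "S o\<^sub>L S = B" "\<And>C. C o\<^sub>L B = B o\<^sub>L C \<Longrightarrow> C o\<^sub>L S = S o\<^sub>L C"
proof -
  \<comment> \<open>The summand 1 keeps the scaling factor positive when B = 0.\<close>
  define c where "c = norm B + 1"
  have c: "c > 0" by (simp add: c_def add_nonneg_pos)
  have "positive_blinfun ((1/c) *\<^sub>R B)"
    using B c by (auto simp: positive_blinfun_def blinfun.bilinear_simps)
  moreover have "((1/c) *\<^sub>R B) x \<bullet> x \<le> x \<bullet> x" for x
  proof -
    have "B x \<bullet> x \<le> norm B * norm x * norm x"
      using norm_cauchy_schwarz[of "B x" x] mult_right_mono[OF norm_blinfun[of B x] norm_ge_zero[of x]] by linarith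
    also have "\<dots> \<le> c * (x \<bullet> x)" by (simp add: c_def dot_square_norm power2_eq_square algebra_simps)
    finally show ?thesis using c by (simp add: blinfun.bilinear_simps field_simps)
  qed
  ultimately obtain S where S: "positive_blinfun S" "S o\<^sub>L S = (1/c) *\<^sub>R B"
    "\<And>C. C o\<^sub>L ((1/c) *\<^sub>R B) = ((1/c) *\<^sub>R B) o\<^sub>L C \<Longrightarrow> C o\<^sub>L S = S o\<^sub>L C"
    using positive_contraction_sqrt by blast
  show thesis
  proof (rule that[of "sqrt c *\<^sub>R S"])
    show "positive_blinfun (sqrt c *\<^sub>R S)"
      using S(1) c by (auto simp: positive_blinfun_def blinfun.bilinear_simps)
    have "(sqrt c *\<^sub>R S) o\<^sub>L (sqrt c *\<^sub>R S) = (sqrt c * sqrt c) *\<^sub>R (S o\<^sub>L S)"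
      by (simp add: blinfun_compose_simps )
    then show "(sqrt c *\<^sub>R S) o\<^sub>L (sqrt c *\<^sub>R S) = B" using S(2) c by simp
    show "C o\<^sub>L (sqrt c *\<^sub>R S) = (sqrt c *\<^sub>R S) o\<^sub>L C" if "C o\<^sub>L B = B o\<^sub>L C" for C
      using S(3)[of C] that by (simp add: blinfun_compose_simps )
  qed
qed

text \<open>With y = S x - C x, commutation gives S y + C y = (S^2 - C^2) x = 0. Both forms
  therefore vanish at y, so S y = C y = 0 by positivity, and |y|^2 = x \<bullet> (S y - C y) =
  0.\<close>

lemma positive_blinfun_sqrt_unique:
  fixes S C :: "'a::{real_inner, banach} \<Rightarrow>\<^sub>L 'a"
  assumes "positive_blinfun S" "positive_blinfun C" "S o\<^sub>L S = C o\<^sub>L C" "C o\<^sub>L S = S o\<^sub>L C"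
  shows "S = C"
proof (rule blinfun_eqI)
  fix x
  define y where "y = S x - C x"
  have SS: "S (S z) = C (C z)"
    and CS: "C (S z) = S (C z)" for z
    by (simp_all flip: blinfun_apply_blinfun_compose add: assms(3,4))
  have "S y + C y = 0"
    by (simp add: y_def blinfun.bilinear_simps SS CS)
  then have "S y \<bullet> y + C y \<bullet> y = 0" by (simp flip: inner_add_left)
  moreover have "0 \<le> S y \<bullet> y" "0 \<le> C y \<bullet> y" using assms by (auto simp: positive_blinfun_def)
  ultimately have "S y \<bullet> y = 0" "C y \<bullet> y = 0" by linarith+
  then have "S y = 0" "C y = 0" using assms positive_blinfun_eq_0 by blast+
  then have "S x \<bullet> y = 0" "C x \<bullet> y = 0"
    using positive_blinfunD(1)[OF assms(1), of x y] positive_blinfunD(1)[OF assms(2), of x y] by auto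
  then have "y \<bullet> y = 0" by (subst y_def) (simp add: inner_diff_left)
  then show "S x = C x" by (simp add: y_def)
qed

section \<open>The square root of the operator and spectral cutoffs\<close>

text \<open>A type of sort \<open>{real_inner, complete_space}\<close> is not an instance of \<open>banach\<close>, which operator
  norm limits and vector-valued integrals need; the type copy \<open>'a hilbert\<close> is.\<close>

typedef (overloaded) ('a::"{real_inner, complete_space}") hilbert = "UNIV :: 'a set"
  morphisms of_hilbert to_hilbert ..

setup_lifting type_definition_hilbert

instantiation hilbert :: ("{real_inner, complete_space}") real_vector
begin
lift_definition zero_hilbert :: "'a hilbert" is 0 .
lift_definition plus_hilbert :: "'a hilbert \<Rightarrow> 'a hilbert \<Rightarrow> 'a hilbert" is "(+)" .
lift_definition minus_hilbert :: "'a hilbert \<Rightarrow> 'a hilbert \<Rightarrow> 'a hilbert" is "(-)" .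
lift_definition uminus_hilbert :: "'a hilbert \<Rightarrow> 'a hilbert" is uminus .
lift_definition scaleR_hilbert :: "real \<Rightarrow> 'a hilbert \<Rightarrow> 'a hilbert" is scaleR .
instance by standard (transfer; simp add: algebra_simps; fail)+
end

instantiation hilbert :: ("{real_inner, complete_space}") real_inner
begin
lift_definition inner_hilbert :: "'a hilbert \<Rightarrow> 'a hilbert \<Rightarrow> real" is inner .
lift_definition norm_hilbert :: "'a hilbert \<Rightarrow> real" is norm .
definition "dist_hilbert x y = norm (x - y)" for x y :: "'a hilbert"
definition "sgn_hilbert x = x /\<^sub>R norm x" for x :: "'a hilbert"
definition "uniformity_hilbert = (INF e\<in>{0 <..}. principal {(x, y :: 'a hilbert). dist x y < e})"
definition "open_hilbert U = (\<forall>x\<in>U. eventually (\<lambda>(x', y). x' = x \<longrightarrow> y \<in> U) uniformity)"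
  for U :: "'a hilbert set"
instance
proof
  fix x y z :: "'a hilbert" and r s :: real
  show "dist x y = norm (x - y)" by (rule dist_hilbert_def)
  show "sgn x = x /\<^sub>R norm x" by (rule sgn_hilbert_def)
  show "norm x = sqrt (inner x x)" by transfer (rule norm_eq_sqrt_inner)
  show "uniformity = (INF e\<in>{0 <..}. principal {(x, y :: 'a hilbert). dist x y < e})"
    by (rule uniformity_hilbert_def)
  show "open U = (\<forall>x\<in>U. eventually (\<lambda>(x', y). x' = x \<longrightarrow> y \<in> U) uniformity)" for U :: "'a hilbert set"
    by (rule open_hilbert_def)
  show "inner x y = inner y x" by transfer (rule inner_commute)
  show "inner (x + y) z = inner x z + inner y z" by transfer (rule inner_add_left)
  show "inner (r *\<^sub>R x) y = r * inner x y" by transfer simp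
  show "0 \<le> inner x x" by transfer simp
  show "inner x x = 0 \<longleftrightarrow> x = 0" by transfer simp
qed
end

lemma bounded_linear_of_hilbert: "bounded_linear of_hilbert"
  by (rule bounded_linear_intro[where K = 1]) (transfer; simp)+

lemma bounded_linear_to_hilbert: "bounded_linear to_hilbert"
  by (rule bounded_linear_intro[where K = 1]) (transfer; simp)+

lemma hilbert_simps [simp]:
  "to_hilbert (of_hilbert x) = x" "of_hilbert (to_hilbert y) = y"
  "norm (of_hilbert x) = norm x" "norm (to_hilbert y) = norm y"
  "of_hilbert x \<bullet> of_hilbert x' = x \<bullet> x'" "to_hilbert y \<bullet> to_hilbert y' = y \<bullet> y'"
  by (simp_all add: of_hilbert_inverse to_hilbert_inverse norm_hilbert.rep_eq inner_hilbert.rep_eq)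

instance hilbert :: ("{real_inner, complete_space}") banach
proof
  fix X :: "nat \<Rightarrow> 'a hilbert"
  assume "Cauchy X"
  then have "Cauchy (\<lambda>n. of_hilbert (X n))"
    by (rule bounded_linear.Cauchy[OF bounded_linear_of_hilbert])
  then have "convergent (\<lambda>n. of_hilbert (X n))" by (rule Cauchy_convergent)
  then obtain l where "(\<lambda>n. of_hilbert (X n)) \<longlonglongrightarrow> l" by (auto simp: convergent_def)
  from bounded_linear.tendsto[OF bounded_linear_to_hilbert this]
  show "convergent X" by (auto simp: convergent_def)
qed

section \<open>Graphs of inverses and the square root of A\<close>

definition injective_blinfun :: "('a::real_normed_vector \<Rightarrow>\<^sub>L 'a) \<Rightarrow> bool" where
  "injective_blinfun R \<longleftrightarrow> (\<forall>x. R x = 0 \<longrightarrow> x = 0)"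

lemma injective_blinfunD: "injective_blinfun R \<Longrightarrow> R x = R y \<Longrightarrow> x = y"
  unfolding injective_blinfun_def by (metis blinfun.diff_right eq_iff_diff_eq_0)

lemma subspace_closure:
  fixes M :: "'a::real_normed_vector set"
  assumes "subspace M"
  shows "subspace (closure M)"
proof (rule subspaceI)
  show "0 \<in> closure M" using subspace_0[OF assms] closure_subset by blast
  fix x y assume "x \<in> closure M" "y \<in> closure M"
  then obtain f g where f: "\<And>n. f n \<in> M" "f \<longlonglongrightarrow> x" and g: "\<And>n. g n \<in> M" "g \<longlonglongrightarrow> y"
    unfolding closure_sequential by blast
  have "(\<lambda>n. f n + g n) \<longlonglongrightarrow> x + y" by (intro tendsto_intros f g)
  moreover have "f n + g n \<in> M" for n by (intro subspace_add assms f g)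
  ultimately show "x + y \<in> closure M"
    unfolding closure_sequential by (intro exI[of _ "\<lambda>n. f n + g n"]) simp
next
  fix c x assume "x \<in> closure M"
  then obtain f where f: "\<And>n. f n \<in> M" "f \<longlonglongrightarrow> x" unfolding closure_sequential by blast
  have "(\<lambda>n. c *\<^sub>R f n) \<longlonglongrightarrow> c *\<^sub>R x" by (intro tendsto_intros f)
  moreover have "c *\<^sub>R f n \<in> M" for n by (intro subspace_scale assms f)
  ultimately show "c *\<^sub>R x \<in> closure M"
    unfolding closure_sequential by (intro exI[of _ "\<lambda>n. c *\<^sub>R f n"]) simp
qed

text \<open>For z orthogonal to the range, |r z|^2 = z \<bullet> r (r z) = 0.\<close>

lemma dense_range_symmetric:
  fixes r :: "'a::{real_inner, complete_space} \<Rightarrow> 'a"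
  assumes lin: "linear r" and sym: "\<And>x y. r x \<bullet> y = x \<bullet> r y" and inj: "\<And>x. r x = 0 \<Longrightarrow> x = 0"
  shows "closure (range r) = UNIV"
proof (rule closed_subspace_eq_UNIV)
  show "subspace (closure (range r))"
    by (intro subspace_closure linear_subspace_image subspace_UNIV lin)
  fix z assume z: "\<And>y. y \<in> closure (range r) \<Longrightarrow> z \<bullet> y = 0"
  have "r z \<bullet> r z = z \<bullet> r (r z)" by (rule sym)
  also have "\<dots> = 0" by (intro z subsetD[OF closure_subset]) simp
  finally have "r z = 0" by simp
  then show "z = 0" by (rule inj)
qed simp

text \<open>The set is the graph of the unbounded inverse of R. With (u, y) = (R x, x) the adjoint
  relation reads x \<bullet> v = x \<bullet> R w for all x, that is v = R w.\<close>

lemma graph_selfadjoint: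
  fixes R :: "'a::{real_inner, complete_space} \<Rightarrow> 'a"
  assumes lin: "linear R" and sym: "\<And>x y. R x \<bullet> y = x \<bullet> R y" and inj: "\<And>x. R x = 0 \<Longrightarrow> x = 0"
    and dense: "closure (range R) = UNIV"
  shows "selfadjoint {(R x, x) | x. True}"
  unfolding selfadjoint_def linear_operator_def
proof (intro conjI)
  show "subspace {(R x, x) | x. True}"
    using lin by (intro subspaceI) (auto simp: zero_prod_def linear_0 linear_add linear_scale)
  have "x = y" if "R x = R y" for x y
    using inj[of "x - y"] that by (simp add: linear_diff[OF lin])
  then show "single_valued {(R x, x) | x. True}" by (auto simp: single_valued_def)
  have "Domain {(R x, x) | x. True} = range R" by auto
  then show "closure (Domain {(R x, x) | x. True}) = UNIV" using dense by simp
  have "(v, w) \<in> adjoint_operator {(R x, x) | x. True} \<longleftrightarrow> (v, w) \<in> {(R x, x) | x. True}" for v w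
  proof -
    have "(v, w) \<in> adjoint_operator {(R x, x) | x. True} \<longleftrightarrow> (\<forall>x. x \<bullet> v = x \<bullet> R w)"
      by (auto simp: adjoint_operator_def sym)
    also have "\<dots> \<longleftrightarrow> v = R w"
    proof
      assume "\<forall>x. x \<bullet> v = x \<bullet> R w"
      then have "(v - R w) \<bullet> (v - R w) = 0" by (simp add: inner_diff_right)
      then show "v = R w" by simp
    qed simp
    finally show ?thesis by auto
  qed
  then show "adjoint_operator {(R x, x) | x. True} = {(R x, x) | x. True}" by auto
qed

text \<open>The root of A is the inverse of the bounded positive root R of the inverse of A. Since
  \<open>sqrt_operator\<close> is a definite description, every nonnegative selfadjoint T with
  square A has to be shown equal to it; such a T has a bounded positive inverse, to which uniqueness
  of bounded roots applies.\<close>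

lemma sqrt_operator_representation:
  fixes A :: "'a::{real_inner, complete_space} operator"
  assumes "selfadjoint A" "strictly_positive A"
  obtains R :: "'a hilbert \<Rightarrow>\<^sub>L 'a hilbert" where "positive_blinfun R" "injective_blinfun R"
    "sqrt_operator A = {(of_hilbert (R x), of_hilbert x) | x. True}"
proof -
  obtain b where b: "bounded_linear b" "\<And>u y. (u, y) \<in> A \<longleftrightarrow> u = b y"
    "\<And>x y. b x \<bullet> y = x \<bullet> b y" "\<And>y. 0 \<le> b y \<bullet> y"
    using strictly_positive_selfadjoint_inverse[OF assms] by blast
  have sub: "subspace A" and sv: "single_valued A"
    using assms(1) by (auto simp: selfadjoint_def linear_operator_def)
  have "(0, 0) \<in> A" using subspace_0[OF sub] by (simp add: zero_prod_def)
  have b_inj: "y = 0" if "b y = 0" for y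
  proof -
    have "(0, y) \<in> A" using b(2)[of 0 y] that by simp
    then show ?thesis using sv \<open>(0, 0) \<in> A\<close> by (auto dest: single_valuedD)
  qed
  define B where "B = Blinfun (\<lambda>x. to_hilbert (b (of_hilbert x)))"
  have B: "B x = to_hilbert (b (of_hilbert x))" for x
    unfolding B_def
    by (subst bounded_linear_Blinfun_apply)
      (intro bounded_linear_compose[OF bounded_linear_to_hilbert] bounded_linear_compose[OF b(1)] bounded_linear_of_hilbert, simp)
  have tr: "to_hilbert u \<bullet> x = u \<bullet> of_hilbert x" "x \<bullet> to_hilbert u = of_hilbert x \<bullet> u" for u :: 'a and x
    by (simp_all add: inner_hilbert.rep_eq)
  have posB: "positive_blinfun B"
    using b(3,4) by (auto simp: positive_blinfun_def B tr)
  obtain R where R: "positive_blinfun R" "R o\<^sub>L R = B" "\<And>C. C o\<^sub>L B = B o\<^sub>L C \<Longrightarrow> C o\<^sub>L R = R o\<^sub>L C"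
    using positive_blinfun_sqrt[OF posB] by blast
  have RR: "R (R x) = to_hilbert (b (of_hilbert x))" for x
    by (simp flip: B R(2))
  have Rinj: "injective_blinfun R"
    unfolding injective_blinfun_def
  proof (intro allI impI)
    fix x assume "R x = 0"
    then have "to_hilbert (b (of_hilbert x)) = 0" using RR[of x] by simp
    then have "of_hilbert (to_hilbert (b (of_hilbert x))) = of_hilbert 0" by simp
    then have "b (of_hilbert x) = 0" by (simp add: zero_hilbert.rep_eq)
    then have "of_hilbert x = of_hilbert 0" by (simp add: b_inj zero_hilbert.rep_eq)
    then show "x = 0" by (simp add: of_hilbert_inject)
  qed
  define S where "S = {(of_hilbert (R x), of_hilbert x) | x. True}"
  define r where "r x = of_hilbert (R (to_hilbert x))" for x
  have S_r: "S = {(r x, x) | x. True}"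
  proof -
    have "(u, y) \<in> S \<longleftrightarrow> u = r y" for u y
      unfolding S_def r_def by (auto intro: exI[of _ "to_hilbert y"])
    then show ?thesis by auto
  qed
  have lin_r: "bounded_linear r"
    unfolding r_def
    by (intro bounded_linear_compose[OF bounded_linear_of_hilbert] bounded_linear_compose[OF blinfun.bounded_linear_right] bounded_linear_to_hilbert)
  have r_sym: "r x \<bullet> y = x \<bullet> r y" for x y
    using positive_blinfunD(1)[OF R(1), of "to_hilbert x" "to_hilbert y"] by (simp add: r_def tr)
  have rr: "r (r x) = b x" for x by (simp add: r_def RR)
  have r_inj: "x = 0" if "r x = 0" for x
    using b_inj[of x] rr[of x] that linear_0[OF bounded_linear.linear[OF lin_r]] by simp
  have "closure (range r) = UNIV"
    using r_sym r_inj by (intro dense_range_symmetric bounded_linear.linear lin_r) auto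
  then have S_sa: "selfadjoint S"
    unfolding S_r using r_sym r_inj by (intro graph_selfadjoint bounded_linear.linear lin_r) auto
  have S_nonneg: "nonneg_operator S"
    using positive_blinfunD(3)[OF R(1)] by (auto simp: nonneg_operator_def S_def)
  have S_sq: "S O S = A"
  proof -
    have S_iff: "(u, y) \<in> S \<longleftrightarrow> u = r y" for u y by (auto simp: S_r)
    have "(u, y) \<in> S O S \<longleftrightarrow> (u, y) \<in> A" for u y
    proof
      assume "(u, y) \<in> S O S"
      then obtain m where "(u, m) \<in> S" "(m, y) \<in> S" by (rule relcompEpair)
      then show "(u, y) \<in> A" by (simp only: S_iff b(2) rr)
    next
      assume "(u, y) \<in> A"
      then have "u = r (r y)" by (simp only: b(2) rr)
      then have "(u, r y) \<in> S" "(r y, y) \<in> S" by (simp_all only: S_iff)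
      then show "(u, y) \<in> S O S" by (rule relcompI)
    qed
    note SA = this
    show ?thesis by (intro subset_antisym subrelI) (simp_all only: SA)
  qed
  have uniq: "T = S" if T: "selfadjoint T" "nonneg_operator T" "T O T = A" for T
  proof -
    have subT: "subspace T" and adjT: "adjoint_operator T = T"
      using T(1) by (auto simp: selfadjoint_def linear_operator_def)
    have T0: "(0, 0) \<in> T" using subspace_0[OF subT] by (simp add: zero_prod_def)
    \<comment> \<open>T is onto because its square A is.\<close>
    have ex: "\<exists>m. (m, y) \<in> T" for y
    proof -
      have "(b y, y) \<in> T O T" by (simp add: b(2) T(3))
      then show ?thesis by (auto elim: relcompE)
    qed
    have injT: "m = 0" if "(m, 0) \<in> T" for m
    proof -
      have "(m, 0) \<in> A" using relcompI[OF that T0] T(3) by simp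
      then show ?thesis by (simp add: b(2) linear_0[OF bounded_linear.linear[OF b(1)]])
    qed
    have eqT: "m = m'" if "(m, y) \<in> T" "(m', y) \<in> T" for m m' y
      using injT[of "m - m'"] subspace_diff[OF subT that] by simp
    define c where "c y = (THE m. (m, y) \<in> T)" for y
    have c: "(c y, y) \<in> T" for y
    proof -
      obtain m where m: "(m, y) \<in> T" using ex by blast
      show ?thesis unfolding c_def by (rule theI[of _ m]) (use m eqT in \<open>blast+\<close>)
    qed
    have cc: "c (c y) = b y" for y
    proof -
      have "(c (c y), y) \<in> T O T" using relcompI[OF c[of "c y"] c[of y]] .
      then show ?thesis using b(2) T(3) by simp
    qed
    have c_sym: "c x \<bullet> y = x \<bullet> c y" for x y
    proof -
      have "(c y, y) \<in> adjoint_operator T" using c adjT by simp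
      then have "\<forall>(u, z)\<in>T. z \<bullet> c y = u \<bullet> y" by (simp add: adjoint_operator_def)
      from bspec[OF this c[of x]] have "x \<bullet> c y = c x \<bullet> y" by simp
      then show ?thesis by simp
    qed
    obtain k where k: "\<And>x. norm (b x) \<le> norm x * k" using bounded_linear.bounded[OF b(1)] by blast
    have lin_c: "bounded_linear c"
    proof (rule bounded_linear_intro[of c "sqrt k"])
      show "c (x + y) = c x + c y" for x y
        using eqT[OF c] subspace_add[OF subT c[of x] c[of y]] by simp
      show "c (q *\<^sub>R x) = q *\<^sub>R c x" for q x
        using eqT[OF c] subspace_scale[OF subT c[of x], of q] by simp
      fix x
      \<comment> \<open>Symmetry and c c = b bound c by the square root of the bound of b.\<close>
      have "(norm (c x))\<^sup>2 = b x \<bullet> x" using c_sym[of "c x" x] by (simp add: power2_norm_eq_inner cc)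
      also have "\<dots> \<le> (norm x)\<^sup>2 * k"
        using norm_cauchy_schwarz[of "b x" x] mult_right_mono[OF k[of x] norm_ge_zero[of x]]
        by (simp add: power2_eq_square mult.commute mult.left_commute)
      finally have "norm (c x) \<le> sqrt ((norm x)\<^sup>2 * k)" by (rule real_le_rsqrt)
      then show "norm (c x) \<le> norm x * sqrt k" by (simp add: real_sqrt_mult)
    qed
    define C where "C = Blinfun (\<lambda>x. to_hilbert (c (of_hilbert x)))"
    have C: "C x = to_hilbert (c (of_hilbert x))" for x
      unfolding C_def
      by (subst bounded_linear_Blinfun_apply)
        (intro bounded_linear_compose[OF bounded_linear_to_hilbert] bounded_linear_compose[OF lin_c] bounded_linear_of_hilbert, simp)
    have "0 \<le> c x \<bullet> x" for x
      using bspec[OF T(2)[unfolded nonneg_operator_def] c[of x]] by (simp add: inner_commute)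
    then have posC: "positive_blinfun C"
      using c_sym by (auto simp: positive_blinfun_def C tr)
    have CC: "C o\<^sub>L C = B" by (rule blinfun_eqI) (simp add: C B cc)
    \<comment> \<open>C commutes with B = C^2, hence with R, because the constructed root commutes
      with everything that commutes with B.\<close>
    then have "C o\<^sub>L B = B o\<^sub>L C" by (auto simp: blinfun_compose_assoc)
    from R(3)[OF this] have "R = C"
      by (intro positive_blinfun_sqrt_unique[OF R(1) posC]) (simp_all add: R(2) CC)
    then have "r x = c x" for x by (simp add: r_def C)
    then have "(u, y) \<in> T \<longleftrightarrow> u = r y" for u y using c[of y] eqT[of u y "c y"] by metis
    then show ?thesis by (auto simp: S_r)
  qed
  have "sqrt_operator A = S"
    unfolding sqrt_operator_def
  proof (rule the_equality)
    show "selfadjoint S \<and> nonneg_operator S \<and> S O S = A" by (intro conjI S_sa S_nonneg S_sq)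
    show "T = S" if "selfadjoint T \<and> nonneg_operator T \<and> T O T = A" for T
      by (rule uniq) (simp_all only: that)
  qed
  then show thesis using that[OF R(1) Rinj] by (simp add: S_def)
qed

section \<open>Spectral projections of a positive operator\<close>

lemma orthogonal_projection_blinfun:
  fixes M :: "'a::{real_inner, banach} set"
  assumes M: "subspace M" "closed M"
  obtains P :: "'a \<Rightarrow>\<^sub>L 'a" where "\<And>x. P x \<in> M" "\<And>x y. y \<in> M \<Longrightarrow> (x - P x) \<bullet> y = 0"
    "\<And>x. x \<in> M \<Longrightarrow> P x = x" "\<And>x. norm (P x) \<le> norm x"
    "\<And>x y. P x \<bullet> y = x \<bullet> P y"
    "\<And>x. (\<And>y. y \<in> M \<Longrightarrow> x \<bullet> y = 0) \<Longrightarrow> P x = 0"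
proof -
  have "\<exists>m. m \<in> M \<and> (\<forall>y\<in>M. (x - m) \<bullet> y = 0)" for x
    using orthogonal_projection_exists[OF M, of x] by metis
  then obtain p where p: "\<And>x. p x \<in> M" "\<And>x y. y \<in> M \<Longrightarrow> (x - p x) \<bullet> y = 0" by metis
  have uniq: "p x = m" if m: "m \<in> M" "\<And>y. y \<in> M \<Longrightarrow> (x - m) \<bullet> y = 0" for x m
  proof -
    have d: "m - p x \<in> M" using m(1) p(1) M(1) by (intro subspace_diff)
    have "(m - p x) \<bullet> (m - p x) = (x - p x) \<bullet> (m - p x) - (x - m) \<bullet> (m - p x)"
      by (simp add: inner_diff_left)
    also have "\<dots> = 0" using m(2)[OF d] p(2)[OF d] by simp
    finally show ?thesis by simp
  qed
  have nrm: "norm (p x) \<le> norm x" for x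
  proof -
    have "(x - p x) \<bullet> p x = 0" by (rule p(2)[OF p(1)])
    then have "(norm (p x))\<^sup>2 = x \<bullet> p x" by (simp add: power2_norm_eq_inner inner_diff_left)
    also have "\<dots> \<le> norm x * norm (p x)" by (rule norm_cauchy_schwarz)
    finally show ?thesis by (cases "p x = 0") (auto simp: power2_eq_square)
  qed
  have lin: "bounded_linear p"
  proof (rule bounded_linear_intro[of p 1])
    show "p (x + y) = p x + p y" for x y
    proof (rule uniq)
      show "(x + y - (p x + p y)) \<bullet> z = 0" if "z \<in> M" for z
        using p(2)[OF that, of x] p(2)[OF that, of y] by (simp add: inner_simps)
    qed (use p(1) M(1) in \<open>auto intro: subspace_add\<close>)
    show "p (r *\<^sub>R x) = r *\<^sub>R p x" for r x
    proof (rule uniq)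
      show "(r *\<^sub>R x - r *\<^sub>R p x) \<bullet> z = 0" if "z \<in> M" for z
        using p(2)[OF that, of x] by (simp flip: scaleR_diff_right)
    qed (use p(1) M(1) in \<open>auto intro: subspace_scale\<close>)
  qed (simp add: nrm)
  have app: "blinfun_apply (Blinfun p) = p" by (rule bounded_linear_Blinfun_apply[OF lin])
  show thesis
  proof (rule that[of "Blinfun p"]; unfold app)
    show "p x \<in> M" for x by (rule p(1))
    show "(x - p x) \<bullet> y = 0" if "y \<in> M" for x y by (rule p(2)[OF that])
    show "p x = x" if "x \<in> M" for x by (rule uniq[OF that]) simp
    show "norm (p x) \<le> norm x" for x by (rule nrm)
    show "p x = 0" if "\<And>y. y \<in> M \<Longrightarrow> x \<bullet> y = 0" for x
      by (rule uniq) (use that M(1) in \<open>auto simp: subspace_0\<close>)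
    show "p x \<bullet> y = x \<bullet> p y" for x y
    proof -
      have "(y - p y) \<bullet> p x = 0" "(x - p x) \<bullet> p y = 0" using p by auto
      then show ?thesis by (simp add: inner_diff_left inner_diff_right inner_commute)
    qed
  qed
qed

text \<open>\<open>P\<close> is the spectral projection of \<open>R\<^sup>2\<close> for \<open>[\<epsilon>\<^sup>2, \<infinity>)\<close>: the kernel of \<open>\<bar>T\<bar> - T\<close> for
  \<open>T = R\<^sup>2 - \<epsilon>\<^sup>2\<close>. On its range \<open>R\<close> has the bounded inverse \<open>L\<close>.\<close>

lemma spectral_cutoff:
  fixes R :: "'a::{real_inner, banach} \<Rightarrow>\<^sub>L 'a"
  assumes R: "positive_blinfun R" and eps: "\<epsilon> > 0"
  obtains P L :: "'a \<Rightarrow>\<^sub>L 'a" where "P o\<^sub>L P = P" "R o\<^sub>L L = P" "L o\<^sub>L R = P" "P o\<^sub>L L = L" "L o\<^sub>L P = L"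
    "R o\<^sub>L P = P o\<^sub>L R"
    "\<And>x y. P x \<bullet> y = x \<bullet> P y" "\<And>x y. L x \<bullet> y = x \<bullet> L y"
    "\<And>x. norm (P x) \<le> norm x"
    "\<And>x. norm (R (x - P x)) \<le> \<epsilon> * norm x"
proof -
  note app [simp] = blinfun.bilinear_simps
  define c where "c = \<epsilon>\<^sup>2"
  have c: "c > 0" using eps by (simp add: c_def)
  define T where "T = (R o\<^sub>L R) - c *\<^sub>R id_blinfun"
  have Tx: "T x = R (R x) - c *\<^sub>R x" for x by (simp add: T_def)
  note Rsym = positive_blinfunD(1)[OF R]
  have Tsym: "T x \<bullet> y = x \<bullet> T y" for x y
    by (simp add: Tx inner_simps Rsym)
  have "positive_blinfun (T o\<^sub>L T)"
    unfolding positive_blinfun_def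
  proof (intro conjI allI)
    show "0 \<le> (T o\<^sub>L T) x \<bullet> x" for x using Tsym[of "T x" x] by simp
    show "(T o\<^sub>L T) x \<bullet> y = x \<bullet> (T o\<^sub>L T) y" for x y
      using Tsym[of x "T y"] Tsym[of "T x" y] by simp
  qed
  \<comment> \<open>N is the modulus of T: the positive root of T^2, which commutes with R and
    T.\<close>
  then obtain N where N: "positive_blinfun N" "N o\<^sub>L N = T o\<^sub>L T"
    "\<And>C. C o\<^sub>L (T o\<^sub>L T) = (T o\<^sub>L T) o\<^sub>L C \<Longrightarrow> C o\<^sub>L N = N o\<^sub>L C"
    using positive_blinfun_sqrt by blast
  have RT: "R o\<^sub>L T = T o\<^sub>L R" by (rule blinfun_eqI) (simp add: Tx)
  then have "R o\<^sub>L (T o\<^sub>L T) = (T o\<^sub>L T) o\<^sub>L R" by (metis blinfun_compose_assoc)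
  then have RN: "R o\<^sub>L N = N o\<^sub>L R" by (rule N(3))
  have TN: "T o\<^sub>L N = N o\<^sub>L T" by (rule N(3)) (simp add: blinfun_compose_assoc)
  have NNx: "N (N x) = T (T x)" for x
    by (simp flip: blinfun_apply_blinfun_compose add: N(2))
  have TNx: "T (N x) = N (T x)" for x
    by (simp flip: blinfun_apply_blinfun_compose add: TN)
  have RNx: "R (N x) = N (R x)" for x
    by (simp flip: blinfun_apply_blinfun_compose add: RN)
  have RTx: "R (T x) = T (R x)" for x
    by (simp flip: blinfun_apply_blinfun_compose add: RT)
  define M where "M = {x. N x = T x}"
  have sM: "subspace M" unfolding M_def by (rule subspaceI) auto
  have cM: "closed M" unfolding M_def by (intro closed_Collect_eq continuous_intros)
  obtain P :: "'a \<Rightarrow>\<^sub>L 'a" where P: "\<And>x. P x \<in> M" "\<And>x y. y \<in> M \<Longrightarrow> (x - P x) \<bullet> y = 0"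
    "\<And>x. x \<in> M \<Longrightarrow> P x = x" "\<And>x. norm (P x) \<le> norm x"
    "\<And>x y. P x \<bullet> y = x \<bullet> P y"
    "\<And>x. (\<And>y. y \<in> M \<Longrightarrow> x \<bullet> y = 0) \<Longrightarrow> P x = 0"
    apply (rule orthogonal_projection_blinfun[OF sM cM])
    subgoal premises prems for P by (rule prems(1)[OF prems(2-)])
    done
  have PP: "P o\<^sub>L P = P" by (rule blinfun_eqI) (simp add: P(1,3))
  then have PPx: "P (P x) = P x" for x by (metis blinfun_apply_blinfun_compose)
  \<comment> \<open>M is invariant under R, and by symmetry of R so is its orthogonal complement;
    hence P commutes with R.\<close>
  have RM: "R x \<in> M" if "x \<in> M" for x
  proof -
    have "R (N x) = R (T x)" using that by (simp add: M_def)
    then show ?thesis unfolding RNx RTx by (simp add: M_def)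
  qed
  have PRx: "P (R x) = R (P x)" for x
  proof -
    have "P (R (x - P x)) = 0"
      by (rule P(6)) (simp only: Rsym P(2) RM)
    moreover have "P (R (P x)) = R (P x)"
      by (intro P(3) RM P(1))
    ultimately show ?thesis by simp
  qed
  have norm_R: "(norm (R x))\<^sup>2 = c * (norm x)\<^sup>2 + T x \<bullet> x" for x
    by (simp add: Tx power2_norm_eq_inner Rsym inner_simps)
  \<comment> \<open>On M the form of T equals that of N, which is nonnegative.\<close>
  have lower: "c * (norm x)\<^sup>2 \<le> (norm (R x))\<^sup>2" if "x \<in> M" for x
    using that positive_blinfunD(2)[OF N(1), of x] unfolding norm_R by (simp add: M_def)
  \<comment> \<open>(N - T)(N + T) = N^2 - T^2 = 0, so N + T maps into M and, being symmetric,
    vanishes on the orthogonal complement; there T = -N, whose form is at most 0.\<close>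
  have upper: "(norm (R x))\<^sup>2 \<le> c * (norm x)\<^sup>2" if orth: "\<And>y. y \<in> M \<Longrightarrow> x \<bullet> y = 0" for x
  proof -
    let ?z = "N x + T x"
    have zM: "N y + T y \<in> M" for y
      by (simp add: M_def NNx TNx)
    have "?z \<bullet> ?z = x \<bullet> (N ?z + T ?z)"
      by (simp only: inner_add_left inner_add_right positive_blinfunD(1)[OF N(1)] Tsym blinfun.add_right)
    also have "\<dots> = 0" by (rule orth[OF zM])
    finally have "?z = 0" by (simp only: inner_eq_zero_iff)
    then have "T x = - N x" by (simp only: add_eq_0_iff)
    then show ?thesis unfolding norm_R using positive_blinfunD(2)[OF N(1), of x] by simp
  qed
  \<comment> \<open>Q agrees with R^2 on M, and its form is bounded below by min c 1 on the whole
    space. Its bounded inverse comes from the lemma on unbounded operators, applied to the graph of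
    Q.\<close>
  define Q where "Q = (R o\<^sub>L R) + (id_blinfun - P)"
  have Qx: "Q x = R (R x) + (x - P x)" for x by (simp add: Q_def)
  have Qsym: "Q x \<bullet> y = x \<bullet> Q y" for x y
    by (simp add: Qx inner_simps Rsym P(5))
  have Qpos: "min c 1 * (norm x)\<^sup>2 \<le> Q x \<bullet> x" for x
  proof -
    let ?y = "P x" and ?z = "x - P x"
    have yz: "?z \<bullet> ?y = 0" using P(1,2) by blast
    have "(norm x)\<^sup>2 = (norm (?y + ?z))\<^sup>2" by simp
    also have "\<dots> = (norm ?y)\<^sup>2 + (norm ?z)\<^sup>2"
      using yz by (simp only: power2_norm_eq_inner inner_add_left inner_add_right inner_commute[of ?y ?z])
    finally have nx: "(norm x)\<^sup>2 = (norm ?y)\<^sup>2 + (norm ?z)\<^sup>2" .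
    have "?z \<bullet> x = ?z \<bullet> (?z + ?y)" by simp
    then have zx: "?z \<bullet> x = (norm ?z)\<^sup>2"
      using yz by (simp only: power2_norm_eq_inner inner_add_right)
    have "c * (norm ?y)\<^sup>2 \<le> (norm (R ?y))\<^sup>2" by (rule lower[OF P(1)])
    also have "\<dots> \<le> (norm (R x))\<^sup>2"
      unfolding PRx[symmetric] by (intro power_mono P(4)) simp
    finally have 1: "c * (norm ?y)\<^sup>2 \<le> (norm (R x))\<^sup>2" .
    have "Q x \<bullet> x = (norm (R x))\<^sup>2 + (norm ?z)\<^sup>2"
      unfolding Qx inner_add_left zx by (simp add: power2_norm_eq_inner Rsym)
    moreover have "min c 1 * (norm ?y)\<^sup>2 \<le> c * (norm ?y)\<^sup>2" "min c 1 * (norm ?z)\<^sup>2 \<le> 1 * (norm ?z)\<^sup>2"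
      by (intro mult_right_mono; simp)+
    ultimately show ?thesis using 1 unfolding nx by (simp add: algebra_simps)
  qed
  let ?G = "{(x, Q x) | x. True}"
  have saG: "selfadjoint ?G"
    unfolding selfadjoint_def linear_operator_def
  proof (intro conjI)
    show "subspace ?G" by (intro subspaceI) (auto simp: zero_prod_def)
    show "single_valued ?G" by (auto simp: single_valued_def)
    have "Domain ?G = UNIV" by auto
    then show "closure (Domain ?G) = UNIV" by simp
    have "(v, w) \<in> adjoint_operator ?G \<longleftrightarrow> (v, w) \<in> ?G" for v w
    proof -
      have "(v, w) \<in> adjoint_operator ?G \<longleftrightarrow> (\<forall>x. x \<bullet> (Q v - w) = 0)"
        by (auto simp: adjoint_operator_def Qsym inner_diff_right)
      also have "\<dots> \<longleftrightarrow> Q v - w = 0"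
      proof
        assume "\<forall>x. x \<bullet> (Q v - w) = 0"
        from this[rule_format, of "Q v - w"] show "Q v - w = 0" by simp
      qed simp
      finally show ?thesis by auto
    qed
    then show "adjoint_operator ?G = ?G" by auto
  qed
  have spG: "strictly_positive ?G"
    unfolding strictly_positive_def using Qpos c by (intro exI[of _ "min c 1"]) auto
  obtain b where b: "bounded_linear b" "\<And>u y. (u, y) \<in> ?G \<longleftrightarrow> u = b y"
    "\<And>x y. b x \<bullet> y = x \<bullet> b y"
    apply (rule strictly_positive_selfadjoint_inverse[OF saG spG])
    subgoal premises prems for b by (rule prems(1)[OF prems(2-4)])
    done
  define D where "D = Blinfun b"
  have Dx: "blinfun_apply D = b" unfolding D_def by (rule bounded_linear_Blinfun_apply[OF b(1)])
  have QD: "Q (D y) = y" for y proof -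
    have "(b y, y) \<in> ?G" using b(2) by simp
    then show ?thesis by (simp add: Dx)
  qed
  have DQ: "D (Q x) = x" for x proof -
    have "(x, Q x) \<in> ?G" by simp
    then show ?thesis unfolding b(2) Dx by (rule sym)
  qed
  have PQ: "P (Q x) = Q (P x)" for x by (simp add: Qx PRx)
  have RQ: "R (Q x) = Q (R x)" for x by (simp add: Qx PRx)
  have PD: "P (D x) = D (P x)" for x
    using arg_cong[OF PQ[of "D x"], of "blinfun_apply D"] by (simp only: DQ QD)
  have RD: "R (D x) = D (R x)" for x
    using arg_cong[OF RQ[of "D x"], of "blinfun_apply D"] by (simp only: DQ QD)
  have BDP: "R (R (D (P x))) = P x" for x
    using QD[of "P x"] unfolding Qx by (simp add: PD PPx)
  \<comment> \<open>As Q = R^2 on M, the product D P inverts R^2 there, and one factor R turns it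
    into an inverse of R.\<close>
  define L where "L = R o\<^sub>L D o\<^sub>L P"
  have Lx: "L x = R (D (P x))" for x by (simp add: L_def)
  show thesis
  proof (rule that[of P L])
    show "P o\<^sub>L P = P" by (rule PP)
    show "R o\<^sub>L L = P" by (rule blinfun_eqI) (simp add: Lx BDP)
    show "L o\<^sub>L R = P" by (rule blinfun_eqI) (simp add: Lx PRx BDP flip: RD)
    show "P o\<^sub>L L = L" by (rule blinfun_eqI) (simp add: Lx PRx PD PPx)
    show "L o\<^sub>L P = L" by (rule blinfun_eqI) (simp add: Lx PPx)
    show "R o\<^sub>L P = P o\<^sub>L R" by (rule blinfun_eqI) (simp add: PRx)
    show "P x \<bullet> y = x \<bullet> P y" for x y by (rule P(5))
    show "L x \<bullet> y = x \<bullet> L y" for x y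
      by (simp only: Lx Rsym Dx b(3) P(5)) (simp only: Dx[symmetric] PD[symmetric] RD[symmetric] PRx)
    show "norm (P x) \<le> norm x" for x by (rule P(4))
    show "norm (R (x - P x)) \<le> \<epsilon> * norm x" for x
    proof -
      let ?z = "x - P x"
      have "?z \<bullet> P x = 0" by (rule P(2)[OF P(1)])
      then have "(norm (P x + ?z))\<^sup>2 = (norm (P x))\<^sup>2 + (norm ?z)\<^sup>2"
        by (simp only: power2_norm_eq_inner inner_add_left inner_add_right inner_commute[of "P x" ?z])
      then have "(norm ?z)\<^sup>2 \<le> (norm x)\<^sup>2" by (simp del: app)
      then have "c * (norm ?z)\<^sup>2 \<le> c * (norm x)\<^sup>2" using c by simp
      then have "(norm (R ?z))\<^sup>2 \<le> (\<epsilon> * norm x)\<^sup>2"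
        using upper[OF P(2), of x] unfolding c_def power_mult_distrib by linarith
      then show ?thesis by (rule power2_le_imp_le) (use eps in simp)
    qed
  qed
qed

text \<open>On a vector R y of the range, which is dense, the error of P n is R (y - P n y) and
  tends to 0; the bound |P n x| \<le> |x| carries this over to all x.\<close>

lemma cutoffs_tendsto:
  fixes R :: "'a::{real_inner, banach} \<Rightarrow>\<^sub>L 'a" and P :: "nat \<Rightarrow> 'a \<Rightarrow>\<^sub>L 'a"
  assumes R: "positive_blinfun R" "injective_blinfun R"
    and comm: "\<And>n. R o\<^sub>L P n = P n o\<^sub>L R" and nP: "\<And>n x. norm ((P n) x) \<le> norm x"
    and small: "\<And>n x. norm (R (x - (P n) x)) \<le> 1 / (real n + 1) * norm x"
  shows "(\<lambda>n. (P n) x) \<longlonglongrightarrow> x"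
proof (rule LIMSEQ_I)
  fix e :: real assume e: "e > 0"
  have "closure (range (blinfun_apply R)) = UNIV"
    using R by (intro dense_range_symmetric) (auto simp: positive_blinfunD(1) injective_blinfun_def intro: bounded_linear.linear[OF blinfun.bounded_linear_right])
  then have "x \<in> closure (range (blinfun_apply R))" by simp
  then obtain y where y: "dist (R y) x < e/3"
    using e unfolding closure_approachable by (metis divide_pos_pos rangeE zero_less_numeral)
  obtain N :: nat where N: "norm y / (e/3) < real N" using reals_Archimedean2 by blast
  have "norm ((P n) x - x) < e" if "n \<ge> N" for n
  proof -
    have comm': "(P n) (R y) = R ((P n) y)"
      by (simp flip: blinfun_apply_blinfun_compose add: comm)
    have "norm (R y - (P n) (R y)) \<le> 1 / (real n + 1) * norm y"
      using small[of y n] unfolding comm' by (simp add: blinfun.bilinear_simps)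
    also have "\<dots> < e/3"
    proof -
      have "norm y < (e/3) * real N" using N e by (simp add: field_simps)
      also have "\<dots> \<le> (e/3) * (real n + 1)" using e that by (intro mult_left_mono) auto
      finally show ?thesis by (simp add: field_simps)
    qed
    finally have 1: "norm (R y - (P n) (R y)) < e/3" .
    have 2: "norm ((P n) (x - R y)) < e/3"
      using nP[of n "x - R y"] y by (simp add: dist_norm norm_minus_commute)
    have "(P n) x - x = (P n) (x - R y)
        - (R y - (P n) (R y)) + (R y - x)"
      by (simp add: blinfun.bilinear_simps)
    also have "norm \<dots> \<le> norm ((P n) (x - R y))
        + norm (R y - (P n) (R y)) + norm (R y - x)"
      by (intro order_trans[OF norm_triangle_ineq] add_right_mono norm_triangle_ineq4)
    also have "\<dots> < e" using 1 2 y by (simp add: dist_norm)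
    finally show ?thesis .
  qed
  then show "\<exists>no. \<forall>n\<ge>no. norm ((P n) x - x) < e" by blast
qed

section \<open>Convolutions\<close>

text \<open>The kernel gets the argument t - s, so that a derivative in t falls on k and f only
  needs to be continuous.\<close>

definition conv :: "(real \<Rightarrow> real) \<Rightarrow> (real \<Rightarrow> 'a::real_normed_vector) \<Rightarrow> real \<Rightarrow> 'a" where
  "conv k f t = integral {0..t} (\<lambda>s. k (t - s) *\<^sub>R f s)"

lemma at_within_Icc_extend:
  fixes t :: real
  assumes "t < T"
  shows "at t within {a..T} = at t within {a..}"
  by (rule at_within_nhd[of t "{..<T}"]) (use assms in auto)

lemma integral_upper_has_vector_derivative:
  fixes f :: "real \<Rightarrow> 'a::banach"
  assumes "continuous_on {0..} f" "0 \<le> t"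
  shows "((\<lambda>x. integral {0..x} f) has_vector_derivative f t) (at t within {0..})"
proof -
  have "((\<lambda>x. integral {0..x} f) has_vector_derivative f t) (at t within {0..t + 1})"
    using assms by (intro integral_has_vector_derivative continuous_on_subset[OF assms(1)]) auto
  then show ?thesis by (simp add: at_within_Icc_extend)
qed

lemma integral_reflect_interval:
  fixes h :: "real \<Rightarrow> 'a::banach"
  assumes "continuous_on {0..t} h"
  shows "integral {0..t} (\<lambda>s. h (t - s)) = integral {0..t} h"
proof (cases "0 \<le> t")
  case True
  have "(h has_integral integral {0..t} h) (cbox 0 t)"
    using assms by (simp add: integrable_integral integrable_continuous_real)
  from has_integral_affinity[OF this, of "- 1" t]
  have "((\<lambda>s. h (t - s)) has_integral integral {0..t} h) ((\<lambda>s. t - s) ` {0..t})" by simp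
  moreover have "(\<lambda>s. t - s) ` {0..t} = {0..t}" using True by (simp add: image_diff_atLeastAtMost)
  ultimately show ?thesis by (simp add: integral_unique)
qed simp

lemma integral_scale01:
  fixes h :: "real \<Rightarrow> 'a::banach"
  assumes "0 \<le> x" "continuous_on {0..x} h"
  shows "integral {0..x} h = x *\<^sub>R integral {0..1} (\<lambda>\<theta>. h (x * \<theta>))"
proof (cases "x = 0")
  case False
  then have "x > 0" using assms by simp
  have "(h has_integral integral {0..x} h) {0..x}"
    using assms by (intro integrable_integral integrable_continuous_real)
  from has_integral_stretch_real[OF this False]
  have "((\<lambda>\<theta>. h (x * \<theta>)) has_integral (1 / \<bar>x\<bar>) *\<^sub>R integral {0..x} h) ((\<lambda>y. y / x) ` {0..x})" .
  moreover have "(\<lambda>y. y / x) ` {0..x} = {0..1}"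
    using \<open>x > 0\<close> by (simp add: image_divide_atLeastAtMost)
  ultimately have "integral {0..1} (\<lambda>\<theta>. h (x * \<theta>)) = (1 / \<bar>x\<bar>) *\<^sub>R integral {0..x} h"
    by (simp add: integral_unique)
  then show ?thesis using \<open>x > 0\<close> by simp
qed simp

text \<open>Scaling by x maps the variable interval onto [0,1] and moves x into the integrand, where
  continuity in a parameter is available.\<close>

lemma continuous_on_integral_two_params:
  fixes f :: "real \<Rightarrow> 'a::banach"
  assumes "continuous_on UNIV k" "continuous_on UNIV f"
  shows "continuous_on ({0..} \<times> UNIV) (\<lambda>(x, t). integral {0..x} (\<lambda>s. k (t - s) *\<^sub>R f s))"
proof -
  have "continuous_on ({0..} \<times> UNIV) (\<lambda>(x, t). x *\<^sub>R integral {0..1} (\<lambda>\<theta>. k (t - x * \<theta>) *\<^sub>R f (x * \<theta>)))"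
  proof -
    have "continuous_on (({0..} \<times> UNIV) \<times> cbox 0 1)
      (\<lambda>(p, \<theta>). k (snd p - fst p * \<theta>) *\<^sub>R f (fst p * \<theta>))"
      unfolding case_prod_beta
      by (intro continuous_intros continuous_on_compose2[OF assms(1)] continuous_on_compose2[OF assms(2)]) auto
    from integral_continuous_on_param[OF this]
    show ?thesis unfolding case_prod_beta
      by (intro continuous_intros) simp
  qed
  moreover have "(case p of (x, t) \<Rightarrow> integral {0..x} (\<lambda>s. k (t - s) *\<^sub>R f s)) =
    (case p of (x, t) \<Rightarrow> x *\<^sub>R integral {0..1} (\<lambda>\<theta>. k (t - x * \<theta>) *\<^sub>R f (x * \<theta>)))"
    if "p \<in> {0..} \<times> UNIV" for p
  proof -
    obtain x t where p: "p = (x, t)" "0 \<le> x" using \<open>p \<in> {0..} \<times> UNIV\<close> by auto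
    have "continuous_on {0..x} (\<lambda>s. k (t - s) *\<^sub>R f s)"
      by (intro continuous_intros continuous_on_compose2[OF assms(1)] continuous_on_compose2[OF assms(2)]) auto
    from integral_scale01[OF p(2) this] show ?thesis by (simp add: p)
  qed
  ultimately show ?thesis by (rule continuous_on_eq[OF _ sym])
qed

lemma continuous_on_UNIV_extend:
  fixes f :: "real \<Rightarrow> 'a::topological_space"
  assumes "continuous_on {0..} f"
  shows "continuous_on UNIV (\<lambda>s. f (max 0 s))"
  by (rule continuous_on_compose2[OF assms]) (auto intro!: continuous_intros)

lemma continuous_on_conv_integrand:
  fixes f :: "real \<Rightarrow> 'a::real_normed_vector"
  assumes "continuous_on {0..} k" "continuous_on {0..} f"
  shows "continuous_on {0..t} (\<lambda>s. k (t - s) *\<^sub>R f s)"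
  by (intro continuous_intros continuous_on_compose2[OF assms(1)] continuous_on_compose2[OF assms(2)]) auto

lemma conv_integrable:
  fixes f :: "real \<Rightarrow> 'a::banach"
  assumes "continuous_on {0..} k" "continuous_on {0..} f"
  shows "(\<lambda>s. k (t - s) *\<^sub>R f s) integrable_on {0..t}"
  using continuous_on_conv_integrand[OF assms] by (rule integrable_continuous_real)

lemma continuous_on_conv:
  fixes f :: "real \<Rightarrow> 'a::banach"
  assumes "continuous_on {0..} k" "continuous_on {0..} f"
  shows "continuous_on {0..} (conv k f)"
proof -
  have "continuous_on {0..} (\<lambda>t. (\<lambda>(x, t). integral {0..x} (\<lambda>s. k (max 0 (t - s)) *\<^sub>R f (max 0 s))) (t, t))"
    by (rule continuous_on_compose2[OF continuous_on_integral_two_params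
        [OF continuous_on_UNIV_extend[OF assms(1)] continuous_on_UNIV_extend[OF assms(2)]]])
      (auto intro!: continuous_intros)
  moreover have "(\<lambda>(x, t). integral {0..x} (\<lambda>s. k (max 0 (t - s)) *\<^sub>R f (max 0 s))) (t, t) = conv k f t" for t
    unfolding conv_def by (auto intro!: integral_cong)
  ultimately show ?thesis by simp
qed

lemma conv_0 [simp]: "conv k f 0 = 0"
  by (simp add: conv_def)

lemma conv_one:
  assumes "continuous_on {0..} k"
  shows "conv k (\<lambda>_. 1) t = integral {0..t} k"
proof -
  have "continuous_on {0..t} k" by (rule continuous_on_subset[OF assms]) auto
  then have "integral {0..t} (\<lambda>s. k (t - s)) = integral {0..t} k" by (rule integral_reflect_interval)
  then show ?thesis by (simp add: conv_def)
qed

lemma conv_linear: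
  fixes f :: "real \<Rightarrow> 'a::banach" and T :: "'a \<Rightarrow> 'b::banach"
  assumes "bounded_linear T" "continuous_on {0..} k" "continuous_on {0..} f"
  shows "conv k (\<lambda>s. T (f s)) t = T (conv k f t)"
  unfolding conv_def using integral_linear[OF conv_integrable[OF assms(2,3)] assms(1), of t]
  by (simp add: o_def linear_scale[OF bounded_linear.linear[OF assms(1)]])

lemma conv_diff:
  fixes f :: "real \<Rightarrow> 'a::banach"
  assumes "continuous_on {0..} k" "continuous_on {0..} f" "continuous_on {0..} h"
  shows "conv k (\<lambda>s. f s - h s) t = conv k f t - conv k h t"
  unfolding conv_def scaleR_diff_right
  by (rule integral_diff[OF conv_integrable[OF assms(1,2)] conv_integrable[OF assms(1,3)]])

lemma conv_diff_left:
  fixes f :: "real \<Rightarrow> 'a::banach"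
  assumes "continuous_on {0..} k" "continuous_on {0..} l" "continuous_on {0..} f"
  shows "conv k f t - conv l f t = conv (\<lambda>s. k s - l s) f t"
  unfolding conv_def scaleR_diff_left
  by (rule integral_diff[OF conv_integrable[OF assms(1,3)] conv_integrable[OF assms(2,3)], symmetric])

lemma norm_conv_le:
  fixes f :: "real \<Rightarrow> 'a::banach"
  assumes k: "continuous_on {0..} k" "\<And>s. 0 \<le> s \<Longrightarrow> s \<le> t \<Longrightarrow> 0 \<le> k s" and f: "continuous_on {0..} f"
    and C: "\<And>s. 0 \<le> s \<Longrightarrow> s \<le> t \<Longrightarrow> norm (f s) \<le> C"
  shows "norm (conv k f t) \<le> C * integral {0..t} k"
proof -
  have "norm (conv k f t) \<le> integral {0..t} (\<lambda>s. C * k (t - s))"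
    unfolding conv_def
  proof (rule integral_norm_bound_integral[OF conv_integrable[OF k(1) f]])
    show "(\<lambda>s. C * k (t - s)) integrable_on {0..t}"
      by (intro integrable_continuous_real continuous_intros continuous_on_compose2[OF k(1)]) auto
    show "norm (k (t - s) *\<^sub>R f s) \<le> C * k (t - s)" if "s \<in> {0..t}" for s
      using mult_right_mono[OF C[of s] k(2)[of "t - s"]] k(2)[of "t - s"] that by (simp add: mult.commute)
  qed
  also have "\<dots> = C * integral {0..t} k"
  proof -
    have "continuous_on {0..t} k" by (rule continuous_on_subset[OF k(1)]) auto
    then have "integral {0..t} (\<lambda>s. k (t - s)) = integral {0..t} k" by (rule integral_reflect_interval)
    then show ?thesis by (simp only: integral_mult_right)
  qed
  finally show ?thesis .
qed

text \<open>The variable t is both the upper limit and a parameter of the integrand. The two roles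
  are separated as x and u, and the chain rule is applied along the diagonal.\<close>

lemma conv_has_vector_derivative:
  fixes f :: "real \<Rightarrow> 'a::banach"
  assumes k: "\<And>t. 0 \<le> t \<Longrightarrow> (k has_vector_derivative k' t) (at t within {0..})"
    and k': "continuous_on {0..} k'" and f: "continuous_on {0..} f" and t: "0 \<le> t"
  shows "(conv k f has_vector_derivative (k 0 *\<^sub>R f t + conv k' f t)) (at t within {0..})"
proof -
  \<comment> \<open>Off the diagonal u - s may be negative, so k is continued below 0 by its tangent
    at 0, which makes it C^1 on the whole line.\<close>
  define l where "l s = (if s \<in> {0..} then k s else k 0 + s * k' 0)" for s
  define l' where "l' s = k' (max 0 s)" for s
  define f' where "f' s = f (max 0 s)" for s
  have l: "(l has_vector_derivative l' s) (at s)" for s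
  proof -
    have eq: "{0..} \<union> closure {0..} \<inter> closure {..0} = {0::real..}" "{..0} \<union> closure {0..} \<inter> closure {..0} = {..0::real}"
      by auto
    have lin: "((\<lambda>s. k 0 + s * k' 0) has_vector_derivative k' 0) (at s within {..0})"
      unfolding has_real_derivative_iff_has_vector_derivative[symmetric]
      by (rule derivative_eq_intros refl)+ simp
    have "(l has_vector_derivative (if s \<in> {0..} then k' s else k' 0)) (at s within UNIV)"
      unfolding l_def
    proof (rule has_vector_derivative_If_within_closures[of s "{0..}" "{..0}" UNIV k k'
          "\<lambda>s. k 0 + s * k' 0" "\<lambda>_. k' 0"], unfold eq)
      show "s \<in> {0..} \<union> {..0}" "UNIV = {0::real..} \<union> {..0}" by auto
      show "(k has_vector_derivative k' s) (at s within {0..})" if "s \<in> {0..}" using that by (intro k) simp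
      show "((\<lambda>s. k 0 + s * k' 0) has_vector_derivative k' 0) (at s within {..0})" by (rule lin)
      show "k s = k 0 + s * k' 0" "k' s = k' 0" if "s \<in> closure {0..}" "s \<in> closure {..0}"
      proof -
        have "s = 0" using that by simp
        then show "k s = k 0 + s * k' 0" "k' s = k' 0" by simp_all
      qed
    qed
    moreover have "(if s \<in> {0..} then k' s else k' 0) = l' s" by (simp add: l'_def)
    ultimately show ?thesis by simp
  qed
  have cl: "continuous_on UNIV l"
    using l by (auto intro!: continuous_at_imp_continuous_on has_vector_derivative_continuous)
  have cl': "continuous_on UNIV l'" and cf': "continuous_on UNIV f'"
    unfolding l'_def f'_def using k' f by (auto intro: continuous_on_UNIV_extend)
  define H where "H = (\<lambda>x u. integral {0..x} (\<lambda>s. l (u - s) *\<^sub>R f' s))"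
  define H' where "H' x u = integral {0..x} (\<lambda>s. l' (u - s) *\<^sub>R f' s)" for x u
  have "((\<lambda>(x, u). H x u) has_derivative (\<lambda>(tx, tu). tx *\<^sub>R (l (t - t) *\<^sub>R f' t) + blinfun_scaleR_left (H' t t) tu))
      (at (t, t) within {0..} \<times> UNIV)"
  proof (rule has_derivative_partialsI[where f = H and fx = "\<lambda>tx. tx *\<^sub>R (l (t - t) *\<^sub>R f' t)"
        and fy = "\<lambda>x u. blinfun_scaleR_left (H' x u)" and x = t and y = t and X = "{0..}" and Y = UNIV])
    have "continuous_on {0..} (\<lambda>s. l (t - s) *\<^sub>R f' s)"
      by (intro continuous_intros continuous_on_compose2[OF cl] continuous_on_subset[OF cf']) auto
    from integral_upper_has_vector_derivative[OF this t]
    show "((\<lambda>x. H x t) has_derivative (\<lambda>tx. tx *\<^sub>R (l (t - t) *\<^sub>R f' t))) (at t within {0..})"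
      unfolding H_def has_vector_derivative_def .
  next
    fix x u :: real
    have "((\<lambda>u. integral (cbox 0 x) (\<lambda>s. l (u - s) *\<^sub>R f' s)) has_vector_derivative
        integral (cbox 0 x) (\<lambda>s. l' (u - s) *\<^sub>R f' s)) (at u within UNIV)"
    proof (rule leibniz_rule_vector_derivative)
      fix u s :: real
      have "((\<lambda>u. l (u - s)) has_vector_derivative l' (u - s)) (at u)"
        using DERIV_shift[of l "l' (u - s)" u "- s"] l[of "u - s"]
        by (simp add: has_real_derivative_iff_has_vector_derivative)
      then show "((\<lambda>u. l (u - s) *\<^sub>R f' s) has_vector_derivative l' (u - s) *\<^sub>R f' s) (at u within UNIV)"
        by (rule bounded_linear.has_vector_derivative[OF bounded_linear_scaleR_left])
      show "(\<lambda>s. l (u - s) *\<^sub>R f' s) integrable_on cbox 0 x"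
        by (intro integrable_continuous continuous_intros continuous_on_compose2[OF cl] continuous_on_subset[OF cf']) auto
    next
      show "continuous_on (UNIV \<times> cbox 0 x) (\<lambda>(u, s). l' (u - s) *\<^sub>R f' s)"
        unfolding case_prod_beta
        by (intro continuous_intros continuous_on_compose2[OF cl'] continuous_on_compose2[OF cf']) auto
    qed auto
    moreover have "blinfun_apply (blinfun_scaleR_left y) = (\<lambda>h. h *\<^sub>R y)" for y :: 'a by auto
    ultimately show "(H x has_derivative blinfun_scaleR_left (H' x u)) (at u within UNIV)"
      unfolding H_def H'_def has_vector_derivative_def by (simp only: box_real)
  next
    have "continuous_on ({0..} \<times> UNIV) (\<lambda>(x, u). H' x u)"
      unfolding H'_def by (rule continuous_on_integral_two_params[OF cl' cf'])
    then have "continuous_on ({0..} \<times> UNIV) (\<lambda>p. blinfun_scaleR_left (case p of (x, u) \<Rightarrow> H' x u))"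
      by (rule bounded_linear.continuous_on[OF bounded_linear_blinfun_scaleR_left])
    then have "continuous_on ({0..} \<times> UNIV) (\<lambda>(x, u). blinfun_scaleR_left (H' x u))"
      by (simp add: case_prod_beta)
    then show "continuous (at (t, t) within {0..} \<times> UNIV) (\<lambda>(x, u). blinfun_scaleR_left (H' x u))"
      unfolding continuous_on_eq_continuous_within by (rule bspec) (use t in simp)
    show "t \<in> UNIV" "convex (UNIV :: real set)" by simp_all
  qed
  then have D: "((\<lambda>(x, u). H x u) has_derivative (\<lambda>(tx, tu). tx *\<^sub>R (l (t - t) *\<^sub>R f' t) + blinfun_scaleR_left (H' t t) tu))
      (at (t, t) within (\<lambda>u. (u, u)) ` {0..})"
    by (rule has_derivative_subset) auto
  have "((\<lambda>u. (\<lambda>(x, u). H x u) (u, u)) has_derivative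
      (\<lambda>h. (\<lambda>(tx, tu). tx *\<^sub>R (l (t - t) *\<^sub>R f' t) + blinfun_scaleR_left (H' t t) tu) (h, h))) (at t within {0..})"
    by (rule has_derivative_in_compose[where f = "\<lambda>u. (u, u)" and f' = "\<lambda>h. (h, h)", OF _ D])
      (intro has_derivative_Pair has_derivative_ident)
  then have "((\<lambda>u. H u u) has_vector_derivative (l 0 *\<^sub>R f' t + H' t t)) (at t within {0..})"
    by (simp add: has_vector_derivative_def scaleR_add_right)
  moreover have "H u u = conv k f u" "H' u u = conv k' f u" for u
    unfolding H_def H'_def conv_def l_def l'_def f'_def by (auto intro!: integral_cong)
  moreover have "l 0 = k 0" "f' t = f t" using t by (simp_all add: l_def f'_def)
  ultimately show ?thesis by simp
qed

text \<open>Links the memory integrals, whose sign is known, with convolutions, whose derivative is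
  known. The vector a is free: it will be p t in some places and p t + q t / \<alpha> in
  another.\<close>

lemma integral_quadratic_conv:
  fixes f :: "real \<Rightarrow> 'a::{real_inner, banach}"
  assumes k: "continuous_on {0..} k" and f: "continuous_on {0..} f"
  shows "integral {0..t} (\<lambda>s. k (t - s) * (norm (a - f s))\<^sup>2) =
     integral {0..t} k * (a \<bullet> a) - 2 * (a \<bullet> conv k f t) + conv k (\<lambda>s. f s \<bullet> f s) t"
proof -
  have cf: "continuous_on {0..} (\<lambda>s. f s \<bullet> f s)" "continuous_on {0..} (\<lambda>s. a \<bullet> f s)"
    by (intro continuous_intros f)+
  have "integral {0..t} (\<lambda>s. k (t - s) * (norm (a - f s))\<^sup>2) =
      integral {0..t} (\<lambda>s. (a \<bullet> a) * (k (t - s) *\<^sub>R 1) - 2 * (k (t - s) *\<^sub>R (a \<bullet> f s)) + k (t - s) *\<^sub>R (f s \<bullet> f s))"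
    by (intro integral_cong) (simp add: power2_norm_eq_inner inner_simps inner_commute algebra_simps)
  also have "\<dots> = (a \<bullet> a) * conv k (\<lambda>_. 1) t - 2 * conv k (\<lambda>s. a \<bullet> f s) t + conv k (\<lambda>s. f s \<bullet> f s) t"
  proof (rule integral_unique)
    have I: "((\<lambda>s. k (t - s) *\<^sub>R h s) has_integral conv k h t) {0..t}"
      if "continuous_on {0..} h" for h :: "real \<Rightarrow> real"
      unfolding conv_def by (rule integrable_integral[OF conv_integrable[OF k that]])
    show "((\<lambda>s. (a \<bullet> a) * (k (t - s) *\<^sub>R 1) - 2 * (k (t - s) *\<^sub>R (a \<bullet> f s)) + k (t - s) *\<^sub>R (f s \<bullet> f s))
      has_integral (a \<bullet> a) * conv k (\<lambda>_. 1) t - 2 * conv k (\<lambda>s. a \<bullet> f s) t + conv k (\<lambda>s. f s \<bullet> f s) t) {0..t}"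
      by (intro has_integral_add has_integral_diff has_integral_mult_right I cf continuous_intros)
  qed
  also have "conv k (\<lambda>s. a \<bullet> f s) t = a \<bullet> conv k f t"
    by (rule conv_linear[OF bounded_linear_inner_right k f])
  finally show ?thesis by (simp add: conv_one[OF k] mult.commute)
qed

section \<open>Regularization of the memory kernel\<close>

text \<open>\<open>G\<close> is \<open>g\<close> extended continuously to \<open>0\<close>, where \<open>g'\<close> may be singular; the \<open>k n\<close> are \<open>C\<^sup>2\<close> up to \<open>0\<close>,
  approximate \<open>G\<close> from below and have derivatives \<open>k1 n\<close>, \<open>k2 n\<close>. The sign condition
  \<open>\<alpha> * k1 n s \<le> k2 n s\<close> is all that is needed of (g3).\<close>

locale regularized_kernel =
  fixes g :: "real \<Rightarrow> real" and \<alpha> \<kappa> :: real and G :: "real \<Rightarrow> real"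
    and k k1 k2 :: "nat \<Rightarrow> real \<Rightarrow> real" and e :: "nat \<Rightarrow> real" and c :: real
  assumes G_cont: "continuous_on {0..} G" and G_eq: "0 < s \<Longrightarrow> G s = g s"
    and G_nonneg: "0 \<le> s \<Longrightarrow> 0 \<le> G s" and G_le: "0 \<le> s \<Longrightarrow> G s \<le> G 0"
    and G_integral: "0 \<le> t \<Longrightarrow> integral {0..t} G \<le> \<kappa>"
    and k_deriv: "0 \<le> s \<Longrightarrow> (k n has_vector_derivative k1 n s) (at s within {0..})"
    and k1_deriv: "0 \<le> s \<Longrightarrow> (k1 n has_vector_derivative k2 n s) (at s within {0..})"
    and k2_cont: "continuous_on {0..} (k2 n)"
    and k_nonneg: "0 \<le> s \<Longrightarrow> 0 \<le> k n s" and k1_nonpos: "0 \<le> s \<Longrightarrow> k1 n s \<le> 0"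
    and k2_ge: "0 \<le> s \<Longrightarrow> \<alpha> * k1 n s \<le> k2 n s"
    and k_le: "0 \<le> s \<Longrightarrow> k n s \<le> G s"
    and k_integral: "0 \<le> t \<Longrightarrow> integral {0..t} (\<lambda>s. G s - k n s) \<le> e n" and e_lim: "e \<longlonglongrightarrow> 0"
    and k1_lim: "0 < s \<Longrightarrow> (\<lambda>n. k1 n s) \<longlonglongrightarrow> deriv g s"
    and k1_bound: "0 < s \<Longrightarrow> - k1 n s \<le> - deriv g s + c"
    and dg_integrable: "set_integrable lborel {0<..} (deriv g)"

lemma real_derivative_imp_vector_derivative_within:
  "(f has_real_derivative y) (at s) \<Longrightarrow> (f has_vector_derivative y) (at s within S)"
  by (drule iffD1[OF has_real_derivative_iff_has_vector_derivative]) (rule has_vector_derivative_at_within)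

lemma vector_derivative_within_atLeast_imp_real_derivative:
  assumes "(f has_vector_derivative y) (at s within {a..})" "a < s"
  shows "(f has_real_derivative y) (at s)"
proof -
  have "at s within {a..} = at s" by (rule at_within_interior) (use assms(2) in simp)
  then show ?thesis using assms(1) by (simp only: has_real_derivative_iff_has_vector_derivative)
qed

lemma AE_lborel_negligible:
  assumes "AE s in lborel. P s"
  obtains N where "negligible N" "\<And>s. s \<notin> N \<Longrightarrow> P s"
proof -
  from assms obtain N where N: "N \<in> null_sets lborel" "{s \<in> space lborel. \<not> P s} \<subseteq> N"
    unfolding eventually_ae_filter by blast
  have "negligible N" using N(1) by (simp add: negligible_iff_null_sets null_sets_completionI)
  then show thesis using that N(2) by auto
qed

lemma kernel_regularization:
  assumes g1: "kernel_g1 g \<gamma>" and g2: "kernel_g2 g" and g3: "kernel_g3 g \<alpha>"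
  obtains G k k1 k2 e c where "regularized_kernel g \<alpha> (LINT s:{0<..}|lborel. g s) G k k1 k2 e c"
proof -
  obtain \<delta> where \<delta>: "\<delta> > 0" "\<delta> < \<alpha>"
    and g3': "AE s in lborel. 0 < s \<longrightarrow> (\<alpha> - \<delta>) * deriv g s - deriv (deriv g) s \<le> 0"
    using g3 unfolding kernel_g3_def by blast
  define d where "d = \<alpha> - \<delta>"
  have d: "0 \<le> d" "d \<le> \<alpha>" using \<delta> by (auto simp: d_def)
  define \<kappa> where "\<kappa> = (LINT s:{0<..}|lborel. g s)"
  have gi: "set_integrable lborel {0<..} g" and dgi: "set_integrable lborel {0<..} (deriv g)"
    and ac: "\<And>a b. 0 < a \<Longrightarrow> a \<le> b \<Longrightarrow> abs_continuous_on {a..b} (deriv g)"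
    and gd: "\<And>s. 0 < s \<Longrightarrow> (g has_real_derivative deriv g s) (at s)"
    using g1 unfolding kernel_g1_def by (auto simp: DERIV_deriv_iff_real_differentiable)
  have g_nn: "0 \<le> g s" and dg_np: "deriv g s \<le> 0" if "0 < s" for s
    using g2 that unfolding kernel_g2_def by auto
  have g_isCont: "isCont g s" if "0 < s" for s using gd[OF that] by (rule DERIV_isCont)
  have dg_isCont: "isCont (deriv g) s" if "0 < s" for s
  proof -
    have "continuous_on {s/2..s + 1} (deriv g)"
      using that by (intro abs_continuous_on_imp_continuous_on ac) auto
    then show ?thesis by (rule continuous_on_interior) (use that in simp)
  qed
  have g_mono: "g y \<le> g x" if "0 < x" "x \<le> y" for x y
  proof (rule DERIV_nonpos_imp_nonincreasing[OF that(2)])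
    fix z assume "x \<le> z" "z \<le> y"
    then have "0 < z" using that by simp
    then show "\<exists>w. (g has_real_derivative w) (at z) \<and> w \<le> 0" using gd dg_np by blast
  qed
  have dg_int: "(deriv g has_integral (g y - g x)) {x..y}" if "0 < x" "x \<le> y" for x y
  proof (rule fundamental_theorem_of_calculus[OF that(2)])
    fix z assume "z \<in> {x..y}"
    then have "0 < z" using that by simp
    then show "(g has_vector_derivative deriv g z) (at z within {x..y})"
      by (intro real_derivative_imp_vector_derivative_within gd)
  qed
  \<comment> \<open>(g3) in integrated form: as \<open>deriv g\<close> is absolutely continuous, its
    increment is the integral of its derivative, which exists almost everywhere.\<close>
  have key: "d * (g y - g x) \<le> deriv g y - deriv g x" if xy: "0 < x" "x \<le> y" for x y
  proof -
    obtain N where N: "negligible N" "\<And>s. s \<notin> N \<Longrightarrow> 0 < s \<longrightarrow> d * deriv g s - deriv (deriv g) s \<le> 0"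
      using AE_lborel_negligible[OF g3'] unfolding d_def by blast
    have "(deriv (deriv g) has_integral (deriv g y - deriv g x)) {x..y}"
      by (rule abs_continuous_deriv_has_integral[OF ac[OF xy] xy(2)])
    \<comment> \<open>The maximum turns a comparison of integrands that holds almost everywhere into
      one that holds everywhere.\<close>
    then have 1: "((\<lambda>s. max (d * deriv g s) (deriv (deriv g) s)) has_integral (deriv g y - deriv g x)) {x..y}"
    proof (rule has_integral_spike[OF N(1), rotated])
      fix s assume s: "s \<in> {x..y} - N"
      then have "0 < s" using xy by simp
      then show "max (d * deriv g s) (deriv (deriv g) s) = deriv (deriv g) s" using N(2)[of s] s by simp
    qed
    have 2: "((\<lambda>s. d * deriv g s) has_integral (d * (g y - g x))) {x..y}"
      by (rule has_integral_mult_right[OF dg_int[OF xy]])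
    show ?thesis by (rule has_integral_le[OF 2 1]) simp
  qed
  \<comment> \<open>Summability of g' near 0 keeps g bounded there; as g decreases, its supremum is
    its limit at 0 and serves as G 0.\<close>
  have bdd: "bdd_above (g ` {0<..})"
  proof -
    define I where "I = (LINT s:{0<..}|lborel. - deriv g s)"
    have mi: "set_integrable lborel {0<..} (\<lambda>s. - deriv g s)" using dgi by (simp add: set_integrable_def)
    have "g s \<le> g 1 + I" if s: "0 < s" for s
    proof (cases "s \<le> 1")
      case True
      have cont: "continuous_on {s..1} (\<lambda>s. - deriv g s)"
        using s by (intro continuous_intros continuous_at_imp_continuous_on ballI dg_isCont) auto
      have si: "set_integrable lborel {s..1} (\<lambda>s. - deriv g s)"
        by (rule borel_integrable_atLeastAtMost'[OF cont])
      have "g s - g 1 = integral {s..1} (\<lambda>s. - deriv g s)"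
        using dg_int[OF s True] by (simp add: integral_unique)
      also have "\<dots> = (LINT s:{s..1}|lborel. - deriv g s)"
        using set_borel_integral_eq_integral(2)[OF si] by simp
      also have "\<dots> \<le> I"
        unfolding I_def set_lebesgue_integral_def
        using si mi s dg_np unfolding set_integrable_def
        by (intro integral_mono) (auto simp: indicator_def)
      finally show ?thesis by simp
    next
      case False
      have "0 \<le> I" unfolding I_def set_lebesgue_integral_def using dg_np by (intro integral_nonneg_AE) (auto simp: indicator_def)
      then show ?thesis using g_mono[of 1 s] False by simp
    qed
    then show ?thesis by (auto intro!: bdd_aboveI)
  qed
  define G where "G s = (if 0 < s then g s else Sup (g ` {0<..}))" for s
  have G_g: "G s = g s" if "0 < s" for s using that by (simp add: G_def)
  have g_le0: "g s \<le> G 0" if "0 < s" for s using that bdd by (auto simp: G_def intro: cSup_upper)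
  have G_anti: "G y \<le> G x" if "0 \<le> x" "x \<le> y" for x y :: real
  proof (cases "x = 0")
    case True then show ?thesis using g_le0[of y] that by (cases "y = 0") (auto simp: G_g)
  next
    case False then show ?thesis using g_mono[of x y] that by (simp add: G_g)
  qed
  have G_nn: "0 \<le> G s" if "0 \<le> s" for s
    using G_anti[OF that, of "s + 1"] g_nn[of "s + 1"] that by (simp add: G_g)
  have G_c: "continuous_on {0..} G"
    unfolding continuous_on_eq_continuous_within
  proof
    fix s :: real assume "s \<in> {0..}"
    show "continuous (at s within {0..}) G"
    proof (cases "s = 0")
      case True
      show ?thesis
        unfolding True continuous_within_eps_delta
      proof (intro allI impI)
        fix \<epsilon> :: real assume "\<epsilon> > 0"
        then have "\<exists>y\<in>g ` {0<..}. Sup (g ` {0<..}) - \<epsilon> < y"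
          using bdd by (intro less_cSupD) auto
        then obtain x where x: "0 < x" "G 0 - \<epsilon> < g x" by (auto simp: G_def)
        show "\<exists>d>0. \<forall>x'\<in>{0..}. dist x' 0 < d \<longrightarrow> dist (G x') (G 0) < \<epsilon>"
        proof (intro exI[of _ x] conjI ballI impI x(1))
          fix y :: real assume "y \<in> {0..}" "dist y 0 < x"
          then have "G y \<le> G 0" "G x \<le> G y" by (auto intro!: G_anti)
          then show "dist (G y) (G 0) < \<epsilon>" using x by (simp add: dist_real_def G_g)
        qed
      qed
    next
      case False
      then have s: "0 < s" using \<open>s \<in> {0..}\<close> by simp
      have "isCont G s"
      proof (rule iffD2[OF isCont_cong g_isCont[OF s]])
        show "\<forall>\<^sub>F x in nhds s. G x = g x"
          using eventually_nhds_in_open[of "{0<..}" s] s by (auto elim!: eventually_mono simp: G_g)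
      qed
      then show ?thesis by (rule continuous_at_imp_continuous_at_within)
    qed
  qed
  have G_sub: "continuous_on {a..b} G" if "0 \<le> a" for a b
    by (rule continuous_on_subset[OF G_c]) (use that in auto)
  have G_int: "integral {0..t} G \<le> \<kappa>" if "0 \<le> t" for t
  proof -
    have si: "set_integrable lborel {0..t} G" by (intro borel_integrable_atLeastAtMost' G_sub) simp
    have "integral {0..t} G = (LINT s:{0..t}|lborel. G s)"
      using set_borel_integral_eq_integral(2)[OF si] by simp
    also have "\<dots> \<le> \<kappa>"
      unfolding \<kappa>_def set_lebesgue_integral_def
    proof (rule integral_mono_AE)
      show "AE s in lborel. indicator {0..t} s *\<^sub>R G s \<le> indicator {0<..} s *\<^sub>R g s"
        using AE_lborel_singleton[of "0::real"]
        by eventually_elim (use g_nn in \<open>auto simp: indicator_def G_g\<close>)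
    qed (use si gi in \<open>auto simp: set_integrable_def\<close>)
    finally show ?thesis .
  qed
  define \<Gamma> where "\<Gamma> x = integral {0..x} G" for x
  have \<Gamma>d: "(\<Gamma> has_real_derivative G x) (at x)" if "0 < x" for x
  proof -
    have "(\<Gamma> has_vector_derivative G x) (at x within {0..})"
      unfolding \<Gamma>_def using that by (intro integral_upper_has_vector_derivative G_c) simp
    then show ?thesis using that by (rule vector_derivative_within_atLeast_imp_real_derivative)
  qed
  define h where "h n = 1 / (real n + 1)" for n
  have h: "0 < h n" for n by (simp add: h_def)
  have h_lim: "h \<longlonglongrightarrow> 0"
    using LIMSEQ_inverse_real_of_nat by (simp add: h_def[abs_def] inverse_eq_divide add.commute)
  \<comment> \<open>Written as a difference quotient of the primitive \<Gamma>, the average of G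
    over [s + h, s + 2h] is differentiated by differentiating the quotient. The shift by h keeps
    every argument positive, where g' is continuous.\<close>
  define k where "k n s = (\<Gamma> (s + 2 * h n) - \<Gamma> (s + h n)) / h n" for n s
  define k1 where "k1 n s = (g (s + 2 * h n) - g (s + h n)) / h n" for n s
  define k2 where "k2 n s = (deriv g (s + 2 * h n) - deriv g (s + h n)) / h n" for n s
  have k_mv: "\<exists>z. s + h n < z \<and> z < s + 2 * h n \<and> k n s = G z" if "0 \<le> s" for n s
  proof -
    have "\<exists>z. s + h n < z \<and> z < s + 2 * h n \<and> \<Gamma> (s + 2 * h n) - \<Gamma> (s + h n) = (s + 2 * h n - (s + h n)) * G z"
      using h[of n] that by (intro MVT2 \<Gamma>d) auto
    then show ?thesis using h[of n] by (auto simp: k_def)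
  qed
  have k1_mv: "\<exists>z. s + h n < z \<and> z < s + 2 * h n \<and> k1 n s = deriv g z" if "0 \<le> s" for n s
  proof -
    have "\<exists>z. s + h n < z \<and> z < s + 2 * h n \<and> g (s + 2 * h n) - g (s + h n) = (s + 2 * h n - (s + h n)) * deriv g z"
      using h[of n] that by (intro MVT2 gd) auto
    then show ?thesis using h[of n] by (auto simp: k1_def)
  qed
  have "regularized_kernel g \<alpha> \<kappa> G k k1 k2 (\<lambda>n. 2 * h n * G 0) (d * G 0)"
  proof
    fix s t :: real and n
    show "continuous_on {0..} G" by (rule G_c)
    show "G s = g s" if "0 < s" by (rule G_g[OF that])
    show "0 \<le> G s" if "0 \<le> s" by (rule G_nn[OF that])
    show "G s \<le> G 0" if "0 \<le> s" using G_anti[of 0 s] that by simp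
    show "integral {0..t} G \<le> \<kappa>" if "0 \<le> t" by (rule G_int[OF that])
    show "(k n has_vector_derivative k1 n s) (at s within {0..})" if s: "0 \<le> s"
    proof -
      have "((\<lambda>s. \<Gamma> (s + a)) has_real_derivative g (s + a)) (at s)" if "0 < a" for a
        using \<Gamma>d[of "s + a"] that s by (simp add: DERIV_shift G_g)
      from DERIV_cdivide[OF DERIV_diff[OF this[of "2 * h n"] this[of "h n"]], of "h n"]
      show ?thesis using h[of n] unfolding k_def[abs_def] k1_def
        by (intro real_derivative_imp_vector_derivative_within) simp
    qed
    show "(k1 n has_vector_derivative k2 n s) (at s within {0..})" if s: "0 \<le> s"
    proof -
      have "((\<lambda>s. g (s + a)) has_real_derivative deriv g (s + a)) (at s)" if "0 < a" for a
        using gd[of "s + a"] that s by (simp add: DERIV_shift)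
      from DERIV_cdivide[OF DERIV_diff[OF this[of "2 * h n"] this[of "h n"]], of "h n"]
      show ?thesis using h[of n] unfolding k1_def[abs_def] k2_def
        by (intro real_derivative_imp_vector_derivative_within) simp
    qed
    have dgs: "continuous_on {0..} (\<lambda>s. deriv g (s + a))" if "0 < a" for a
    proof (rule continuous_on_compose2[of "{a..}" "deriv g"])
      show "continuous_on {a..} (deriv g)"
        using that by (intro continuous_at_imp_continuous_on ballI dg_isCont) auto
    qed (auto intro!: continuous_intros)
    show "continuous_on {0..} (k2 n)"
      unfolding k2_def[abs_def] using h[of n] by (intro continuous_intros dgs) auto
    show "0 \<le> k n s" if "0 \<le> s"
      using k_mv[OF that, of n] G_nn h[of n] that by fastforce
    show "k1 n s \<le> 0" if "0 \<le> s"
      using k1_mv[OF that, of n] dg_np h[of n] that by fastforce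
    show "\<alpha> * k1 n s \<le> k2 n s" if "0 \<le> s"
    proof -
      have 1: "k1 n s \<le> 0" using k1_mv[OF that, of n] dg_np h[of n] that by fastforce
      have "\<alpha> * k1 n s \<le> d * k1 n s" using d(2) 1 by (rule mult_right_mono_neg)
      also have "\<dots> \<le> k2 n s"
        using key[of "s + h n" "s + 2 * h n"] h[of n] that by (simp add: k1_def k2_def divide_right_mono)
      finally show ?thesis .
    qed
    show "k n s \<le> G s" if s: "0 \<le> s"
    proof -
      obtain z where "s + h n < z" "k n s = G z" using k_mv[OF s, of n] by blast
      then show ?thesis using G_anti[OF s, of z] h[of n] by simp
    qed
    show "integral {0..t} (\<lambda>s. G s - k n s) \<le> 2 * h n * G 0" if t: "0 \<le> t"
    proof -
      have kc: "continuous_on {0..t} (k n)"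
      proof -
        have "continuous_on {0..t} (\<lambda>s. \<Gamma> (s + a))" if "0 < a" for a
        proof (rule continuous_on_compose2[of "{a..}" \<Gamma>])
          show "continuous_on {a..} \<Gamma>"
            using that by (intro continuous_at_imp_continuous_on ballI DERIV_isCont[OF \<Gamma>d]) auto
        qed (auto intro!: continuous_intros)
        then show ?thesis unfolding k_def[abs_def] using h[of n] by (intro continuous_intros) auto
      qed
      have shift: "((\<lambda>s. G (s + 2 * h n)) has_integral (\<Gamma> (t + 2 * h n) - \<Gamma> (0 + 2 * h n))) {0..t}"
      proof (rule fundamental_theorem_of_calculus[OF t])
        fix s assume "s \<in> {0..t}"
        then have "((\<lambda>s. \<Gamma> (s + 2 * h n)) has_real_derivative G (s + 2 * h n)) (at s)"
          using \<Gamma>d[of "s + 2 * h n"] h[of n] by (simp add: DERIV_shift)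
        then show "((\<lambda>s. \<Gamma> (s + 2 * h n)) has_vector_derivative G (s + 2 * h n)) (at s within {0..t})"
          by (rule real_derivative_imp_vector_derivative_within)
      qed
      \<comment> \<open>G is nonincreasing, so k n s \<ge> G (s + 2h). The integral of G s - G (s +
        2h) telescopes, and at most the integral of G over [0, 2h] remains.\<close>
      have "integral {0..t} (\<lambda>s. G s - k n s) \<le> integral {0..t} (\<lambda>s. G s - G (s + 2 * h n))"
      proof (rule integral_le)
        show "(\<lambda>s. G s - k n s) integrable_on {0..t}"
          by (intro integrable_continuous_real continuous_intros G_sub kc) simp
        show "(\<lambda>s. G s - G (s + 2 * h n)) integrable_on {0..t}"
          by (intro integrable_diff has_integral_integrable[OF shift] integrable_continuous_real[OF G_sub]) simp
        fix s assume s: "s \<in> {0..t}"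
        then obtain z where "s + h n < z" "z < s + 2 * h n" "k n s = G z" using k_mv[of s n] by auto
        then show "G s - k n s \<le> G s - G (s + 2 * h n)" using G_anti[of z "s + 2 * h n"] h[of n] s by simp
      qed
      also have "\<dots> = \<Gamma> t - (\<Gamma> (t + 2 * h n) - \<Gamma> (2 * h n))"
        using integral_diff[OF integrable_continuous_real[OF G_sub[of 0 t]] has_integral_integrable[OF shift]]
          integral_unique[OF shift] by (simp add: \<Gamma>_def)
      also have "\<Gamma> t \<le> \<Gamma> (t + 2 * h n)"
        unfolding \<Gamma>_def using h[of n] t
        by (intro integral_subset_le integrable_continuous_real G_sub) (auto intro: G_nn)
      then have "\<Gamma> t - (\<Gamma> (t + 2 * h n) - \<Gamma> (2 * h n)) \<le> \<Gamma> (2 * h n)" by simp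
      also have "\<Gamma> (2 * h n) \<le> 2 * h n * G 0"
        unfolding \<Gamma>_def using integral_le[of G "{0..2 * h n}" "\<lambda>_. G 0"] G_anti[of 0] h[of n]
        by (simp add: integrable_continuous_real G_sub)
      finally show ?thesis .
    qed
    show "(\<lambda>n. 2 * h n * G 0) \<longlonglongrightarrow> 0"
      by (rule tendsto_eq_intros h_lim refl | simp)+
    show "(\<lambda>n. k1 n s) \<longlonglongrightarrow> deriv g s" if s: "0 < s"
    proof -
      have "\<forall>n. \<exists>z. s + h n < z \<and> z < s + 2 * h n \<and> k1 n s = deriv g z" using k1_mv s by auto
      then obtain z where z: "\<And>n. s + h n < z n" "\<And>n. z n < s + 2 * h n" "\<And>n. k1 n s = deriv g (z n)"
        by metis
      have "(\<lambda>n. s + h n) \<longlonglongrightarrow> s" "(\<lambda>n. s + 2 * h n) \<longlonglongrightarrow> s"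
        by (rule tendsto_eq_intros h_lim refl | simp)+
      then have "z \<longlonglongrightarrow> s" by (rule tendsto_sandwich[rotated 2]) (auto intro!: always_eventually less_imp_le z)
      then show ?thesis unfolding z(3) by (rule isCont_tendsto_compose[OF dg_isCont[OF s]])
    qed
    \<comment> \<open>A majorant independent of n, made for dominated convergence:
      \<open>key\<close> between s and the mean value point z, with the decrease of g bounded by G
      0.\<close>
    show "- k1 n s \<le> - deriv g s + d * G 0" if s: "0 < s"
    proof -
      obtain z where z: "s + h n < z" "k1 n s = deriv g z" using k1_mv[of s n] s by auto
      have "s \<le> z" using z h[of n] by simp
      from key[OF s this] have "- deriv g z \<le> - deriv g s + d * (g s - g z)" by (simp add: algebra_simps)
      also have "d * (g s - g z) \<le> d * G 0"
        using g_le0[OF s] g_nn[of z] s \<open>s \<le> z\<close> d(1) by (intro mult_left_mono) auto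
      finally show ?thesis using z by simp
    qed
    show "set_integrable lborel {0<..} (deriv g)" by (rule dgi)
  qed
  then show thesis unfolding \<kappa>_def by (rule that)
qed

section \<open>The Lyapunov functional\<close>

lemma has_real_derivative_inner:
  fixes f h :: "real \<Rightarrow> 'a::real_inner"
  assumes "(f has_vector_derivative f') (at t within S)" "(h has_vector_derivative h') (at t within S)"
  shows "((\<lambda>t. f t \<bullet> h t) has_real_derivative (f t \<bullet> h' + f' \<bullet> h t)) (at t within S)"
  unfolding has_real_derivative_iff_has_vector_derivative
  by (rule bounded_bilinear.has_vector_derivative[OF bounded_bilinear_inner assms])

lemma continuous_on_has_vector_derivative:
  assumes "\<And>t. 0 \<le> t \<Longrightarrow> (f has_vector_derivative f' t) (at t within {0..})"
  shows "continuous_on {0..} f"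
  unfolding continuous_on_eq_continuous_within
  using has_vector_derivative_continuous[OF assms] by simp

lemma continuous_on_Icc_bounded:
  fixes f :: "real \<Rightarrow> 'a::real_normed_vector"
  assumes "continuous_on {a..b} f"
  obtains C where "\<And>s. s \<in> {a..b} \<Longrightarrow> norm (f s) \<le> C"
proof -
  have "bounded (f ` {a..b})" by (intro compact_imp_bounded compact_continuous_image assms compact_Icc)
  then obtain C where "\<forall>y\<in>f ` {a..b}. norm y \<le> C" unfolding bounded_iff ..
  then show thesis by (intro that[of C]) simp
qed

lemma conv_scale_left: "conv (\<lambda>s. a * k s) f t = a *\<^sub>R conv k f t"
  unfolding conv_def scaleR_scaleR[symmetric] by (rule integral_cmul)

lemma integral_nonneg_sq:
  fixes l :: "real \<Rightarrow> real" and f :: "real \<Rightarrow> 'a::real_normed_vector"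
  assumes "\<And>s. 0 \<le> s \<Longrightarrow> 0 \<le> l s"
  shows "0 \<le> integral {0..t} (\<lambda>s. l (t - s) * (norm (a - f s))\<^sup>2)"
proof (cases "(\<lambda>s. l (t - s) * (norm (a - f s))\<^sup>2) integrable_on {0..t}")
  case True
  then show ?thesis by (rule Henstock_Kurzweil_Integration.integral_nonneg) (use assms in auto)
qed (simp add: not_integrable_integral)

text \<open>The memory integral \<open>\<integral>(\<alpha>k - k')|\<eta>|\<^sup>2\<close> is expanded into convolutions, which can be differentiated
  term by term; the coefficients of \<open>|p|\<^sup>2\<close> then add up to \<open>\<gamma>\<alpha> + k(0)\<close>.\<close>

definition lyapunov :: "real \<Rightarrow> real \<Rightarrow> real \<Rightarrow> (real \<Rightarrow> real) \<Rightarrow> (real \<Rightarrow> real) \<Rightarrow>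
    (real \<Rightarrow> 'a::real_inner) \<Rightarrow> (real \<Rightarrow> 'a) \<Rightarrow> (real \<Rightarrow> 'a) \<Rightarrow> real \<Rightarrow> real" where
  "lyapunov \<alpha> \<beta> \<gamma> k k1 p q z t = z t \<bullet> z t + \<beta> * (q t \<bullet> q t) + 2 * \<gamma> * (p t \<bullet> q t)
     + (\<gamma> * \<alpha> + k 0) * (p t \<bullet> p t) - 2 * (conv k p t \<bullet> q t)
     - 2 * (p t \<bullet> (\<alpha> *\<^sub>R conv k p t - conv k1 p t))
     + \<alpha> * conv k (\<lambda>s. p s \<bullet> p s) t - conv k1 (\<lambda>s. p s \<bullet> p s) t"

text \<open>F is the memory term of the true kernel while the functional is built from k, so F - k*p
  tested against r + \<alpha> q survives. The equation is assumed only in its pairing with z, where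
  the inverse of R moves from z' onto z and turns it into r + \<alpha> q.\<close>

lemma lyapunov_derivative:
  fixes p q r z y F :: "real \<Rightarrow> 'a::{real_inner, banach}"
  assumes k: "\<And>s. 0 \<le> s \<Longrightarrow> (k has_vector_derivative k1 s) (at s within {0..})"
      "\<And>s. 0 \<le> s \<Longrightarrow> (k1 has_vector_derivative k2 s) (at s within {0..})" "continuous_on {0..} k2"
    and sign: "\<And>s. 0 \<le> s \<Longrightarrow> 0 \<le> k s" "\<And>s. 0 \<le> s \<Longrightarrow> k1 s \<le> 0" "\<And>s. 0 \<le> s \<Longrightarrow> \<alpha> * k1 s \<le> k2 s"
    and par: "0 < \<alpha>" "\<gamma> \<le> \<alpha> * \<beta>"
    and p: "\<And>t. 0 \<le> t \<Longrightarrow> (p has_vector_derivative q t) (at t within {0..})"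
    and q: "\<And>t. 0 \<le> t \<Longrightarrow> (q has_vector_derivative r t) (at t within {0..})"
    and z: "\<And>t. 0 \<le> t \<Longrightarrow> (z has_vector_derivative y t) (at t within {0..})"
    and y: "y t \<bullet> z t = - ((\<beta> *\<^sub>R q t + \<gamma> *\<^sub>R p t - F t) \<bullet> (r t + \<alpha> *\<^sub>R q t))"
    and t: "0 \<le> t"
  obtains D where "(lyapunov \<alpha> \<beta> \<gamma> k k1 p q z has_real_derivative D) (at t within {0..})"
    "D \<le> 2 * ((F t - conv k p t) \<bullet> (r t + \<alpha> *\<^sub>R q t))"
proof -
  have cp: "continuous_on {0..} p" by (rule continuous_on_has_vector_derivative[OF p])
  note ck = continuous_on_has_vector_derivative[OF k(1)] and ck1 = continuous_on_has_vector_derivative[OF k(2)]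
  have cpp: "continuous_on {0..} (\<lambda>s. p s \<bullet> p s)" by (intro continuous_intros cp)
  note P = p[OF t] and Q = q[OF t] and Z = z[OF t]
  let ?P = "p t \<bullet> p t"
  have K: "(conv k p has_vector_derivative k 0 *\<^sub>R p t + conv k1 p t) (at t within {0..})"
    by (rule conv_has_vector_derivative[OF k(1) ck1 cp t])
  have K1: "(conv k1 p has_vector_derivative k1 0 *\<^sub>R p t + conv k2 p t) (at t within {0..})"
    by (rule conv_has_vector_derivative[OF k(2) k(3) cp t])
  have N: "(conv k (\<lambda>s. p s \<bullet> p s) has_real_derivative k 0 * ?P + conv k1 (\<lambda>s. p s \<bullet> p s) t) (at t within {0..})"
    using conv_has_vector_derivative[OF k(1) ck1 cpp t]
    unfolding has_real_derivative_iff_has_vector_derivative real_scaleR_def .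
  have N1: "(conv k1 (\<lambda>s. p s \<bullet> p s) has_real_derivative k1 0 * ?P + conv k2 (\<lambda>s. p s \<bullet> p s) t) (at t within {0..})"
    using conv_has_vector_derivative[OF k(2) k(3) cpp t]
    unfolding has_real_derivative_iff_has_vector_derivative real_scaleR_def .
  define D where "D = (z t \<bullet> y t + y t \<bullet> z t) + \<beta> * (q t \<bullet> r t + r t \<bullet> q t) + 2 * \<gamma> * (p t \<bullet> r t + q t \<bullet> q t)
     + (\<gamma> * \<alpha> + k 0) * (p t \<bullet> q t + q t \<bullet> p t)
     - 2 * (conv k p t \<bullet> r t + (k 0 *\<^sub>R p t + conv k1 p t) \<bullet> q t)
     - 2 * (p t \<bullet> (\<alpha> *\<^sub>R (k 0 *\<^sub>R p t + conv k1 p t) - (k1 0 *\<^sub>R p t + conv k2 p t))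
            + q t \<bullet> (\<alpha> *\<^sub>R conv k p t - conv k1 p t))
     + \<alpha> * (k 0 * ?P + conv k1 (\<lambda>s. p s \<bullet> p s) t) - (k1 0 * ?P + conv k2 (\<lambda>s. p s \<bullet> p s) t)"
  have J: "((\<lambda>t. \<alpha> *\<^sub>R conv k p t - conv k1 p t) has_vector_derivative
      \<alpha> *\<^sub>R (k 0 *\<^sub>R p t + conv k1 p t) - (k1 0 *\<^sub>R p t + conv k2 p t)) (at t within {0..})"
    by (intro has_vector_derivative_diff K1 bounded_linear.has_vector_derivative[OF bounded_linear_scaleR_right K])
  have der: "(lyapunov \<alpha> \<beta> \<gamma> k k1 p q z has_real_derivative D) (at t within {0..})"
    unfolding lyapunov_def[abs_def] D_def
    by (intro DERIV_add DERIV_diff DERIV_cmult N N1 has_real_derivative_inner P Q Z K J)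
  \<comment> \<open>The weight of the dissipated memory, nonnegative by assumption. Its integral is
    explicit and accounts for the boundary terms at 0 and t.\<close>
  define l where "l s = k2 s - \<alpha> * k1 s" for s
  have cl: "continuous_on {0..} l" unfolding l_def[abs_def] by (intro continuous_intros k(3) ck1)
  have l_int: "integral {0..t} l = (k1 t - \<alpha> * k t) - (k1 0 - \<alpha> * k 0)"
  proof (rule integral_unique[OF fundamental_theorem_of_calculus[OF t]])
    fix s assume s: "s \<in> {0..t}"
    have "((\<lambda>s. k1 s - \<alpha> * k s) has_vector_derivative l s) (at s within {0..})"
      unfolding l_def using s
      by (intro has_vector_derivative_diff has_vector_derivative_mult_right k) auto
    then show "((\<lambda>s. k1 s - \<alpha> * k s) has_vector_derivative l s) (at s within {0..t})"
      by (rule has_vector_derivative_within_subset) auto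
  qed
  have cak1: "continuous_on {0..} (\<lambda>s. \<alpha> * k1 s)" by (intro continuous_intros ck1)
  have "0 \<le> integral {0..t} (\<lambda>s. l (t - s) * (norm (p t - p s))\<^sup>2)"
    by (rule integral_nonneg_sq) (auto simp: l_def sign(3))
  also have "\<dots> = integral {0..t} l * ?P - 2 * (p t \<bullet> conv l p t) + conv l (\<lambda>s. p s \<bullet> p s) t"
    by (rule integral_quadratic_conv[OF cl cp])
  finally have B0: "0 \<le> integral {0..t} l * ?P - 2 * (p t \<bullet> conv l p t) + conv l (\<lambda>s. p s \<bullet> p s) t" .
  have lp: "conv l p t = conv k2 p t - \<alpha> *\<^sub>R conv k1 p t" 
    unfolding l_def[abs_def] conv_scale_left[symmetric] by (rule conv_diff_left[OF k(3) cak1 cp, symmetric])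
  have lpp: "conv l (\<lambda>s. p s \<bullet> p s) t = conv k2 (\<lambda>s. p s \<bullet> p s) t - \<alpha> *\<^sub>R conv k1 (\<lambda>s. p s \<bullet> p s) t"
    unfolding l_def[abs_def] conv_scale_left[symmetric] by (rule conv_diff_left[OF k(3) cak1 cpp, symmetric])
  have B: "0 \<le> ((k1 t - \<alpha> * k t) - (k1 0 - \<alpha> * k 0)) * ?P
      - 2 * (p t \<bullet> conv k2 p t - \<alpha> * (p t \<bullet> conv k1 p t))
      + (conv k2 (\<lambda>s. p s \<bullet> p s) t - \<alpha> * conv k1 (\<lambda>s. p s \<bullet> p s) t)"
    using B0 unfolding l_int lp lpp by (simp only: inner_diff_right inner_scaleR_right real_scaleR_def)
  have S1: "0 \<le> (\<alpha> * k t - k1 t) * ?P"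
  proof (rule mult_nonneg_nonneg)
    have "0 \<le> \<alpha> * k t" using sign(1)[OF t] par(1) by simp
    then show "0 \<le> \<alpha> * k t - k1 t" using sign(2)[OF t] by linarith
  qed simp
  have S2: "0 \<le> (\<alpha> * \<beta> - \<gamma>) * (q t \<bullet> q t)" using par(2) by simp
  \<comment> \<open>D falls short of the forcing term by three nonnegative losses: twice (\<alpha>
    \<beta> - \<gamma>) |q|^2, then (\<alpha> k - k1) |p|^2, and the integral of l(t - s) |p(t) -
    p(s)|^2 in expanded form.\<close>
  have eq: "2 * ((F t - conv k p t) \<bullet> (r t + \<alpha> *\<^sub>R q t)) - D = 2 * ((\<alpha> * \<beta> - \<gamma>) * (q t \<bullet> q t)) + (\<alpha> * k t - k1 t) * ?P
    + (((k1 t - \<alpha> * k t) - (k1 0 - \<alpha> * k 0)) * ?P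
      - 2 * (p t \<bullet> conv k2 p t - \<alpha> * (p t \<bullet> conv k1 p t))
      + (conv k2 (\<lambda>s. p s \<bullet> p s) t - \<alpha> * conv k1 (\<lambda>s. p s \<bullet> p s) t))"
  proof -
    have yz: "z t \<bullet> y t + y t \<bullet> z t = - 2 * ((\<beta> *\<^sub>R q t + \<gamma> *\<^sub>R p t - F t) \<bullet> (r t + \<alpha> *\<^sub>R q t))"
      using y by (simp add: inner_commute)
    show ?thesis
      unfolding D_def yz
      by (simp add: inner_add_left inner_add_right inner_diff_left inner_diff_right)
        (simp add: algebra_simps inner_commute)
  qed
  show thesis using eq B S1 S2 by (intro that[OF der]) linarith
qed

text \<open>With a = p + q/\<alpha>, the integral of \<alpha> k(t - s) |a - p(s)|^2 is nonnegative
  and contains all convolutions with k that occur in the functional. It costs at most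
  \<kappa>/\<alpha> |q + \<alpha> p|^2, whereas the terms with \<gamma> supply \<gamma>/\<alpha> |q
  + \<alpha> p|^2 once \<gamma>/\<alpha> |q|^2 is taken from \<beta> |q|^2.\<close>

lemma lyapunov_lower_bound:
  fixes p q z :: "real \<Rightarrow> 'a::{real_inner, banach}"
  assumes k: "\<And>s. 0 \<le> s \<Longrightarrow> (k has_vector_derivative k1 s) (at s within {0..})" "continuous_on {0..} k1"
    and sign: "\<And>s. 0 \<le> s \<Longrightarrow> 0 \<le> k s"
    and par: "0 < \<alpha>" and kap: "integral {0..t} k \<le> \<kappa>"
    and p: "continuous_on {0..} p" and t: "0 \<le> t"
  shows "(norm (z t))\<^sup>2 + (\<beta> - \<gamma> / \<alpha>) * (norm (q t))\<^sup>2 + (\<gamma> - \<kappa>) / \<alpha> * (norm (q t + \<alpha> *\<^sub>R p t))\<^sup>2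
    + integral {0..t} (\<lambda>s. - k1 s * (norm (p t - p (t - s)))\<^sup>2) \<le> lyapunov \<alpha> \<beta> \<gamma> k k1 p q z t"
proof -
  note ck = continuous_on_has_vector_derivative[OF k(1)]
  let ?P = "p t \<bullet> p t" and ?a = "p t + (1/\<alpha>) *\<^sub>R q t" and ?K = "integral {0..t} k"
  have k1_int: "integral {0..t} k1 = k t - k 0"
    by (rule integral_unique[OF fundamental_theorem_of_calculus[OF t]])
      (rule has_vector_derivative_within_subset[OF k(1)], auto)
  have "integral {0..t} (\<lambda>s. - k1 s * (norm (p t - p (t - s)))\<^sup>2)
      = integral {0..t} (\<lambda>s. (\<lambda>u. - k1 u * (norm (p t - p (t - u)))\<^sup>2) (t - s))"
    by (rule integral_reflect_interval[symmetric])
      (intro continuous_intros continuous_on_subset[OF k(2)] continuous_on_compose2[OF p]; auto)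
  also have "\<dots> = - integral {0..t} (\<lambda>s. k1 (t - s) * (norm (p t - p s))\<^sup>2)" by simp
  also have "\<dots> = - ((k t - k 0) * ?P - 2 * (p t \<bullet> conv k1 p t) + conv k1 (\<lambda>s. p s \<bullet> p s) t)"
    unfolding integral_quadratic_conv[OF k(2) p] k1_int ..
  finally have I: "integral {0..t} (\<lambda>s. - k1 s * (norm (p t - p (t - s)))\<^sup>2)
      = - ((k t - k 0) * ?P - 2 * (p t \<bullet> conv k1 p t) + conv k1 (\<lambda>s. p s \<bullet> p s) t)" .
  have "0 \<le> integral {0..t} (\<lambda>s. k (t - s) * (norm (?a - p s))\<^sup>2)"
    by (rule integral_nonneg_sq) (auto simp: sign)
  also have "\<dots> = ?K * (?a \<bullet> ?a) - 2 * (?a \<bullet> conv k p t) + conv k (\<lambda>s. p s \<bullet> p s) t"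
    by (rule integral_quadratic_conv[OF ck p])
  finally have "0 \<le> \<alpha> * (?K * (?a \<bullet> ?a) - 2 * (?a \<bullet> conv k p t) + conv k (\<lambda>s. p s \<bullet> p s) t)"
    using par by simp
  also have "\<dots> = ?K / \<alpha> * (norm (q t + \<alpha> *\<^sub>R p t))\<^sup>2 - 2 * \<alpha> * (p t \<bullet> conv k p t) - 2 * (q t \<bullet> conv k p t)
      + \<alpha> * conv k (\<lambda>s. p s \<bullet> p s) t"
    using par by (simp add: power2_norm_eq_inner inner_add_left inner_add_right inner_commute field_simps)
  finally have A: "0 \<le> ?K / \<alpha> * (norm (q t + \<alpha> *\<^sub>R p t))\<^sup>2 - 2 * \<alpha> * (p t \<bullet> conv k p t) - 2 * (q t \<bullet> conv k p t)
      + \<alpha> * conv k (\<lambda>s. p s \<bullet> p s) t" .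
  have "?K / \<alpha> * (norm (q t + \<alpha> *\<^sub>R p t))\<^sup>2 \<le> \<kappa> / \<alpha> * (norm (q t + \<alpha> *\<^sub>R p t))\<^sup>2"
    using kap par by (intro mult_right_mono divide_right_mono) auto
  moreover have "\<gamma> / \<alpha> * (norm (q t + \<alpha> *\<^sub>R p t))\<^sup>2 = \<gamma> / \<alpha> * (q t \<bullet> q t) + 2 * \<gamma> * (p t \<bullet> q t) + \<gamma> * \<alpha> * ?P"
    using par by (simp add: power2_norm_eq_inner inner_add_left inner_add_right inner_commute field_simps)
  moreover have "0 \<le> k t * ?P" using sign[OF t] by simp
  moreover have "(\<gamma> - \<kappa>) / \<alpha> * (norm (q t + \<alpha> *\<^sub>R p t))\<^sup>2
      = \<gamma> / \<alpha> * (norm (q t + \<alpha> *\<^sub>R p t))\<^sup>2 - \<kappa> / \<alpha> * (norm (q t + \<alpha> *\<^sub>R p t))\<^sup>2"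
    by (simp add: diff_divide_distrib left_diff_distrib)
  moreover have "lyapunov \<alpha> \<beta> \<gamma> k k1 p q z t = z t \<bullet> z t + \<beta> * (q t \<bullet> q t) + 2 * \<gamma> * (p t \<bullet> q t)
     + \<gamma> * \<alpha> * ?P + k 0 * ?P - 2 * (q t \<bullet> conv k p t)
     - 2 * \<alpha> * (p t \<bullet> conv k p t) + 2 * (p t \<bullet> conv k1 p t)
     + \<alpha> * conv k (\<lambda>s. p s \<bullet> p s) t - conv k1 (\<lambda>s. p s \<bullet> p s) t"
    unfolding lyapunov_def by (simp add: inner_diff_right inner_commute algebra_simps)
  moreover have "(\<beta> - \<gamma> / \<alpha>) * (norm (q t))\<^sup>2 = \<beta> * (q t \<bullet> q t) - \<gamma> / \<alpha> * (q t \<bullet> q t)"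
    by (simp add: power2_norm_eq_inner left_diff_distrib)
  moreover have "(k t - k 0) * ?P = k t * ?P - k 0 * ?P" by (rule left_diff_distrib)
  moreover have "(norm (z t))\<^sup>2 = z t \<bullet> z t" by (rule power2_norm_eq_inner)
  ultimately show ?thesis using A I by linarith
qed

section \<open>Energy estimate for differentiable trajectories\<close>

context regularized_kernel
begin

lemma k_cont: "continuous_on {0..} (k n)"
  by (rule continuous_on_has_vector_derivative[OF k_deriv])

lemma k1_cont: "continuous_on {0..} (k1 n)"
  by (rule continuous_on_has_vector_derivative[OF k1_deriv])

lemma dg_nonpos: "0 < s \<Longrightarrow> deriv g s \<le> 0"
  by (rule LIMSEQ_le_const2[OF k1_lim]) (use k1_nonpos in auto)

lemma memory_integrable:
  assumes h: "continuous_on {0..t} h"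
  shows "set_integrable lborel {0..t} (\<lambda>s. - deriv g s * h s)"
proof -
  obtain C where C: "\<And>s. s \<in> {0..t} \<Longrightarrow> \<bar>h s\<bar> \<le> C"
    using continuous_on_Icc_bounded[OF h] by (metis real_norm_def)
  have hm: "(\<lambda>s. indicator {0..t} s * h s) \<in> borel_measurable lborel"
    using borel_integrable_atLeastAtMost'[OF h] by (auto simp: set_integrable_def)
  have dm: "(\<lambda>s. indicator {0<..} s * deriv g s) \<in> borel_measurable lborel"
    using dg_integrable by (auto simp: set_integrable_def)
  have m: "(\<lambda>s. indicator {0..t} s *\<^sub>R (- deriv g s * h s)) \<in> borel_measurable lborel"
  proof -
    \<comment> \<open>Measurability of \<open>deriv g\<close> is known on the open half-line only;
      the value at 0 is added as a separate term.\<close>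
    have "(\<lambda>s. - (indicator {0<..} s * deriv g s) * (indicator {0..t} s * h s)
        + indicator {0} s * (- deriv g 0 * (indicator {0..t} 0 * h 0))) \<in> borel_measurable lborel"
      by (rule borel_measurable_add[OF borel_measurable_times[OF borel_measurable_uminus[OF dm] hm]]) simp
    moreover have "(\<lambda>s. - (indicator {0<..} s * deriv g s) * (indicator {0..t} s * h s)
        + indicator {0} s * (- deriv g 0 * (indicator {0..t} 0 * h 0))) = (\<lambda>s. indicator {0..t} s *\<^sub>R (- deriv g s * h s))"
      by (auto simp: indicator_def fun_eq_iff)
    ultimately show ?thesis by simp
  qed
  have "integrable lborel (\<lambda>s. C * (indicator {0<..} s *\<^sub>R deriv g s))"
    using dg_integrable unfolding set_integrable_def by (rule integrable_mult_right)
  then show ?thesis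
    unfolding set_integrable_def
  proof (rule Bochner_Integration.integrable_bound[OF _ m])
    show "AE s in lborel. norm (indicator {0..t} s *\<^sub>R (- deriv g s * h s)) \<le> norm (C * (indicator {0<..} s *\<^sub>R deriv g s))"
      using AE_lborel_singleton[of "0::real"]
    proof eventually_elim
      fix s :: real assume "s \<noteq> 0"
      show "norm (indicator {0..t} s *\<^sub>R (- deriv g s * h s)) \<le> norm (C * (indicator {0<..} s *\<^sub>R deriv g s))"
      proof (cases "s \<in> {0..t}")
        case True
        then show ?thesis using C[OF True] \<open>s \<noteq> 0\<close>
          by (auto simp: abs_mult mult.commute intro!: mult_right_mono)
      qed simp
    qed
  qed
qed

lemma memory_continuous:
  fixes p :: "real \<Rightarrow> 'a::real_normed_vector"
  assumes "continuous_on {0..} p"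
  shows "continuous_on {0..t} (\<lambda>s. (norm (p t - p (t - s)))\<^sup>2)"
  by (intro continuous_intros continuous_on_compose2[OF assms]) auto

text \<open>Dominated convergence. The majorant (- g' + c) |\<eta>|^2 comes from
  \<open>k1_bound\<close> and is integrable because |\<eta>| is bounded on [0,t] and g' is
  summable.\<close>

lemma memory_integral_tendsto:
  fixes p :: "real \<Rightarrow> 'a::real_inner"
  assumes p: "continuous_on {0..} p" and t: "0 \<le> t"
  shows "(\<lambda>n. integral {0..t} (\<lambda>s. - k1 n s * (norm (p t - p (t - s)))\<^sup>2)) \<longlonglongrightarrow>
     (LINT s:{0..t}|lborel. - deriv g s * (norm (p t - p (t - s)))\<^sup>2)"
proof -
  define h where "h s = (norm (p t - p (t - s)))\<^sup>2" for s
  have h: "continuous_on {0..t} h" unfolding h_def[abs_def] by (rule memory_continuous[OF p])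
  have h0: "0 \<le> h s" for s by (simp add: h_def)
  have si: "set_integrable lborel {0..t} (\<lambda>s. - k1 n s * h s)" for n
    by (intro borel_integrable_atLeastAtMost' continuous_intros h continuous_on_subset[OF k1_cont]) auto
  have sd: "set_integrable lborel {0..t} (\<lambda>s. - deriv g s * h s)" by (rule memory_integrable[OF h])
  have sc: "set_integrable lborel {0..t} (\<lambda>s. c * h s)"
    by (intro borel_integrable_atLeastAtMost' continuous_intros h)
  have "(\<lambda>n. LINT s|lborel. indicator {0..t} s *\<^sub>R (- k1 n s * h s)) \<longlonglongrightarrow>
      (LINT s|lborel. indicator {0..t} s *\<^sub>R (- deriv g s * h s))"
  proof (rule integral_dominated_convergence
      [where w = "\<lambda>s. indicator {0..t} s *\<^sub>R (- deriv g s * h s) + indicator {0..t} s *\<^sub>R (c * h s)"])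
    show "integrable lborel (\<lambda>s. indicator {0..t} s *\<^sub>R (- deriv g s * h s) + indicator {0..t} s *\<^sub>R (c * h s))"
      using sd sc unfolding set_integrable_def by (rule Bochner_Integration.integrable_add)
    show "AE s in lborel. (\<lambda>n. indicator {0..t} s *\<^sub>R (- k1 n s * h s)) \<longlonglongrightarrow> indicator {0..t} s *\<^sub>R (- deriv g s * h s)"
      using AE_lborel_singleton[of "0::real"]
    proof eventually_elim
      fix s :: real assume "s \<noteq> 0"
      show "(\<lambda>n. indicator {0..t} s *\<^sub>R (- k1 n s * h s)) \<longlonglongrightarrow> indicator {0..t} s *\<^sub>R (- deriv g s * h s)"
      proof (cases "s \<in> {0..t}")
        case True
        then show ?thesis using \<open>s \<noteq> 0\<close> by (intro tendsto_intros k1_lim) auto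
      qed simp
    qed
    show "AE s in lborel. norm (indicator {0..t} s *\<^sub>R (- k1 n s * h s))
        \<le> indicator {0..t} s *\<^sub>R (- deriv g s * h s) + indicator {0..t} s *\<^sub>R (c * h s)" for n
      using AE_lborel_singleton[of "0::real"]
    proof eventually_elim
      fix s :: real assume "s \<noteq> 0"
      show "norm (indicator {0..t} s *\<^sub>R (- k1 n s * h s))
        \<le> indicator {0..t} s *\<^sub>R (- deriv g s * h s) + indicator {0..t} s *\<^sub>R (c * h s)"
      proof (cases "s \<in> {0..t}")
        case True
        then have s: "0 < s" using \<open>s \<noteq> 0\<close> by auto
        have "- k1 n s * h s \<le> (- deriv g s + c) * h s"
          by (rule mult_right_mono[OF k1_bound[OF s] h0])
        moreover have "norm (- k1 n s * h s) = - k1 n s * h s"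
          using k1_nonpos[of s n] h0[of s] s by (simp add: abs_mult)
        ultimately show ?thesis using True by (simp add: algebra_simps)
      qed simp
    qed
  qed (use si sd in \<open>auto simp: set_integrable_def\<close>)
  moreover have "(LINT s|lborel. indicator {0..t} s *\<^sub>R (- k1 n s * h s)) = integral {0..t} (\<lambda>s. - k1 n s * h s)" for n
    using set_borel_integral_eq_integral(2)[OF si[of n]] by (simp add: set_lebesgue_integral_def)
  ultimately show ?thesis unfolding h_def set_lebesgue_integral_def by simp
qed

text \<open>The functional of the n-th kernel may grow, but at most at the rate 2 Cp Cr (e n), where
  Cp and Cr bound p and r + \<alpha> q on [0,t] and do not depend on n. Letting n tend to infinity
  removes the growth and restores g.\<close>

lemma regular_energy_estimate:
  fixes p q r z y :: "real \<Rightarrow> 'a::{real_inner, banach}"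
  assumes par: "0 < \<alpha>" "\<gamma> \<le> \<alpha> * \<beta>"
    and p: "\<And>t. 0 \<le> t \<Longrightarrow> (p has_vector_derivative q t) (at t within {0..})"
    and q: "\<And>t. 0 \<le> t \<Longrightarrow> (q has_vector_derivative r t) (at t within {0..})"
    and z: "\<And>t. 0 \<le> t \<Longrightarrow> (z has_vector_derivative y t) (at t within {0..})"
    and r: "continuous_on {0..} r"
    and y: "\<And>t. 0 \<le> t \<Longrightarrow> y t \<bullet> z t = - ((\<beta> *\<^sub>R q t + \<gamma> *\<^sub>R p t - conv G p t) \<bullet> (r t + \<alpha> *\<^sub>R q t))"
    and t: "0 \<le> t"
  shows "(norm (z t))\<^sup>2 + (\<beta> - \<gamma> / \<alpha>) * (norm (q t))\<^sup>2 + (\<gamma> - \<kappa>) / \<alpha> * (norm (q t + \<alpha> *\<^sub>R p t))\<^sup>2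
    + (LINT s:{0..t}|lborel. - deriv g s * (norm (p t - p (t - s)))\<^sup>2)
    \<le> (norm (z 0))\<^sup>2 + \<beta> * (norm (q 0))\<^sup>2 + 2 * \<gamma> * (p 0 \<bullet> q 0) + (\<gamma> * \<alpha> + G 0) * (norm (p 0))\<^sup>2" (is "?E + ?I \<le> ?R")
proof -
  have cp: "continuous_on {0..} p" by (rule continuous_on_has_vector_derivative[OF p])
  have cq: "continuous_on {0..} q" by (rule continuous_on_has_vector_derivative[OF q])
  obtain Cp where Cp: "\<And>s. s \<in> {0..t} \<Longrightarrow> norm (p s) \<le> Cp"
    using continuous_on_Icc_bounded[OF continuous_on_subset[OF cp], of 0 t] by auto
  have "continuous_on {0..t} (\<lambda>s. r s + \<alpha> *\<^sub>R q s)"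
    by (intro continuous_intros continuous_on_subset[OF r] continuous_on_subset[OF cq]) auto
  then obtain Cr where Cr: "\<And>s. s \<in> {0..t} \<Longrightarrow> norm (r s + \<alpha> *\<^sub>R q s) \<le> Cr"
    using continuous_on_Icc_bounded by blast
  have C0: "0 \<le> Cp" "0 \<le> Cr" using Cp[of 0] Cr[of 0] t norm_ge_zero order_trans by (metis atLeastAtMost_iff order_refl)+
  have est: "?E + integral {0..t} (\<lambda>s. - k1 n s * (norm (p t - p (t - s)))\<^sup>2) \<le> ?R + 2 * Cp * Cr * t * e n" for n
  proof -
    let ?\<Phi> = "lyapunov \<alpha> \<beta> \<gamma> (k n) (k1 n) p q z"
    have e0: "0 \<le> e n" using k_integral[of 0 n] by simp
    have D: "\<exists>D. (?\<Phi> has_real_derivative D) (at s within {0..}) \<and> D \<le> 2 * (Cp * e n * Cr)" if s: "s \<in> {0..t}" for s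
    proof -
      have s0: "0 \<le> s" using s by simp
      obtain D where D: "(?\<Phi> has_real_derivative D) (at s within {0..})"
        "D \<le> 2 * ((conv G p s - conv (k n) p s) \<bullet> (r s + \<alpha> *\<^sub>R q s))"
        using lyapunov_derivative[where k = "k n" and ?k1.0 = "k1 n" and ?k2.0 = "k2 n" and \<alpha> = \<alpha> and \<beta> = \<beta>
            and \<gamma> = \<gamma> and p = p and q = q and r = r and z = z and y = y and F = "conv G p" and t = s,
          OF k_deriv k1_deriv k2_cont k_nonneg k1_nonpos k2_ge par p q z y[OF s0] s0] by blast
      have "norm (conv G p s - conv (k n) p s) \<le> Cp * integral {0..s} (\<lambda>u. G u - k n u)"
      proof -
        have "continuous_on {0..} (\<lambda>s. G s - k n s)" by (intro continuous_intros G_cont k_cont)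
        then have "norm (conv (\<lambda>s. G s - k n s) p s) \<le> Cp * integral {0..s} (\<lambda>u. G u - k n u)"
          by (rule norm_conv_le[OF _ _ cp]) (use s k_le Cp in auto)
        then show ?thesis by (simp only: conv_diff_left[OF G_cont k_cont cp])
      qed
      also have "\<dots> \<le> Cp * e n" using k_integral[OF s0, of n] C0(1) by (rule mult_left_mono)
      finally have "norm (conv G p s - conv (k n) p s) * norm (r s + \<alpha> *\<^sub>R q s) \<le> Cp * e n * Cr"
        using Cr[OF s] C0 e0 by (intro mult_mono) auto
      then have "D \<le> 2 * (Cp * e n * Cr)"
        using D(2) norm_cauchy_schwarz[of "conv G p s - conv (k n) p s" "r s + \<alpha> *\<^sub>R q s"] by linarith
      then show ?thesis using D(1) by blast
    qed
    have "?\<Phi> t - 2 * (Cp * e n * Cr) * t \<le> ?\<Phi> 0 - 2 * (Cp * e n * Cr) * 0"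
    proof (rule DERIV_nonpos_imp_decreasing_open[OF t])
      fix s assume s: "0 < s" "s < t"
      then obtain D where D: "(?\<Phi> has_real_derivative D) (at s within {0..})" "D \<le> 2 * (Cp * e n * Cr)"
        using D[of s] by auto
      have "(?\<Phi> has_real_derivative D) (at s)"
        by (rule vector_derivative_within_atLeast_imp_real_derivative[OF _ s(1)])
          (use D(1) in \<open>simp only: has_real_derivative_iff_has_vector_derivative\<close>)
      then have "((\<lambda>s. ?\<Phi> s - 2 * (Cp * e n * Cr) * s) has_real_derivative D - 2 * (Cp * e n * Cr)) (at s)"
        by (rule DERIV_diff[OF _ DERIV_cmult_Id])
      then show "\<exists>y. ((\<lambda>s. ?\<Phi> s - 2 * (Cp * e n * Cr) * s) has_real_derivative y) (at s) \<and> y \<le> 0"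
      proof (intro exI conjI)
        show "D - 2 * (Cp * e n * Cr) \<le> 0" using D(2) by linarith
      qed
    next
      have "continuous (at s within {0..t}) ?\<Phi>" if sT: "s \<in> {0..t}" for s
      proof -
        obtain D' where "(?\<Phi> has_real_derivative D') (at s within {0..})" using D[OF sT] by auto
        then have "continuous (at s within {0..}) ?\<Phi>" by (rule DERIV_continuous)
        then show ?thesis by (rule continuous_within_subset) auto
      qed
      then have "continuous_on {0..t} ?\<Phi>" by (simp add: continuous_on_eq_continuous_within)
      then show "continuous_on {0..t} (\<lambda>s. ?\<Phi> s - 2 * (Cp * e n * Cr) * s)" by (intro continuous_intros)
    qed
    then have up: "?\<Phi> t \<le> ?\<Phi> 0 + 2 * Cp * Cr * t * e n" by (simp add: algebra_simps)
    have "?\<Phi> 0 = (norm (z 0))\<^sup>2 + \<beta> * (norm (q 0))\<^sup>2 + 2 * \<gamma> * (p 0 \<bullet> q 0) + (\<gamma> * \<alpha> + k n 0) * (norm (p 0))\<^sup>2"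
      by (simp add: lyapunov_def power2_norm_eq_inner)
    also have "\<dots> \<le> ?R" using k_le[of 0 n] by (simp add: mult_right_mono)
    finally have z0: "?\<Phi> 0 \<le> ?R" .
    have "integral {0..t} (k n) \<le> integral {0..t} G"
      using k_le by (intro integral_le integrable_continuous_real continuous_on_subset[OF G_cont] continuous_on_subset[OF k_cont]) auto
    then have "integral {0..t} (k n) \<le> \<kappa>" using G_integral[OF t] by simp
    from lyapunov_lower_bound[where k = "k n" and ?k1.0 = "k1 n" and \<alpha> = \<alpha> and \<beta> = \<beta>
            and \<gamma> = \<gamma> and p = p and q = q and z = z and \<kappa> = \<kappa> and t = t,
        OF k_deriv k1_cont k_nonneg par(1) this cp t]
    show ?thesis using up z0 by simp
  qed
  have "?E + ?I \<le> ?R + 2 * Cp * Cr * t * 0"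
  proof (rule LIMSEQ_le)
    show "(\<lambda>n. ?E + integral {0..t} (\<lambda>s. - k1 n s * (norm (p t - p (t - s)))\<^sup>2)) \<longlonglongrightarrow> ?E + ?I"
      by (intro tendsto_intros memory_integral_tendsto cp t)
    show "(\<lambda>n. ?R + 2 * Cp * Cr * t * e n) \<longlonglongrightarrow> ?R + 2 * Cp * Cr * t * 0"
      by (intro tendsto_intros e_lim)
  qed (use est in blast)
  then show ?thesis by simp
qed

end

section \<open>Linear Volterra equations\<close>

lemma integral_exp:
  fixes C l t :: real
  assumes "0 < l" "0 \<le> t"
  shows "((\<lambda>s. C * exp (l * s)) has_integral C * (exp (l * t) - 1) / l) {0..t}"
proof -
  have "((\<lambda>s. C * exp (l * s)) has_integral C * exp (l * t) / l - C * exp (l * 0) / l) {0..t}"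
  proof (rule fundamental_theorem_of_calculus[OF assms(2)])
    fix s
    have "((\<lambda>s. C * exp (l * s) / l) has_real_derivative C * exp (l * s)) (at s)"
      using assms(1) by (auto intro!: derivative_eq_intros)
    then show "((\<lambda>s. C * exp (l * s) / l) has_vector_derivative C * exp (l * s)) (at s within {0..t})"
      by (rule real_derivative_imp_vector_derivative_within)
  qed
  moreover have "C * exp (l * t) / l - C * exp (l * 0) / l = C * (exp (l * t) - 1) / l"
    using assms(1) by (simp add: field_simps)
  ultimately show ?thesis by simp
qed

text \<open>Picard iteration in the exponentially weighted sup norm is a contraction on all of
  \<open>[0,\<infinity>)\<close> at once.\<close>

lemma volterra_exists:
  fixes A M :: "'b::banach \<Rightarrow> 'b" and G :: "real \<Rightarrow> real"
  assumes A: "bounded_linear A" and M: "bounded_linear M"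
    and G: "continuous_on {0..} G" "\<And>s. 0 \<le> s \<Longrightarrow> 0 \<le> G s" "\<And>s. 0 \<le> s \<Longrightarrow> G s \<le> C"
  obtains X where "X 0 = X0" "continuous_on {0..} X"
    "\<And>t. 0 \<le> t \<Longrightarrow> (X has_vector_derivative (A (X t) + M (conv G X t))) (at t within {0..})"
proof -
  obtain a where a: "0 < a" "\<And>x. norm (A x) \<le> norm x * a" using bounded_linear.pos_bounded[OF A] by blast
  obtain m where m: "0 < m" "\<And>x. norm (M x) \<le> norm x * m" using bounded_linear.pos_bounded[OF M] by blast
  have C: "0 \<le> C" using G(2,3)[of 0] by simp
  define K where "K = a + C * m"
  have K: "0 < K" using a m C by (simp add: K_def add_pos_nonneg)
  \<comment> \<open>Since l \<ge> 1, K bounds the right-hand side on functions of growth exp (l s);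
    integration gains 1 / l, so the contraction factor is K / l \<le> 1/2.\<close>
  define l where "l = 2 * K + 1"
  have l: "1 \<le> l" "0 < l" using K by (simp_all add: l_def)
  \<comment> \<open>The unknown of the iteration is y(s) = exp (- l s) X(s); \<open>E\<close>
    removes the weight.\<close>
  define E where "E y s = exp (l * s) *\<^sub>R y s" for y :: "real \<Rightarrow> 'b" and s
  define N where "N y s = A (E y s) + M (conv G (E y) s)" for y :: "real \<Rightarrow> 'b" and s
  have cE: "continuous_on {0..} (E y)" if "continuous_on {0..} y" for y
    unfolding E_def[abs_def] by (intro continuous_intros that)
  have cN: "continuous_on {0..} (N y)" if "continuous_on {0..} y" for y
    unfolding N_def[abs_def]
    by (intro continuous_on_add bounded_linear.continuous_on[OF A] bounded_linear.continuous_on[OF M]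
        continuous_on_conv G(1) cE that)
  have N_diff: "N (\<lambda>s. y s - y' s) s = N y s - N y' s" if "continuous_on {0..} y" "continuous_on {0..} y'" for y y' s
  proof -
    have "E (\<lambda>s. y s - y' s) = (\<lambda>s. E y s - E y' s)" by (simp add: E_def fun_eq_iff scaleR_diff_right)
    then show ?thesis unfolding N_def
      by (simp add: conv_diff[OF G(1) cE[OF that(1)] cE[OF that(2)]] linear_diff[OF bounded_linear.linear[OF A]] linear_diff[OF bounded_linear.linear[OF M]])
  qed
  have N_bound: "norm (N y s) \<le> B * K * exp (l * s)"
    if y: "continuous_on {0..} y" and B: "\<And>s. 0 \<le> s \<Longrightarrow> norm (y s) \<le> B" and s: "0 \<le> s" for y B s
  proof -
    have B0: "0 \<le> B" using order_trans[OF norm_ge_zero B[of 0]] by simp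
    have nE: "norm (E y r) \<le> B * exp (l * r)" if "0 \<le> r" for r
      using B[OF that] by (simp add: E_def mult.commute mult_right_mono)
    have "norm (conv G (E y) s) \<le> integral {0..s} (\<lambda>r. C * B * exp (l * r))"
      unfolding conv_def
    proof (rule integral_norm_bound_integral[OF conv_integrable[OF G(1) cE[OF y]] has_integral_integrable[OF integral_exp[OF l(2) s]]])
      fix r assume r: "r \<in> {0..s}"
      have "norm (G (s - r) *\<^sub>R E y r) \<le> C * (B * exp (l * r))"
        using G(2,3)[of "s - r"] r nE[of r] C by (auto intro!: mult_mono)
      then show "norm (G (s - r) *\<^sub>R E y r) \<le> C * B * exp (l * r)" by (simp add: mult.assoc)
    qed
    also have "\<dots> = C * B * (exp (l * s) - 1) / l" by (rule integral_unique[OF integral_exp[OF l(2) s]])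
    also have "\<dots> \<le> C * B * exp (l * s) / 1"
      using C B0 l s by (intro frac_le mult_left_mono mult_nonneg_nonneg) auto
    finally have nc: "norm (conv G (E y) s) \<le> C * B * exp (l * s)" by simp
    have "norm (N y s) \<le> norm (E y s) * a + norm (conv G (E y) s) * m"
      unfolding N_def using norm_triangle_ineq[of "A (E y s)" "M (conv G (E y) s)"] a(2)[of "E y s"] m(2)[of "conv G (E y) s"] by linarith
    also have "\<dots> \<le> (B * exp (l * s)) * a + (C * B * exp (l * s)) * m"
      using nE[OF s] nc a(1) m(1) by (intro add_mono mult_right_mono) auto
    also have "\<dots> = B * K * exp (l * s)" by (simp add: K_def algebra_simps)
    finally show ?thesis .
  qed
  have I_bound: "norm (exp (- l * t) *\<^sub>R integral {0..t} (N y)) \<le> B / 2"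
    if y: "continuous_on {0..} y" and B: "\<And>s. 0 \<le> s \<Longrightarrow> norm (y s) \<le> B" and t: "0 \<le> t" for y B t
  proof -
    have B0: "0 \<le> B" using order_trans[OF norm_ge_zero B[of 0]] by simp
    have "norm (integral {0..t} (N y)) \<le> integral {0..t} (\<lambda>s. B * K * exp (l * s))"
      by (rule integral_norm_bound_integral)
        (auto intro!: integrable_continuous_real continuous_on_subset[OF cN[OF y]] continuous_intros N_bound[OF y B])
    also have "\<dots> = B * K * (exp (l * t) - 1) / l" by (rule integral_unique[OF integral_exp[OF l(2) t]])
    also have "\<dots> \<le> B * K * exp (l * t) / l"
      using B0 K l by (intro divide_right_mono mult_left_mono mult_nonneg_nonneg) auto
    also have "\<dots> = B * exp (l * t) * (K / l)" by simp
    also have "\<dots> \<le> B * exp (l * t) * (1 / 2)"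
      using B0 K l(2) by (intro mult_left_mono) (auto simp: l_def field_simps)
    finally have "norm (integral {0..t} (N y)) \<le> B * exp (l * t) / 2" by simp
    then have "exp (- l * t) * norm (integral {0..t} (N y)) \<le> exp (- l * t) * (B * exp (l * t) / 2)"
      by (intro mult_left_mono) auto
    also have "\<dots> = B / 2" by (simp add: exp_minus field_simps)
    finally show ?thesis by simp
  qed
  \<comment> \<open>Bounded continuous functions live on the whole line, so the image is continued
    to t < 0 by its value at 0.\<close>
  define \<Phi> where "\<Phi> y t = exp (- l * max 0 t) *\<^sub>R (X0 + integral {0..max 0 t} (N y))" for y :: "real \<Rightarrow> 'b" and t
  have cy: "continuous_on {0..} (apply_bcontfun y)" for y :: "real \<Rightarrow>\<^sub>C 'b"
    by simp
  have cI: "continuous_on {0..} (\<lambda>t. integral {0..t} (N y))" if "continuous_on {0..} y" for y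
    unfolding continuous_on_eq_continuous_within
    using has_vector_derivative_continuous[OF integral_upper_has_vector_derivative[OF cN[OF that]]] by simp
  have \<Phi>_in: "\<Phi> (apply_bcontfun y) \<in> bcontfun" for y :: "real \<Rightarrow>\<^sub>C 'b"
  proof (rule bcontfun_normI)
    have "continuous_on {0..} (\<lambda>t. exp (- l * t) *\<^sub>R (X0 + integral {0..t} (N (apply_bcontfun y))))"
      by (intro continuous_intros cI cy)
    then show "continuous_on UNIV (\<Phi> (apply_bcontfun y))"
      unfolding \<Phi>_def[abs_def] by (rule continuous_on_UNIV_extend)
    fix t
    have "norm (exp (- l * max 0 t) *\<^sub>R X0) \<le> 1 * norm X0"
      unfolding norm_scaleR using l by (intro mult_right_mono) (auto simp: mult_nonneg_nonneg)
    moreover have "norm (exp (- l * max 0 t) *\<^sub>R integral {0..max 0 t} (N (apply_bcontfun y))) \<le> norm y / 2"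
      by (rule I_bound[OF cy]) (auto intro: norm_bounded)
    ultimately show "norm (\<Phi> (apply_bcontfun y) t) \<le> norm X0 + norm y / 2"
      unfolding \<Phi>_def scaleR_add_right by (intro order_trans[OF norm_triangle_ineq]) simp
  qed
  define F where "F y = Bcontfun (\<Phi> (apply_bcontfun y))" for y :: "real \<Rightarrow>\<^sub>C 'b"
  have F: "apply_bcontfun (F y) = \<Phi> (apply_bcontfun y)" for y
    unfolding F_def by (rule Bcontfun_inverse[OF \<Phi>_in])
  have "dist (F y) (F y') \<le> (1/2) * dist y y'" for y y'
  proof (rule dist_bound)
    fix t :: real
    let ?\<tau> = "max 0 t"
    have "integral {0..?\<tau>} (N (apply_bcontfun y)) - integral {0..?\<tau>} (N (apply_bcontfun y'))
        = integral {0..?\<tau>} (N (\<lambda>s. apply_bcontfun y s - apply_bcontfun y' s))"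
      unfolding N_diff[OF cy cy]
      by (rule integral_diff[symmetric]; intro integrable_continuous_real continuous_on_subset[OF cN[OF cy]]) auto
    then have "dist (F y t) (F y' t) = norm (exp (- l * ?\<tau>) *\<^sub>R integral {0..?\<tau>} (N (\<lambda>s. apply_bcontfun y s - apply_bcontfun y' s)))"
      by (simp add: F \<Phi>_def dist_norm flip: scaleR_diff_right)
    also have "\<dots> \<le> dist y y' / 2"
      by (rule I_bound) (auto intro!: continuous_intros cy simp: dist_bounded simp flip: dist_norm)
    finally show "dist (F y t) (F y' t) \<le> (1/2) * dist y y'" by simp
  qed
  then have "\<exists>!y. F y = y" by (intro banach_fix_type[of "1/2"]) auto
  then obtain y where "F y = y" by blast
  then have y: "apply_bcontfun y t = \<Phi> (apply_bcontfun y) t" for t using F by metis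
  define X where "X t = X0 + integral {0..t} (N (apply_bcontfun y))" for t
  have XE: "X t = E (apply_bcontfun y) t" if "0 \<le> t" for t
    unfolding E_def by (subst y) (use that in \<open>simp add: \<Phi>_def X_def exp_minus\<close>)
  have convX: "conv G X t = conv G (E (apply_bcontfun y)) t" for t
    unfolding conv_def by (intro integral_cong) (simp add: XE)
  have dX: "(X has_vector_derivative (A (X t) + M (conv G X t))) (at t within {0..})" if t: "0 \<le> t" for t
  proof -
    have "(X has_vector_derivative 0 + N (apply_bcontfun y) t) (at t within {0..})"
      unfolding X_def[abs_def]
      by (intro has_vector_derivative_add has_vector_derivative_const integral_upper_has_vector_derivative cN cy t)
    then show ?thesis by (simp add: N_def XE[OF t] convX)
  qed
  show thesis
  proof (rule that[OF _ _ dX])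
    show "X 0 = X0" by (simp add: X_def)
    show "continuous_on {0..} X"
      unfolding continuous_on_eq_continuous_within using has_vector_derivative_continuous[OF dX] by simp
  qed
qed

section \<open>Mild solutions\<close>

definition cutoff_pair :: "('a::real_inner \<Rightarrow>\<^sub>L 'a) \<Rightarrow> real \<Rightarrow> ('a \<Rightarrow>\<^sub>L 'a) \<Rightarrow> ('a \<Rightarrow>\<^sub>L 'a) \<Rightarrow> bool" where
  "cutoff_pair R \<epsilon> P L \<longleftrightarrow> P o\<^sub>L P = P \<and> R o\<^sub>L L = P \<and> L o\<^sub>L R = P \<and> P o\<^sub>L L = L \<and> L o\<^sub>L P = L \<and>
    R o\<^sub>L P = P o\<^sub>L R \<and> (\<forall>x y. P x \<bullet> y = x \<bullet> P y) \<and>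
    (\<forall>x y. L x \<bullet> y = x \<bullet> L y) \<and>
    (\<forall>x. norm (P x) \<le> norm x) \<and>
    (\<forall>x. norm (R (x - P x)) \<le> \<epsilon> * norm x)"

lemma cutoff_pair_exists:
  fixes R :: "'a::{real_inner, banach} \<Rightarrow>\<^sub>L 'a"
  assumes "positive_blinfun R" "0 < \<epsilon>"
  shows "\<exists>P L. cutoff_pair R \<epsilon> P L"
  apply (rule spectral_cutoff[OF assms])
  subgoal premises prems for P L
    unfolding cutoff_pair_def by (intro exI[of _ P] exI[of _ L] conjI allI prems)
  done

lemma cutoff_pairD:
  assumes "cutoff_pair R \<epsilon> P L"
  shows "P (P x) = P x" "R (L x) = P x"
    "L (R x) = P x" "P (L x) = L x"
    "L (P x) = L x"
    "R (P x) = P (R x)"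
    "P x \<bullet> y = x \<bullet> P y" "L x \<bullet> y = x \<bullet> L y"
    "norm (P x) \<le> norm x"
  using assms unfolding cutoff_pair_def by (simp_all flip: blinfun_apply_blinfun_compose)

text \<open>With \<open>u = R p\<close>, \<open>\<partial>\<^sub>t u = R q\<close>, \<open>\<partial>\<^sub>t\<^sub>t u = w\<close> and \<open>R = A\<^sup>-\<^sup>1\<^sup>/\<^sup>2\<close>, the equation becomes a system in which
  only bounded operators occur, and the \<open>H\<^sup>1\<close> norms of \<open>u\<close>, \<open>\<partial>\<^sub>t u\<close> are the norms of \<open>p\<close>, \<open>q\<close>.\<close>

definition mild_solution :: "('a::real_inner \<Rightarrow>\<^sub>L 'a) \<Rightarrow> real \<Rightarrow> real \<Rightarrow> real \<Rightarrow> (real \<Rightarrow> real) \<Rightarrow>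
    (real \<Rightarrow> 'a) \<Rightarrow> (real \<Rightarrow> 'a) \<Rightarrow> (real \<Rightarrow> 'a) \<Rightarrow> bool" where
  "mild_solution R \<alpha> \<beta> \<gamma> G p q w \<longleftrightarrow>
    continuous_on {0..} p \<and> continuous_on {0..} q \<and> continuous_on {0..} w \<and>
    (\<forall>t\<ge>0. (p has_vector_derivative q t) (at t within {0..}) \<and>
      ((\<lambda>t. R (q t)) has_vector_derivative w t) (at t within {0..}) \<and>
      ((\<lambda>t. R (w t)) has_vector_derivative
        (conv G p t - \<alpha> *\<^sub>R R (w t) - \<beta> *\<^sub>R q t - \<gamma> *\<^sub>R p t)) (at t within {0..}))"

lemma mild_solutionD:
  assumes "mild_solution R \<alpha> \<beta> \<gamma> G p q w"
  shows "continuous_on {0..} p" "continuous_on {0..} q" "continuous_on {0..} w"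
    "0 \<le> t \<Longrightarrow> (p has_vector_derivative q t) (at t within {0..})"
    "0 \<le> t \<Longrightarrow> ((\<lambda>t. R (q t)) has_vector_derivative w t) (at t within {0..})"
    "0 \<le> t \<Longrightarrow> ((\<lambda>t. R (w t)) has_vector_derivative
        (conv G p t - \<alpha> *\<^sub>R R (w t) - \<beta> *\<^sub>R q t - \<gamma> *\<^sub>R p t)) (at t within {0..})"
  using assms unfolding mild_solution_def by blast+

lemma mild_solution_diff:
  fixes p q w p' q' w' :: "real \<Rightarrow> 'a::{real_inner, banach}"
  assumes G: "continuous_on {0..} G" and s: "mild_solution R \<alpha> \<beta> \<gamma> G p q w" and s': "mild_solution R \<alpha> \<beta> \<gamma> G p' q' w'"
  shows "mild_solution R \<alpha> \<beta> \<gamma> G (\<lambda>t. p t - p' t) (\<lambda>t. q t - q' t) (\<lambda>t. w t - w' t)"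
  unfolding mild_solution_def
proof (intro conjI allI impI)
  note c = mild_solutionD(1-3)[OF s] mild_solutionD(1-3)[OF s']
  show "continuous_on {0..} (\<lambda>t. p t - p' t)" "continuous_on {0..} (\<lambda>t. q t - q' t)" "continuous_on {0..} (\<lambda>t. w t - w' t)"
    by (intro continuous_intros c)+
  fix t :: real assume t: "0 \<le> t"
  note d = mild_solutionD(4-6)[OF s t] and d' = mild_solutionD(4-6)[OF s' t]
  show "((\<lambda>t. p t - p' t) has_vector_derivative q t - q' t) (at t within {0..})"
    by (rule has_vector_derivative_diff[OF d(1) d'(1)])
  show "((\<lambda>t. R (q t - q' t)) has_vector_derivative w t - w' t) (at t within {0..})"
    unfolding blinfun.diff_right by (rule has_vector_derivative_diff[OF d(2) d'(2)])
  have e: "conv G (\<lambda>t. p t - p' t) t - \<alpha> *\<^sub>R R (w t - w' t) - \<beta> *\<^sub>R (q t - q' t) - \<gamma> *\<^sub>R (p t - p' t)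
    = (conv G p t - \<alpha> *\<^sub>R R (w t) - \<beta> *\<^sub>R q t - \<gamma> *\<^sub>R p t)
      - (conv G p' t - \<alpha> *\<^sub>R R (w' t) - \<beta> *\<^sub>R q' t - \<gamma> *\<^sub>R p' t)"
    unfolding conv_diff[OF G c(1) c(4)] by (simp add: blinfun.diff_right scaleR_diff_right)
  show "((\<lambda>t. R (w t - w' t)) has_vector_derivative
      conv G (\<lambda>t. p t - p' t) t - \<alpha> *\<^sub>R R (w t - w' t) - \<beta> *\<^sub>R (q t - q' t) - \<gamma> *\<^sub>R (p t - p' t)) (at t within {0..})"
    unfolding e unfolding blinfun.diff_right by (rule has_vector_derivative_diff[OF d(3) d'(3)])
qed

lemma derivative_uniform_limit:
  fixes f f' :: "nat \<Rightarrow> real \<Rightarrow> 'a::banach"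
  assumes der: "\<And>n t. 0 \<le> t \<Longrightarrow> (f n has_vector_derivative f' n t) (at t within {0..})"
    and lim: "\<And>t. 0 \<le> t \<Longrightarrow> (\<lambda>n. f n t) \<longlonglongrightarrow> h t" and lim': "uniform_limit {0..} f' h' sequentially"
    and t: "0 \<le> t"
  shows "(h has_vector_derivative h' t) (at t within {0..})"
proof -
  have "\<exists>g. \<forall>x\<in>{0..}. (\<lambda>n. f n x) \<longlonglongrightarrow> g x \<and> (g has_derivative (\<lambda>y. y *\<^sub>R h' x)) (at x within {0..})"
  proof (rule has_derivative_sequence[where f' = "\<lambda>n x y. y *\<^sub>R f' n x" and ?x0.0 = 0 and l = "h 0"])
    show "convex {0::real..}" by simp
    show "(f n has_derivative (\<lambda>y. y *\<^sub>R f' n x)) (at x within {0..})" if "x \<in> {0..}" for n x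
      using der[of x n] that by (simp add: has_vector_derivative_def)
    show "\<forall>\<^sub>F n in sequentially. \<forall>x\<in>{0..}. \<forall>y. norm (y *\<^sub>R f' n x - y *\<^sub>R h' x) \<le> e * norm y" if "e > 0" for e
      using uniform_limitD[OF lim' that]
    proof eventually_elim
      case (elim n)
      show ?case
      proof (intro ballI allI)
        fix x y :: real assume "x \<in> {0..}"
        then have "norm (f' n x - h' x) \<le> e" using elim by (auto simp: dist_norm intro: less_imp_le)
        then have "\<bar>y\<bar> * norm (f' n x - h' x) \<le> \<bar>y\<bar> * e" by (intro mult_left_mono) auto
        then show "norm (y *\<^sub>R f' n x - y *\<^sub>R h' x) \<le> e * norm y"
          by (simp add: mult.commute flip: scaleR_diff_right)
      qed
    qed
    show "(\<lambda>n. f n 0) \<longlonglongrightarrow> h 0" by (rule lim) simp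
  qed simp
  then obtain g where g: "\<And>x. 0 \<le> x \<Longrightarrow> (\<lambda>n. f n x) \<longlonglongrightarrow> g x"
    "\<And>x. 0 \<le> x \<Longrightarrow> (g has_derivative (\<lambda>y. y *\<^sub>R h' x)) (at x within {0..})" by auto
  have "g x = h x" if "0 \<le> x" for x using LIMSEQ_unique[OF g(1)[OF that] lim[OF that]] .
  then have "(h has_derivative (\<lambda>y. y *\<^sub>R h' t)) (at t within {0..})"
    using t by (intro has_derivative_transform[OF _ _ g(2)[OF t]]) auto
  then show ?thesis by (simp add: has_vector_derivative_def)
qed

section \<open>Energy estimate for mild solutions\<close>

context regularized_kernel
begin

lemma memory_nonneg:
  "0 \<le> (LINT s:{0..t}|lborel. - deriv g s * (norm (p t - p (t - s)))\<^sup>2)"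
  unfolding set_lebesgue_integral_def
  by (rule integral_nonneg_AE, use AE_lborel_singleton[of "0::real"] in eventually_elim)
    (use dg_nonpos in \<open>auto simp: indicator_def mult_nonpos_nonneg\<close>)

text \<open>Applying L to the equations for R q and R w gives (P q)' = L w and (P w)' = L X -
  \<alpha> P w, because L R = P. The projected fields are thus differentiable in the norm of H, and
  the estimate for differentiable trajectories applies to them.\<close>

lemma cutoff_energy:
  fixes p q w :: "real \<Rightarrow> 'a::{real_inner, banach}"
  assumes par: "0 < \<alpha>" "\<gamma> \<le> \<alpha> * \<beta>" and PL: "cutoff_pair R \<epsilon> P L"
    and s: "mild_solution R \<alpha> \<beta> \<gamma> G p q w" and t: "0 \<le> t"
  shows "(norm (P (w t) + \<alpha> *\<^sub>R R (P (q t))))\<^sup>2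
      + (\<beta> - \<gamma> / \<alpha>) * (norm (P (q t)))\<^sup>2
      + (\<gamma> - \<kappa>) / \<alpha> * (norm (P (q t) + \<alpha> *\<^sub>R P (p t)))\<^sup>2
      + (LINT s:{0..t}|lborel. - deriv g s * (norm (P (p t) - P (p (t - s))))\<^sup>2)
    \<le> (norm (P (w 0) + \<alpha> *\<^sub>R R (P (q 0))))\<^sup>2
      + \<beta> * (norm (P (q 0)))\<^sup>2 + 2 * \<gamma> * (P (p 0) \<bullet> P (q 0))
      + (\<gamma> * \<alpha> + G 0) * (norm (P (p 0)))\<^sup>2"
proof -
  note PLD = cutoff_pairD[OF PL]
  note bl = bounded_linear.has_vector_derivative[OF blinfun.bounded_linear_right]
  define X where "X t = conv G p t - \<beta> *\<^sub>R q t - \<gamma> *\<^sub>R p t" for t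
  have dp: "((\<lambda>t. P (p t)) has_vector_derivative P (q t)) (at t within {0..})" if "0 \<le> t" for t
    by (rule bl[OF mild_solutionD(4)[OF s that]])
  have dq: "((\<lambda>t. P (q t)) has_vector_derivative L (w t)) (at t within {0..})" if "0 \<le> t" for t
    using bl[OF mild_solutionD(5)[OF s that], of L] by (simp only: PLD)
  have dw: "((\<lambda>t. P (w t)) has_vector_derivative L (X t) - \<alpha> *\<^sub>R P (w t)) (at t within {0..})"
    if "0 \<le> t" for t
  proof -
    have "L (conv G p t - \<alpha> *\<^sub>R R (w t) - \<beta> *\<^sub>R q t - \<gamma> *\<^sub>R p t)
        = L (X t) - \<alpha> *\<^sub>R P (w t)"
      by (simp add: X_def blinfun.bilinear_simps PLD(3))
    then show ?thesis using bl[OF mild_solutionD(6)[OF s that], of L] by (simp only: PLD)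
  qed
  have dz: "((\<lambda>t. P (w t) + \<alpha> *\<^sub>R R (P (q t))) has_vector_derivative L (X t)) (at t within {0..})"
    if "0 \<le> t" for t
  proof -
    have "((\<lambda>t. P (w t) + \<alpha> *\<^sub>R R (P (q t))) has_vector_derivative
       (L (X t) - \<alpha> *\<^sub>R P (w t)) + \<alpha> *\<^sub>R R (L (w t))) (at t within {0..})"
      by (intro has_vector_derivative_add dw that bounded_linear.has_vector_derivative[OF bounded_linear_scaleR_right] bl dq)
    then show ?thesis by (simp add: PLD(2))
  qed
  have cw: "continuous_on {0..} (\<lambda>t. L (w t))"
    by (rule bounded_linear.continuous_on[OF blinfun.bounded_linear_right mild_solutionD(3)[OF s]])
  show ?thesis
  proof (rule regular_energy_estimate[where p = "\<lambda>t. P (p t)" and q = "\<lambda>t. P (q t)"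
        and r = "\<lambda>t. L (w t)" and z = "\<lambda>t. P (w t) + \<alpha> *\<^sub>R R (P (q t))"
        and y = "\<lambda>t. L (X t)", OF par dp dq dz cw _ t])
    fix t :: real assume t: "0 \<le> t"
    have cv: "conv G (\<lambda>t. P (p t)) t = P (conv G p t)"
      by (rule conv_linear[OF blinfun.bounded_linear_right G_cont mild_solutionD(1)[OF s]])
    \<comment> \<open>Moved onto z, the symmetric L produces L w + \<alpha> P q, which is the
      multiplier r + \<alpha> q of the projected fields.\<close>
    have "L (X t) \<bullet> (P (w t) + \<alpha> *\<^sub>R R (P (q t)))
        = X t \<bullet> L (P (w t) + \<alpha> *\<^sub>R R (P (q t)))"
      by (rule PLD(8))
    also have "L (P (w t) + \<alpha> *\<^sub>R R (P (q t)))
        = P (L (w t) + \<alpha> *\<^sub>R P (q t))"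
      by (simp add: blinfun.bilinear_simps PLD(1,3,4,5))
    also have "X t \<bullet> \<dots> = P (X t) \<bullet> (L (w t) + \<alpha> *\<^sub>R P (q t))"
      by (rule PLD(7)[symmetric])
    also have "P (X t) = - (\<beta> *\<^sub>R P (q t) + \<gamma> *\<^sub>R P (p t) - P (conv G p t))"
      by (simp add: X_def blinfun.bilinear_simps)
    finally show "L (X t) \<bullet> (P (w t) + \<alpha> *\<^sub>R R (P (q t))) =
      - ((\<beta> *\<^sub>R P (q t) + \<gamma> *\<^sub>R P (p t) - conv G (\<lambda>t. P (p t)) t)
        \<bullet> (L (w t) + \<alpha> *\<^sub>R P (q t)))"
      by (simp only: cv inner_minus_left)
  qed
qed

text \<open>The projections converge strongly, and as they never increase norms, |P n \<eta>|^2
  \<le> |\<eta>|^2 provides the majorant for the memory term.\<close>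

lemma mild_energy_sharp:
  fixes p q w :: "real \<Rightarrow> 'a::{real_inner, banach}"
  assumes R: "positive_blinfun R" "injective_blinfun R" and par: "0 < \<alpha>" "\<gamma> \<le> \<alpha> * \<beta>"
    and s: "mild_solution R \<alpha> \<beta> \<gamma> G p q w" and t: "0 \<le> t"
  shows "(norm (w t + \<alpha> *\<^sub>R R (q t)))\<^sup>2 + (\<beta> - \<gamma> / \<alpha>) * (norm (q t))\<^sup>2
      + (\<gamma> - \<kappa>) / \<alpha> * (norm (q t + \<alpha> *\<^sub>R p t))\<^sup>2
      + (LINT s:{0..t}|lborel. - deriv g s * (norm (p t - p (t - s)))\<^sup>2)
    \<le> (norm (w 0 + \<alpha> *\<^sub>R R (q 0)))\<^sup>2 + \<beta> * (norm (q 0))\<^sup>2 + 2 * \<gamma> * (p 0 \<bullet> q 0)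
      + (\<gamma> * \<alpha> + G 0) * (norm (p 0))\<^sup>2"
proof -
  have "\<forall>n. \<exists>P L. cutoff_pair R (1 / (real n + 1)) P L" by (intro allI cutoff_pair_exists[OF R(1)]) simp
  then obtain P L where PL: "\<And>n. cutoff_pair R (1 / (real n + 1)) (P n) (L n)" by metis
  have lim: "(\<lambda>n. (P n) x) \<longlonglongrightarrow> x" for x
    by (rule cutoffs_tendsto[OF R]) (use PL in \<open>auto simp: cutoff_pair_def\<close>)
  note P_le = cutoff_pairD(9)[OF PL]
  have limR: "(\<lambda>n. R ((P n) x)) \<longlonglongrightarrow> R x" for x
    by (rule bounded_linear.tendsto[OF blinfun.bounded_linear_right lim])
  define h where "h n s = (norm ((P n) (p t) - (P n) (p (t - s))))\<^sup>2" for n s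
  define h' where "h' s = (norm (p t - p (t - s)))\<^sup>2" for s
  have si: "set_integrable lborel {0..t} (\<lambda>s. - deriv g s * h n s)" for n
    unfolding h_def
    by (rule memory_integrable[OF memory_continuous[where p = "\<lambda>t. (P n) (p t)"]])
      (rule bounded_linear.continuous_on[OF blinfun.bounded_linear_right mild_solutionD(1)[OF s]])
  have si': "set_integrable lborel {0..t} (\<lambda>s. - deriv g s * h' s)"
    unfolding h'_def by (rule memory_integrable[OF memory_continuous[OF mild_solutionD(1)[OF s]]])
  have hle: "0 \<le> h n s \<and> h n s \<le> h' s" for n s
    unfolding h_def h'_def using P_le[of n "p t - p (t - s)"] by (simp add: blinfun.diff_right power_mono)
  have I: "(\<lambda>n. LINT s:{0..t}|lborel. - deriv g s * h n s) \<longlonglongrightarrow> (LINT s:{0..t}|lborel. - deriv g s * h' s)"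
    unfolding set_lebesgue_integral_def
  proof (rule integral_dominated_convergence[where w = "\<lambda>s. indicator {0..t} s *\<^sub>R (- deriv g s * h' s)"])
    show "AE s in lborel. (\<lambda>n. indicator {0..t} s *\<^sub>R (- deriv g s * h n s)) \<longlonglongrightarrow> indicator {0..t} s *\<^sub>R (- deriv g s * h' s)"
      unfolding h_def h'_def by (intro AE_I2 tendsto_intros lim)
    show "AE s in lborel. norm (indicator {0..t} s *\<^sub>R (- deriv g s * h n s)) \<le> indicator {0..t} s *\<^sub>R (- deriv g s * h' s)" for n
      using AE_lborel_singleton[of "0::real"]
    proof eventually_elim
      fix s :: real assume "s \<noteq> 0"
      show "norm (indicator {0..t} s *\<^sub>R (- deriv g s * h n s)) \<le> indicator {0..t} s *\<^sub>R (- deriv g s * h' s)"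
      proof (cases "s \<in> {0..t}")
        case True
        then have "deriv g s \<le> 0" using \<open>s \<noteq> 0\<close> by (intro dg_nonpos) auto
        then show ?thesis using True hle[of n s] by (simp add: abs_mult mult_left_mono_neg)
      qed simp
    qed
  qed (use si si' in \<open>auto simp: set_integrable_def\<close>)
  show ?thesis
  proof (rule LIMSEQ_le)
    show "(\<lambda>n. (norm ((P n) (w t) + \<alpha> *\<^sub>R R ((P n) (q t))))\<^sup>2
      + (\<beta> - \<gamma> / \<alpha>) * (norm ((P n) (q t)))\<^sup>2
      + (\<gamma> - \<kappa>) / \<alpha> * (norm ((P n) (q t) + \<alpha> *\<^sub>R (P n) (p t)))\<^sup>2
      + (LINT s:{0..t}|lborel. - deriv g s * h n s))
      \<longlonglongrightarrow> (norm (w t + \<alpha> *\<^sub>R R (q t)))\<^sup>2 + (\<beta> - \<gamma> / \<alpha>) * (norm (q t))\<^sup>2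
      + (\<gamma> - \<kappa>) / \<alpha> * (norm (q t + \<alpha> *\<^sub>R p t))\<^sup>2 + (LINT s:{0..t}|lborel. - deriv g s * (norm (p t - p (t - s)))\<^sup>2)"
      using I unfolding h'_def by (intro tendsto_add tendsto_mult tendsto_power tendsto_norm tendsto_const tendsto_scaleR lim limR)
    show "(\<lambda>n. (norm ((P n) (w 0) + \<alpha> *\<^sub>R R ((P n) (q 0))))\<^sup>2
      + \<beta> * (norm ((P n) (q 0)))\<^sup>2 + 2 * \<gamma> * ((P n) (p 0) \<bullet> (P n) (q 0))
      + (\<gamma> * \<alpha> + G 0) * (norm ((P n) (p 0)))\<^sup>2)
      \<longlonglongrightarrow> (norm (w 0 + \<alpha> *\<^sub>R R (q 0)))\<^sup>2 + \<beta> * (norm (q 0))\<^sup>2 + 2 * \<gamma> * (p 0 \<bullet> q 0)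
      + (\<gamma> * \<alpha> + G 0) * (norm (p 0))\<^sup>2"
      by (intro tendsto_add tendsto_mult tendsto_power tendsto_norm tendsto_const tendsto_scaleR tendsto_inner lim limR)
  qed (use cutoff_energy[OF par PL s t] in \<open>simp add: h_def\<close>)
qed

end

context regularized_kernel
begin

lemma mild_energy:
  fixes R :: "'a::{real_inner, banach} \<Rightarrow>\<^sub>L 'a"
  assumes R: "positive_blinfun R" "injective_blinfun R" and par: "0 < \<alpha>" "0 < \<beta>" "0 < \<gamma>" "\<gamma> / \<alpha> < \<beta>" "\<kappa> < \<gamma>"
  obtains M where "1 \<le> M" "\<And>p q w t. mild_solution R \<alpha> \<beta> \<gamma> G p q w \<Longrightarrow> 0 \<le> t \<Longrightarrow>
    (norm (p t))\<^sup>2 + (norm (q t))\<^sup>2 + (norm (w t))\<^sup>2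
      + (LINT s:{0..t}|lborel. - deriv g s * (norm (p t - p (t - s)))\<^sup>2)
    \<le> M * ((norm (p 0))\<^sup>2 + (norm (q 0))\<^sup>2 + (norm (w 0))\<^sup>2)"
proof -
  have par': "\<gamma> \<le> \<alpha> * \<beta>" using par by (simp add: field_simps)
  have G0: "0 \<le> G 0" by (rule G_nonneg) simp
  define \<rho> where "\<rho> = (\<gamma> - \<kappa>) / \<alpha>"
  define \<omega> where "\<omega> = \<beta> - \<gamma> / \<alpha>"
  define c0 where "c0 = \<alpha> * norm R"
  have pos: "0 < \<rho>" "0 < \<omega>" "0 \<le> c0" using par by (auto simp: \<rho>_def \<omega>_def c0_def)
  \<comment> \<open>With b = q + \<alpha> p one has w = z - \<alpha> R q and p = (b - q) / \<alpha>.
    The coefficient of |q|^2 is then 2 c0^2 from w, 1 from q itself and 2/\<alpha>^2 from p,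
    measured in units of \<omega>; a2 is the coefficient of |b|^2 in units of \<rho>.\<close>
  define a1 where "a1 = (2 * c0\<^sup>2 + 1 + 2 / \<alpha>\<^sup>2) / \<omega>"
  define a2 where "a2 = (2 / \<alpha>\<^sup>2) / \<rho>"
  define C1 where "C1 = 2 + a1 + a2"
  have a: "0 \<le> a1" "0 \<le> a2" using pos by (auto simp: a1_def a2_def)
  \<comment> \<open>Dominates the coefficients at time 0: 2 for |w|^2, 2 c0^2 + \<beta> + \<gamma>
    for |q|^2 and \<gamma> + \<gamma> \<alpha> + G 0 for |p|^2.\<close>
  define C2 where "C2 = 2 + 2 * c0\<^sup>2 + \<beta> + \<gamma> + \<gamma> * \<alpha> + G 0"
  have C1: "2 \<le> C1" and C2: "2 \<le> C2" using a par G0 by (auto simp: C1_def C2_def)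
  have sq: "(norm (x + y))\<^sup>2 \<le> 2 * (norm x)\<^sup>2 + 2 * (norm y)\<^sup>2" for x y :: 'a
  proof -
    have "(norm (x + y))\<^sup>2 + (norm (x - y))\<^sup>2 = 2 * (norm x)\<^sup>2 + 2 * (norm y)\<^sup>2"
      by (simp add: power2_norm_eq_inner inner_simps inner_commute)
    then show ?thesis using zero_le_power2[of "norm (x - y)"] by linarith
  qed
  have Rq: "(norm (\<alpha> *\<^sub>R R x))\<^sup>2 \<le> c0\<^sup>2 * (norm x)\<^sup>2" for x
  proof -
    have "norm (\<alpha> *\<^sub>R R x) \<le> c0 * norm x"
      using mult_left_mono[OF norm_blinfun[of R x], of \<alpha>] par(1) by (simp add: c0_def mult.assoc)
    then have "(norm (\<alpha> *\<^sub>R R x))\<^sup>2 \<le> (c0 * norm x)\<^sup>2" by (rule power_mono) simp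
    then show ?thesis by (simp only: power_mult_distrib)
  qed
  show thesis
  proof (rule that[of "C1 * C2"])
    show "1 \<le> C1 * C2" using mult_mono[OF C1 C2] C1 by simp
    fix p q w t assume s: "mild_solution R \<alpha> \<beta> \<gamma> G p q w" and t: "(0::real) \<le> t"
    let ?I = "LINT s:{0..t}|lborel. - deriv g s * (norm (p t - p (t - s)))\<^sup>2"
    let ?z = "w t + \<alpha> *\<^sub>R R (q t)" and ?b = "q t + \<alpha> *\<^sub>R p t"
    define T where "T = (norm ?z)\<^sup>2 + \<omega> * (norm (q t))\<^sup>2 + \<rho> * (norm ?b)\<^sup>2 + ?I"
    have I0: "0 \<le> ?I" by (rule memory_nonneg)
    have wt: "(norm (w t))\<^sup>2 \<le> 2 * (norm ?z)\<^sup>2 + 2 * (c0\<^sup>2 * (norm (q t))\<^sup>2)"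
      using sq[of ?z "- (\<alpha> *\<^sub>R R (q t))"] Rq[of "q t"] by simp
    have pt: "(norm (p t))\<^sup>2 \<le> 2 / \<alpha>\<^sup>2 * (norm ?b)\<^sup>2 + 2 / \<alpha>\<^sup>2 * (norm (q t))\<^sup>2"
    proof -
      have "\<alpha>\<^sup>2 * (norm (p t))\<^sup>2 = (norm (?b + - q t))\<^sup>2" using par(1) by (simp add: power_mult_distrib)
      also have "\<dots> \<le> 2 * (norm ?b)\<^sup>2 + 2 * (norm (q t))\<^sup>2" using sq[of ?b "- q t"] by simp
      finally have "\<alpha>\<^sup>2 * (norm (p t))\<^sup>2 / \<alpha>\<^sup>2 \<le> (2 * (norm ?b)\<^sup>2 + 2 * (norm (q t))\<^sup>2) / \<alpha>\<^sup>2"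
        by (rule divide_right_mono) simp
      then show ?thesis using par(1) by (simp add: add_divide_distrib)
    qed
    have x1: "(2 * c0\<^sup>2 + 1 + 2 / \<alpha>\<^sup>2) * (norm (q t))\<^sup>2 = a1 * (\<omega> * (norm (q t))\<^sup>2)"
      and x2: "2 / \<alpha>\<^sup>2 * (norm ?b)\<^sup>2 = a2 * (\<rho> * (norm ?b)\<^sup>2)"
      using pos by (simp_all add: a1_def a2_def)
    have "(norm (p t))\<^sup>2 + (norm (q t))\<^sup>2 + (norm (w t))\<^sup>2 + ?I
        \<le> 2 * (norm ?z)\<^sup>2 + (2 * c0\<^sup>2 + 1 + 2 / \<alpha>\<^sup>2) * (norm (q t))\<^sup>2 + 2 / \<alpha>\<^sup>2 * (norm ?b)\<^sup>2 + ?I"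
      using wt pt by (simp add: distrib_right)
    also have "\<dots> = 2 * (norm ?z)\<^sup>2 + a1 * (\<omega> * (norm (q t))\<^sup>2) + a2 * (\<rho> * (norm ?b)\<^sup>2) + 1 * ?I"
      unfolding x1 x2 by simp
    also have "\<dots> \<le> C1 * (norm ?z)\<^sup>2 + C1 * (\<omega> * (norm (q t))\<^sup>2) + C1 * (\<rho> * (norm ?b)\<^sup>2) + C1 * ?I"
      using a pos I0 by (intro add_mono mult_right_mono) (auto simp: C1_def)
    also have "\<dots> = C1 * T" by (simp add: T_def distrib_left)
    finally have L: "(norm (p t))\<^sup>2 + (norm (q t))\<^sup>2 + (norm (w t))\<^sup>2 + ?I \<le> C1 * T" .
    have "T \<le> (norm (w 0 + \<alpha> *\<^sub>R R (q 0)))\<^sup>2 + \<beta> * (norm (q 0))\<^sup>2 + 2 * \<gamma> * (p 0 \<bullet> q 0)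
      + (\<gamma> * \<alpha> + G 0) * (norm (p 0))\<^sup>2"
      unfolding T_def \<omega>_def \<rho>_def by (rule mild_energy_sharp[OF R par(1) par' s t])
    also have "\<dots> \<le> (2 * (norm (w 0))\<^sup>2 + 2 * c0\<^sup>2 * (norm (q 0))\<^sup>2) + \<beta> * (norm (q 0))\<^sup>2
      + \<gamma> * ((norm (p 0))\<^sup>2 + (norm (q 0))\<^sup>2) + (\<gamma> * \<alpha> + G 0) * (norm (p 0))\<^sup>2"
    proof -
      have "(norm (w 0 + \<alpha> *\<^sub>R R (q 0)))\<^sup>2 \<le> 2 * (norm (w 0))\<^sup>2 + 2 * c0\<^sup>2 * (norm (q 0))\<^sup>2"
        using sq[of "w 0" "\<alpha> *\<^sub>R R (q 0)"] Rq[of "q 0"] by simp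
      moreover have "2 * (p 0 \<bullet> q 0) \<le> (norm (p 0))\<^sup>2 + (norm (q 0))\<^sup>2"
      proof -
        have "0 \<le> (norm (p 0 - q 0))\<^sup>2" by simp
        then show ?thesis by (simp add: power2_norm_eq_inner inner_simps inner_commute)
      qed
      then have "\<gamma> * (2 * (p 0 \<bullet> q 0)) \<le> \<gamma> * ((norm (p 0))\<^sup>2 + (norm (q 0))\<^sup>2)" using par(3) by (intro mult_left_mono) auto
      ultimately show ?thesis by (simp add: mult.assoc mult.left_commute)
    qed
    also have "\<dots> = (\<gamma> + \<gamma> * \<alpha> + G 0) * (norm (p 0))\<^sup>2 + (2 * c0\<^sup>2 + \<beta> + \<gamma>) * (norm (q 0))\<^sup>2 + 2 * (norm (w 0))\<^sup>2"
      by (simp add: algebra_simps)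
    also have "\<dots> \<le> C2 * (norm (p 0))\<^sup>2 + C2 * (norm (q 0))\<^sup>2 + C2 * (norm (w 0))\<^sup>2"
      using par G0 by (intro add_mono mult_right_mono) (auto simp: C2_def)
    finally have "T \<le> C2 * ((norm (p 0))\<^sup>2 + (norm (q 0))\<^sup>2 + (norm (w 0))\<^sup>2)" by (simp add: distrib_left)
    then have "C1 * T \<le> C1 * (C2 * ((norm (p 0))\<^sup>2 + (norm (q 0))\<^sup>2 + (norm (w 0))\<^sup>2))"
      using C1 by (intro mult_left_mono) auto
    then show "(norm (p t))\<^sup>2 + (norm (q t))\<^sup>2 + (norm (w t))\<^sup>2 + ?I
        \<le> C1 * C2 * ((norm (p 0))\<^sup>2 + (norm (q 0))\<^sup>2 + (norm (w 0))\<^sup>2)"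
      using L by (simp add: mult.assoc)
  qed
qed

text \<open>With L in place of the unbounded inverse of R the system has bounded coefficients. The
  projection is applied only at the end, to the solution of the bounded system with arbitrary data;
  the original equations return because R L = P.\<close>

lemma mild_solution_exists_cutoff:
  fixes R :: "'a::{real_inner, banach} \<Rightarrow>\<^sub>L 'a"
  assumes PL: "cutoff_pair R \<epsilon> P L"
  shows "\<exists>p q w. mild_solution R \<alpha> \<beta> \<gamma> G p q w \<and>
    p 0 = P p0 \<and> q 0 = P q0 \<and> w 0 = P w0"
proof -
  note PLD = cutoff_pairD[OF PL]
  define A where "A x = (fst (snd x), L (snd (snd x)),
     - (\<alpha> *\<^sub>R snd (snd x) + L (\<beta> *\<^sub>R fst (snd x) + \<gamma> *\<^sub>R fst x)))" for x :: "'a \<times> 'a \<times> 'a"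
  define M where "M x = (0 :: 'a, 0 :: 'a, L (fst x))" for x :: "'a \<times> 'a \<times> 'a"
  have comps: "bounded_linear (\<lambda>x :: 'a \<times> 'a \<times> 'a. fst x)" "bounded_linear (\<lambda>x :: 'a \<times> 'a \<times> 'a. fst (snd x))"
    "bounded_linear (\<lambda>x :: 'a \<times> 'a \<times> 'a. snd (snd x))"
    by (intro bounded_linear_fst bounded_linear_compose[OF bounded_linear_fst bounded_linear_snd]
        bounded_linear_compose[OF bounded_linear_snd bounded_linear_snd])+
  have A: "bounded_linear A"
    unfolding A_def[abs_def]
    by (intro bounded_linear_Pair bounded_linear_minus bounded_linear_add comps
        bounded_linear_compose[OF blinfun.bounded_linear_right] bounded_linear_compose[OF bounded_linear_scaleR_right])
  have M: "bounded_linear M"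
    unfolding M_def[abs_def]
    by (intro bounded_linear_Pair bounded_linear_zero comps bounded_linear_compose[OF blinfun.bounded_linear_right])
  obtain X where X: "X 0 = (p0, q0, w0)" "continuous_on {0..} X"
    "\<And>t. 0 \<le> t \<Longrightarrow> (X has_vector_derivative (A (X t) + M (conv G X t))) (at t within {0..})"
    using volterra_exists[OF A M G_cont G_nonneg G_le] by blast
  define x y z where "x t = fst (X t)" and "y t = fst (snd (X t))" and "z t = snd (snd (X t))" for t
  have c: "continuous_on {0..} x" "continuous_on {0..} y" "continuous_on {0..} z"
    unfolding x_def[abs_def] y_def[abs_def] z_def[abs_def] by (intro continuous_intros X(2))+
  have fst_conv: "fst (conv G X t) = conv G x t" for t
    unfolding x_def[abs_def] by (rule conv_linear[OF bounded_linear_fst G_cont X(2), symmetric])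
  have d: "(x has_vector_derivative y t) (at t within {0..})"
    "(y has_vector_derivative L (z t)) (at t within {0..})"
    "(z has_vector_derivative L (conv G x t) - (\<alpha> *\<^sub>R z t + L (\<beta> *\<^sub>R y t + \<gamma> *\<^sub>R x t))) (at t within {0..})"
    if "0 \<le> t" for t
  proof -
    have e: "fst (A (X t) + M (conv G X t)) = y t" "fst (snd (A (X t) + M (conv G X t))) = L (z t)"
      "snd (snd (A (X t) + M (conv G X t)))
        = L (conv G x t) - (\<alpha> *\<^sub>R z t + L (\<beta> *\<^sub>R y t + \<gamma> *\<^sub>R x t))"
      by (simp_all add: A_def M_def fst_conv x_def y_def z_def)
    show "(x has_vector_derivative y t) (at t within {0..})"
      using bounded_linear.has_vector_derivative[OF comps(1) X(3)[OF that]] unfolding e x_def[abs_def] .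
    show "(y has_vector_derivative L (z t)) (at t within {0..})"
      using bounded_linear.has_vector_derivative[OF comps(2) X(3)[OF that]] unfolding e y_def[abs_def] .
    show "(z has_vector_derivative L (conv G x t) - (\<alpha> *\<^sub>R z t + L (\<beta> *\<^sub>R y t + \<gamma> *\<^sub>R x t))) (at t within {0..})"
      using bounded_linear.has_vector_derivative[OF comps(3) X(3)[OF that]] unfolding e z_def[abs_def] .
  qed
  note dl = bounded_linear.has_vector_derivative[OF blinfun.bounded_linear_right]
  note cl = bounded_linear.continuous_on[OF blinfun.bounded_linear_right]
  have "mild_solution R \<alpha> \<beta> \<gamma> G (\<lambda>t. P (x t)) (\<lambda>t. P (y t)) (\<lambda>t. P (z t))"
    unfolding mild_solution_def
  proof (intro conjI allI impI cl c)
    fix t :: real assume t: "0 \<le> t"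
    show "((\<lambda>t. P (x t)) has_vector_derivative P (y t)) (at t within {0..})"
      by (rule dl[OF d(1)[OF t]])
    show "((\<lambda>t. R (P (y t))) has_vector_derivative P (z t)) (at t within {0..})"
      using dl[OF dl[OF d(2)[OF t], of P], of R] by (simp only: PLD)
    have cv: "conv G (\<lambda>t. P (x t)) t = P (conv G x t)"
      by (rule conv_linear[OF blinfun.bounded_linear_right G_cont c(1)])
    have "R (P (L (conv G x t) - (\<alpha> *\<^sub>R z t + L (\<beta> *\<^sub>R y t + \<gamma> *\<^sub>R x t))))
      = conv G (\<lambda>t. P (x t)) t - \<alpha> *\<^sub>R R (P (z t))
        - \<beta> *\<^sub>R P (y t) - \<gamma> *\<^sub>R P (x t)"
      unfolding cv by (simp add: blinfun.bilinear_simps PLD(2,4))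
    then show "((\<lambda>t. R (P (z t))) has_vector_derivative
        conv G (\<lambda>t. P (x t)) t - \<alpha> *\<^sub>R R (P (z t))
        - \<beta> *\<^sub>R P (y t) - \<gamma> *\<^sub>R P (x t)) (at t within {0..})"
      using dl[OF dl[OF d(3)[OF t], of P], of R] by simp
  qed
  moreover have "x 0 = p0" "y 0 = q0" "z 0 = w0" using X(1) by (simp_all add: x_def y_def z_def)
  ultimately show ?thesis by blast
qed

lemma conv_uniform_limit:
  fixes f :: "nat \<Rightarrow> real \<Rightarrow> 'a::banach"
  assumes c: "\<And>n. continuous_on {0..} (f n)" "continuous_on {0..} h" and lim: "uniform_limit {0..} f h sequentially"
  shows "uniform_limit {0..} (\<lambda>n. conv G (f n)) (conv G h) sequentially"
proof (rule uniform_limitI)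
  fix e :: real assume e: "0 < e"
  have k0: "0 \<le> \<kappa>" using G_integral[of 0] by simp
  \<comment> \<open>Convolution with G enlarges a uniform error at most by the factor \<kappa>, of
    which only \<kappa> \<ge> 0 is known at this point; hence the summand 1.\<close>
  define d where "d = e / (\<kappa> + 1)"
  have d: "0 < d" "d * \<kappa> < e" using e k0 by (auto simp: d_def field_simps)
  show "\<forall>\<^sub>F n in sequentially. \<forall>t\<in>{0..}. dist (conv G (f n) t) (conv G h t) < e"
    using uniform_limitD[OF lim d(1)]
  proof eventually_elim
    case (elim n)
    show ?case
    proof
      fix t :: real assume t: "t \<in> {0..}"
      have "norm (conv G (\<lambda>s. f n s - h s) t) \<le> d * integral {0..t} G"
      proof (rule norm_conv_le[OF G_cont])
        show "continuous_on {0..} (\<lambda>s. f n s - h s)" by (intro continuous_intros c)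
        show "norm (f n s - h s) \<le> d" if "0 \<le> s" for s using elim that by (auto simp: dist_norm intro: less_imp_le)
      qed (rule G_nonneg)
      also have "\<dots> \<le> d * \<kappa>" using G_integral[of t] t d(1) by (intro mult_left_mono) auto
      finally show "dist (conv G (f n) t) (conv G h t) < e"
        using d(2) by (simp add: dist_norm conv_diff[OF G_cont c(1) c(2)])
    qed
  qed
qed

text \<open>The constant of the energy bound does not depend on t, so the approximations converge
  uniformly on the whole half-line. Each equation then passes to the limit, because its right-hand
  side, the derivative, converges uniformly as well.\<close>

lemma mild_solution_exists:
  fixes R :: "'a::{real_inner, banach} \<Rightarrow>\<^sub>L 'a"
  assumes R: "positive_blinfun R" "injective_blinfun R" and par: "0 < \<alpha>" "0 < \<beta>" "0 < \<gamma>" "\<gamma> / \<alpha> < \<beta>" "\<kappa> < \<gamma>"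
  shows "\<exists>p q w. mild_solution R \<alpha> \<beta> \<gamma> G p q w \<and> p 0 = p0 \<and> q 0 = q0 \<and> w 0 = w0"
proof -
  obtain M where M: "1 \<le> M" "\<And>p q w t. mild_solution R \<alpha> \<beta> \<gamma> G p q w \<Longrightarrow> 0 \<le> t \<Longrightarrow>
    (norm (p t))\<^sup>2 + (norm (q t))\<^sup>2 + (norm (w t))\<^sup>2
      + (LINT s:{0..t}|lborel. - deriv g s * (norm (p t - p (t - s)))\<^sup>2)
    \<le> M * ((norm (p 0))\<^sup>2 + (norm (q 0))\<^sup>2 + (norm (w 0))\<^sup>2)"
    using mild_energy[OF R par] by blast
  have "\<forall>n. \<exists>P L. cutoff_pair R (1 / (real n + 1)) P L" by (intro allI cutoff_pair_exists[OF R(1)]) simp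
  then obtain P L where PL: "\<And>n. cutoff_pair R (1 / (real n + 1)) (P n) (L n)" by metis
  have lim: "(\<lambda>n. (P n) x) \<longlonglongrightarrow> x" for x
    by (rule cutoffs_tendsto[OF R]) (use PL in \<open>auto simp: cutoff_pair_def\<close>)
  have "\<forall>n. \<exists>p q w. mild_solution R \<alpha> \<beta> \<gamma> G p q w \<and>
    p 0 = (P n) p0 \<and> q 0 = (P n) q0 \<and> w 0 = (P n) w0"
    by (intro allI mild_solution_exists_cutoff[OF PL])
  then obtain p q w where s: "\<And>n. mild_solution R \<alpha> \<beta> \<gamma> G (p n) (q n) (w n)"
    and i: "\<And>n. p n 0 = (P n) p0" "\<And>n. q n 0 = (P n) q0" "\<And>n. w n 0 = (P n) w0"
    by metis
  define S where "S n = (p n 0, q n 0, w n 0)" for n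
  have "S \<longlonglongrightarrow> (p0, q0, w0)" unfolding S_def[abs_def] i by (intro tendsto_Pair lim)
  then have CS: "Cauchy S" by (rule LIMSEQ_imp_Cauchy)
  have est: "norm (p m t - p n t) \<le> sqrt M * dist (S m) (S n)" "norm (q m t - q n t) \<le> sqrt M * dist (S m) (S n)"
    "norm (w m t - w n t) \<le> sqrt M * dist (S m) (S n)" if t: "0 \<le> t" for m n t
  proof -
    have d: "(dist (S m) (S n))\<^sup>2 = (norm (p m 0 - p n 0))\<^sup>2 + (norm (q m 0 - q n 0))\<^sup>2 + (norm (w m 0 - w n 0))\<^sup>2"
      by (simp add: S_def dist_norm norm_Pair)
    have "(norm (p m t - p n t))\<^sup>2 + (norm (q m t - q n t))\<^sup>2 + (norm (w m t - w n t))\<^sup>2 \<le> M * (dist (S m) (S n))\<^sup>2"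
      unfolding d using M(2)[OF mild_solution_diff[OF G_cont s[of m] s[of n]] t]
        memory_nonneg[of t "\<lambda>t. p m t - p n t"] by linarith
    moreover have "M * (dist (S m) (S n))\<^sup>2 = (sqrt M * dist (S m) (S n))\<^sup>2" using M(1) by (simp add: power_mult_distrib)
    ultimately have *: "(norm (p m t - p n t))\<^sup>2 + (norm (q m t - q n t))\<^sup>2 + (norm (w m t - w n t))\<^sup>2 \<le> (sqrt M * dist (S m) (S n))\<^sup>2"
      by simp
    have nn: "0 \<le> sqrt M * dist (S m) (S n)" using M(1) by simp
    show "norm (p m t - p n t) \<le> sqrt M * dist (S m) (S n)" by (rule power2_le_imp_le[OF _ nn]) (use * in \<open>smt (verit) zero_le_power2\<close>)
    show "norm (q m t - q n t) \<le> sqrt M * dist (S m) (S n)" by (rule power2_le_imp_le[OF _ nn]) (use * in \<open>smt (verit) zero_le_power2\<close>)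
    show "norm (w m t - w n t) \<le> sqrt M * dist (S m) (S n)" by (rule power2_le_imp_le[OF _ nn]) (use * in \<open>smt (verit) zero_le_power2\<close>)
  qed
  have uc: "\<exists>h. uniform_limit {0..} f h sequentially"
    if f: "\<And>m n t. 0 \<le> t \<Longrightarrow> norm (f m t - f n t) \<le> sqrt M * dist (S m) (S n)" for f :: "nat \<Rightarrow> real \<Rightarrow> 'a"
  proof -
    have "uniformly_Cauchy_on {0..} f"
      unfolding uniformly_Cauchy_on_def
    proof (intro allI impI)
      fix e :: real assume e: "0 < e"
      then have "0 < e / sqrt M" using M(1) by simp
      then obtain N where N: "\<And>m n. m \<ge> N \<Longrightarrow> n \<ge> N \<Longrightarrow> dist (S m) (S n) < e / sqrt M"
        using metric_CauchyD[OF CS] by blast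
      show "\<exists>N. \<forall>x\<in>{0..}. \<forall>m\<ge>N. \<forall>n\<ge>N. dist (f m x) (f n x) < e"
      proof (intro exI[of _ N] ballI allI impI)
        fix x :: real and m n assume x: "x \<in> {0..}" and mn: "N \<le> m" "N \<le> n"
        have "norm (f m x - f n x) \<le> sqrt M * dist (S m) (S n)" using x by (intro f) simp
        also have "\<dots> < sqrt M * (e / sqrt M)" using N[OF mn] M(1) by (intro mult_strict_left_mono) auto
        also have "\<dots> = e" using M(1) by simp
        finally show "dist (f m x) (f n x) < e" by (simp add: dist_norm)
      qed
    qed
    then have "uniformly_convergent_on {0..} f" by (rule Cauchy_uniformly_convergent)
    then show ?thesis by (simp add: uniformly_convergent_on_def)
  qed
  obtain p' q' w' where u: "uniform_limit {0..} p p' sequentially" "uniform_limit {0..} q q' sequentially"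
    "uniform_limit {0..} w w' sequentially"
    using uc[of p, OF est(1)] uc[of q, OF est(2)] uc[of w, OF est(3)] by blast
  have c: "continuous_on {0..} p'" "continuous_on {0..} q'" "continuous_on {0..} w'"
    by (rule uniform_limit_theorem[OF always_eventually u(1)], use mild_solutionD(1)[OF s] in simp_all)
      (rule uniform_limit_theorem[OF always_eventually u(2)], use mild_solutionD(2)[OF s] in simp_all,
       rule uniform_limit_theorem[OF always_eventually u(3)], use mild_solutionD(3)[OF s] in simp_all)
  have pt: "(\<lambda>n. p n t) \<longlonglongrightarrow> p' t" "(\<lambda>n. q n t) \<longlonglongrightarrow> q' t" "(\<lambda>n. w n t) \<longlonglongrightarrow> w' t" if "0 \<le> t" for t
    using tendsto_uniform_limitI[OF u(1)] tendsto_uniform_limitI[OF u(2)] tendsto_uniform_limitI[OF u(3)] that by auto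
  note bR = bounded_linear.tendsto[OF blinfun.bounded_linear_right[of R]]
  have "mild_solution R \<alpha> \<beta> \<gamma> G p' q' w'"
    unfolding mild_solution_def
  proof (intro conjI allI impI c)
    fix t :: real assume t: "0 \<le> t"
    show "(p' has_vector_derivative q' t) (at t within {0..})"
      by (rule derivative_uniform_limit[OF mild_solutionD(4)[OF s] pt(1) u(2) t])
    show "((\<lambda>t. R (q' t)) has_vector_derivative w' t) (at t within {0..})"
      by (rule derivative_uniform_limit[OF mild_solutionD(5)[OF s] bR[OF pt(2)] u(3) t])
    have U: "uniform_limit {0..} (\<lambda>n t. conv G (p n) t - \<alpha> *\<^sub>R R (w n t) - \<beta> *\<^sub>R q n t - \<gamma> *\<^sub>R p n t)
        (\<lambda>t. conv G p' t - \<alpha> *\<^sub>R R (w' t) - \<beta> *\<^sub>R q' t - \<gamma> *\<^sub>R p' t) sequentially"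
      by (intro uniform_limit_minus conv_uniform_limit mild_solutionD(1)[OF s] c u
          bounded_linear.uniform_limit[OF bounded_linear_scaleR_right]
          bounded_linear.uniform_limit[OF blinfun.bounded_linear_right])
    show "((\<lambda>t. R (w' t)) has_vector_derivative
        conv G p' t - \<alpha> *\<^sub>R R (w' t) - \<beta> *\<^sub>R q' t - \<gamma> *\<^sub>R p' t) (at t within {0..})"
      by (rule derivative_uniform_limit[OF mild_solutionD(6)[OF s] bR[OF pt(3)] U t])
  qed
  moreover have "p' 0 = p0" "q' 0 = q0" "w' 0 = w0"
    using LIMSEQ_unique[OF pt(1)[of 0]] LIMSEQ_unique[OF pt(2)[of 0]] LIMSEQ_unique[OF pt(3)[of 0]] lim
    unfolding i by auto
  ultimately show ?thesis by blast
qed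

end

section \<open>Weak solutions\<close>

lemma tendsto_norm_le_phase_norm:
  assumes "((\<lambda>s. sqrt ((a s)\<^sup>2 + (b s)\<^sup>2 + (c s)\<^sup>2)) \<longlongrightarrow> 0) F"
  shows "(a \<longlongrightarrow> (0::real)) F" "(b \<longlongrightarrow> (0::real)) F" "(c \<longlongrightarrow> (0::real)) F"
proof -
  have le: "\<bar>a s\<bar> \<le> sqrt ((a s)\<^sup>2 + (b s)\<^sup>2 + (c s)\<^sup>2)" "\<bar>b s\<bar> \<le> sqrt ((a s)\<^sup>2 + (b s)\<^sup>2 + (c s)\<^sup>2)"
    "\<bar>c s\<bar> \<le> sqrt ((a s)\<^sup>2 + (b s)\<^sup>2 + (c s)\<^sup>2)" for s
    by (rule real_le_rsqrt; simp add: add_nonneg_nonneg)+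
  show "(a \<longlongrightarrow> 0) F" by (rule Lim_null_comparison[OF _ assms]) (use le(1) in simp)
  show "(b \<longlongrightarrow> 0) F" by (rule Lim_null_comparison[OF _ assms]) (use le(2) in simp)
  show "(c \<longlongrightarrow> 0) F" by (rule Lim_null_comparison[OF _ assms]) (use le(3) in simp)
qed

lemma time_deriv_eqI:
  assumes "(u has_vector_derivative v) (at t within {0..})" "0 \<le> t"
  shows "time_deriv u t = v"
proof -
  have "at t within {0..} \<noteq> bot"
    unfolding trivial_limit_within using islimpt_subset[of t "{t..t+1}" "{0..}"] assms(2)
    by (auto simp: islimpt_Icc)
  then show ?thesis unfolding time_deriv_def using assms(1) by (intro vector_derivative_within)
qed

section \<open>Coordinates on H^1 and equivalence of weak and mild solutions\<close>

locale sqrt_representation = regularized_kernel +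
  fixes A :: "'a::{real_inner, complete_space} operator" and R :: "'a hilbert \<Rightarrow>\<^sub>L 'a hilbert"
  assumes R: "positive_blinfun R" "injective_blinfun R"
    and rep: "sqrt_operator A = {(of_hilbert (R x), of_hilbert x) | x. True}"
begin

text \<open>\<open>J\<close> is the inverse of the root of A: an isometry of H onto H^1 with the
  norm \<open>norm1 A\<close>. On H^1 its inverse is \<open>coord\<close>.\<close>

definition J :: "'a hilbert \<Rightarrow> 'a" where "J x = of_hilbert (R x)"

definition coord :: "'a \<Rightarrow> 'a hilbert" where "coord u = to_hilbert (op_apply (sqrt_operator A) u)"

lemma bounded_linear_J: "bounded_linear J"
  unfolding J_def[abs_def] by (rule bounded_linear_compose[OF bounded_linear_of_hilbert blinfun.bounded_linear_right])

lemma J_inject: "J x = J y \<Longrightarrow> x = y"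
  unfolding J_def by (rule injective_blinfunD[OF R(2)]) (metis hilbert_simps(1))

lemma op_apply_J: "op_apply (sqrt_operator A) (J x) = of_hilbert x"
  unfolding op_apply_def
proof (rule the_equality)
  show "(J x, of_hilbert x) \<in> sqrt_operator A" unfolding rep J_def by blast
  fix y assume "(J x, y) \<in> sqrt_operator A"
  then obtain x' where x': "J x = J x'" "y = of_hilbert x'" unfolding rep J_def by blast
  then show "y = of_hilbert x" using J_inject[OF x'(1)] by simp
qed

lemma H1_eq: "H1 A = range J"
  unfolding H1_def rep J_def by auto

lemma coord_J [simp]: "coord (J x) = x"
  by (simp add: coord_def op_apply_J)

lemma J_coord: "u \<in> H1 A \<Longrightarrow> J (coord u) = u"
  unfolding H1_eq by auto

lemma norm1_J: "norm1 A (J x) = norm x"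
  by (simp add: norm1_def op_apply_J)

lemma inner1_J: "inner1 A (J x) (J y) = x \<bullet> y"
  by (simp add: inner1_def op_apply_J)

lemma J_diff: "J x - J y = J (x - y)"
  by (rule linear_diff[OF bounded_linear.linear[OF bounded_linear_J], symmetric])

text \<open>A functional \<phi> on H^1 is represented by the vector Y with \<phi> (J y) = Y
  \<bullet> y. In these coordinates an element w of H, seen in the dual of H^1, is R w, which is why
  the third equation of a mild solution concerns R w.\<close>

lemma inner_J: "w \<bullet> J y = R (to_hilbert w) \<bullet> y"
proof -
  have "w \<bullet> J y = to_hilbert w \<bullet> R y" by (simp add: J_def inner_hilbert.rep_eq)
  also have "\<dots> = R (to_hilbert w) \<bullet> y" by (rule positive_blinfunD(1)[OF R(1), symmetric])
  finally show ?thesis .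
qed

lemma phase_norm_J:
  "phase_norm A (J x, J y, w) = sqrt ((norm x)\<^sup>2 + (norm y)\<^sup>2 + (norm w)\<^sup>2)"
  by (simp add: phase_norm_def norm1_J)

lemma memory_term_eq:
  assumes p: "continuous_on {0..} p" and t: "0 \<le> t"
    and u: "\<And>s. s \<in> {0..t} \<Longrightarrow> u s = J (p s)"
  shows "(LINT s:{0..t}|lborel. g s * inner1 A (u (t - s)) (J y)) = conv G p t \<bullet> y"
proof -
  have c: "continuous_on {0..t} (\<lambda>s. G s * (p (t - s) \<bullet> y))"
    by (intro continuous_intros continuous_on_subset[OF G_cont] continuous_on_compose2[OF p]) auto
  have "(LINT s:{0..t}|lborel. g s * inner1 A (u (t - s)) (J y)) = (LINT s:{0..t}|lborel. G s * (p (t - s) \<bullet> y))"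
    unfolding set_lebesgue_integral_def
  proof (rule integral_cong_AE)
    show eq: "AE s in lborel. indicator {0..t} s *\<^sub>R (g s * inner1 A (u (t - s)) (J y)) = indicator {0..t} s *\<^sub>R (G s * (p (t - s) \<bullet> y))"
      using AE_lborel_singleton[of "0::real"]
      by eventually_elim (auto simp: indicator_def u inner1_J G_eq)
    have m: "(\<lambda>s. indicator {0..t} s *\<^sub>R (G s * (p (t - s) \<bullet> y))) \<in> borel_measurable lborel"
      using borel_integrable_atLeastAtMost'[OF c] by (auto simp: set_integrable_def)
    then show "(\<lambda>s. indicator {0..t} s *\<^sub>R (G s * (p (t - s) \<bullet> y))) \<in> borel_measurable lborel" .
    \<comment> \<open>The value g 0 is unrelated to G 0, so measurability is obtained by correcting
      the integrand at the single point s = 0.\<close>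
    let ?d = "g 0 * inner1 A (u t) (J y) - G 0 * (p t \<bullet> y)"
    have "(\<lambda>s. indicator {0..t} s *\<^sub>R (g s * inner1 A (u (t - s)) (J y)))
        = (\<lambda>s. indicator {0..t} s *\<^sub>R (G s * (p (t - s) \<bullet> y)) + indicator {0} s * ?d)"
    proof
      fix s
      show "indicator {0..t} s *\<^sub>R (g s * inner1 A (u (t - s)) (J y))
        = indicator {0..t} s *\<^sub>R (G s * (p (t - s) \<bullet> y)) + indicator {0} s * ?d"
        using t by (cases "s = 0") (auto simp: indicator_def u inner1_J G_eq)
    qed
    also have "\<dots> \<in> borel_measurable lborel" by (rule borel_measurable_add[OF m]) simp
    finally show "(\<lambda>s. indicator {0..t} s *\<^sub>R (g s * inner1 A (u (t - s)) (J y))) \<in> borel_measurable lborel" .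
  qed
  also have "\<dots> = integral {0..t} (\<lambda>s. G s * (p (t - s) \<bullet> y))"
    by (rule set_borel_integral_eq_integral(2)[OF borel_integrable_atLeastAtMost'[OF c]])
  also have "\<dots> = integral {0..t} (\<lambda>s. (\<lambda>r. G r * (p (t - r) \<bullet> y)) (t - s))"
    by (rule integral_reflect_interval[OF c, symmetric])
  also have "\<dots> = conv G (\<lambda>s. p s \<bullet> y) t" by (simp add: conv_def)
  also have "\<dots> = conv G p t \<bullet> y"
    by (rule conv_linear[OF bounded_linear_inner_left G_cont p])
  finally show ?thesis .
qed

lemma integral_set_lebesgue_inner:
  fixes Y :: "real \<Rightarrow> 'a hilbert"
  assumes Y: "continuous_on {0..} Y"
  shows "set_integrable lborel {0..t} (\<lambda>s. Y s \<bullet> y)"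
    "(LINT s:{0..t}|lborel. Y s \<bullet> y) = integral {0..t} Y \<bullet> y"
proof -
  have cY: "continuous_on {0..t} Y" by (rule continuous_on_subset[OF Y]) auto
  have c: "continuous_on {0..t} (\<lambda>s. Y s \<bullet> y)" by (intro continuous_intros cY)
  show si: "set_integrable lborel {0..t} (\<lambda>s. Y s \<bullet> y)" by (rule borel_integrable_atLeastAtMost'[OF c])
  have "(LINT s:{0..t}|lborel. Y s \<bullet> y) = integral {0..t} (\<lambda>s. Y s \<bullet> y)"
    by (rule set_borel_integral_eq_integral(2)[OF si])
  also have "\<dots> = integral {0..t} Y \<bullet> y"
    using integral_linear[OF integrable_continuous_real[OF cY] bounded_linear_inner_left[of y]] by (simp add: o_def)
  finally show "(LINT s:{0..t}|lborel. Y s \<bullet> y) = integral {0..t} Y \<bullet> y" .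
qed

lemma mild_imp_global_weak_solution:
  assumes s: "mild_solution R \<alpha>' \<beta> \<gamma> G p q w"
  shows "global_weak_solution A \<alpha>' \<beta> \<gamma> g (J (p 0), J (q 0), of_hilbert (w 0)) (\<lambda>t. J (p t))"
  unfolding global_weak_solution_def
proof (intro allI impI)
  fix T :: real assume T: "0 < T"
  note c = mild_solutionD(1-3)[OF s]
  define Y where "Y t = conv G p t - \<alpha>' *\<^sub>R R (w t) - \<beta> *\<^sub>R q t - \<gamma> *\<^sub>R p t" for t
  have cY: "continuous_on {0..} Y"
    unfolding Y_def[abs_def]
    by (intro continuous_intros continuous_on_conv G_cont c bounded_linear.continuous_on[OF blinfun.bounded_linear_right])
  \<comment> \<open>The functional with coordinate vector Y t, the derivative of R w; with it the
    equation holds for every t and not only almost everywhere.\<close>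
  define \<xi> where "\<xi> t \<zeta> = Y t \<bullet> coord \<zeta>" for t \<zeta>
  show "weak_solution A \<alpha>' \<beta> \<gamma> g (J (p 0), J (q 0), of_hilbert (w 0)) T (\<lambda>t. J (p t))"
    unfolding weak_solution_def
  proof (rule exI[of _ "\<lambda>t. J (q t)"], rule exI[of _ "\<lambda>t. of_hilbert (w t)"], rule exI[of _ \<xi>],
      intro conjI ballI refl)
    fix t assume t: "t \<in> {0..T}"
    then have t0: "0 \<le> t" by simp
    have sub: "{0..T} \<subseteq> {0..}" by auto
    show "((\<lambda>t. J (p t)) has_vector_derivative J (q t)) (at t within {0..T})"
      by (rule has_vector_derivative_within_subset[OF bounded_linear.has_vector_derivative[OF bounded_linear_J mild_solutionD(4)[OF s t0]] sub])
    have "((\<lambda>t. of_hilbert (R (q t))) has_vector_derivative of_hilbert (w t)) (at t within {0..T})"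
      by (rule has_vector_derivative_within_subset[OF bounded_linear.has_vector_derivative[OF bounded_linear_of_hilbert mild_solutionD(5)[OF s t0]] sub])
    then show "((\<lambda>t. J (q t)) has_vector_derivative of_hilbert (w t)) (at t within {0..T})" by (simp add: J_def)
  next
    show "has_dual_derivative A T (\<lambda>t. of_hilbert (w t)) \<xi>"
      unfolding has_dual_derivative_def
    proof (intro conjI ballI)
      fix t
      show "\<xi> t \<in> H1_dual A"
        unfolding H1_dual_def H1_eq
      proof (intro CollectI conjI ballI allI)
        fix a b assume "a \<in> range J" "b \<in> range J"
        then obtain x y where "a = J x" "b = J y" by blast
        then show "\<xi> t (a + b) = \<xi> t a + \<xi> t b"
          by (simp add: \<xi>_def inner_add_right flip: linear_add[OF bounded_linear.linear[OF bounded_linear_J]])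
      next
        fix r a assume "a \<in> range J"
        then obtain x where "a = J x" by blast
        then show "\<xi> t (r *\<^sub>R a) = r * \<xi> t a"
          by (simp add: \<xi>_def flip: linear_scale[OF bounded_linear.linear[OF bounded_linear_J]])
      next
        show "\<exists>C. \<forall>a\<in>range J. \<bar>\<xi> t a\<bar> \<le> C * norm1 A a"
        proof (intro exI[of _ "norm (Y t)"] ballI)
          fix a assume "a \<in> range J"
          then obtain x where "a = J x" by blast
          then show "\<bar>\<xi> t a\<bar> \<le> norm (Y t) * norm1 A a"
            by (simp add: \<xi>_def norm1_J Cauchy_Schwarz_ineq2)
        qed
      qed
    next
      fix \<zeta> assume "\<zeta> \<in> H1 A"
      then obtain y where y: "\<zeta> = J y" unfolding H1_eq by blast
      show "set_integrable lborel {0..T} (\<lambda>t. \<xi> t \<zeta>)"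
        unfolding \<xi>_def y coord_J by (rule integral_set_lebesgue_inner(1)[OF cY])
      fix t assume t: "t \<in> {0..T}"
      have "(Y has_integral (R (w t) - R (w 0))) {0..t}"
      proof (rule fundamental_theorem_of_calculus)
        show "((\<lambda>t. R (w t)) has_vector_derivative Y x) (at x within {0..t})" if "x \<in> {0..t}" for x
          unfolding Y_def by (rule has_vector_derivative_within_subset[OF mild_solutionD(6)[OF s]]) (use that in auto)
      qed (use t in simp)
      then have "integral {0..t} Y = R (w t) - R (w 0)" by (rule integral_unique)
      then show "of_hilbert (w t) \<bullet> \<zeta> - of_hilbert (w 0) \<bullet> \<zeta> = (LINT s:{0..t}|lborel. \<xi> s \<zeta>)"
        unfolding \<xi>_def y coord_J integral_set_lebesgue_inner(2)[OF cY] by (simp add: inner_J inner_diff_left)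
    qed
  next
    show "continuous_into_phase_space A {0..T} (\<lambda>t. (J (p t), J (q t), of_hilbert (w t)))"
      unfolding continuous_into_phase_space_def
    proof (intro ballI conjI)
      fix t assume t: "t \<in> {0..T}"
      show "(J (p t), J (q t), of_hilbert (w t)) \<in> phase_space A" by (simp add: phase_space_def H1_eq)
      have lim: "(f \<longlongrightarrow> f t) (at t within {0..T})" if "continuous_on {0..} f" for f :: "real \<Rightarrow> 'a hilbert"
        using continuous_on_subset[OF that, of "{0..T}"] t by (auto simp: continuous_on_def)
      have eq: "phase_norm A ((J (p s), J (q s), of_hilbert (w s)) - (J (p t), J (q t), of_hilbert (w t)))
         = sqrt ((norm (p s - p t))\<^sup>2 + (norm (q s - q t))\<^sup>2 + (norm (w s - w t))\<^sup>2)" for s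
      proof -
        have "norm (of_hilbert (w s) - of_hilbert (w t)) = norm (w s - w t)"
          by (simp add: norm_hilbert.rep_eq minus_hilbert.rep_eq)
        then show ?thesis by (simp add: J_diff phase_norm_J)
      qed
      have "((\<lambda>s. sqrt ((norm (p s - p t))\<^sup>2 + (norm (q s - q t))\<^sup>2 + (norm (w s - w t))\<^sup>2)) \<longlongrightarrow>
          sqrt ((norm (p t - p t))\<^sup>2 + (norm (q t - q t))\<^sup>2 + (norm (w t - w t))\<^sup>2)) (at t within {0..T})"
        by (intro tendsto_real_sqrt tendsto_add tendsto_power tendsto_norm tendsto_diff tendsto_const lim c)
      then show "((\<lambda>s. phase_norm A ((J (p s), J (q s), of_hilbert (w s)) - (J (p t), J (q t), of_hilbert (w t)))) \<longlongrightarrow> 0) (at t within {0..T})"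
        unfolding eq by simp
    qed
  next
    fix \<zeta> assume "\<zeta> \<in> H1 A"
    then obtain y where y: "\<zeta> = J y" unfolding H1_eq by blast
    show "AE t in lborel. t \<in> {0..T} \<longrightarrow>
        \<xi> t \<zeta> + \<alpha>' * (of_hilbert (w t) \<bullet> \<zeta>) + \<beta> * inner1 A (J (q t)) \<zeta> + \<gamma> * inner1 A (J (p t)) \<zeta>
          - (LINT s:{0..t}|lborel. g s * inner1 A (J (p (t - s))) \<zeta>) = 0"
    proof (intro AE_I2 impI)
      fix t assume t: "t \<in> {0..T}"
      have "(LINT s:{0..t}|lborel. g s * inner1 A (J (p (t - s))) \<zeta>) = conv G p t \<bullet> y"
        unfolding y by (rule memory_term_eq[where u = "\<lambda>t. J (p t)", OF c(1)]) (use t in auto)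
      then show "\<xi> t \<zeta> + \<alpha>' * (of_hilbert (w t) \<bullet> \<zeta>) + \<beta> * inner1 A (J (q t)) \<zeta> + \<gamma> * inner1 A (J (p t)) \<zeta>
          - (LINT s:{0..t}|lborel. g s * inner1 A (J (p (t - s))) \<zeta>) = 0"
        by (simp add: y \<xi>_def Y_def inner1_J inner_J inner_diff_left)
    qed
  qed
qed

text \<open>The definition provides separate witnesses on each [0,T], unified here by
  \<open>time_deriv\<close>. The derivatives are given only in H; continuity into H^1 and
  integration recover p' = q, and testing with J y recovers the equation for R w.\<close>

lemma global_weak_solution_imp_mild:
  assumes s: "global_weak_solution A \<alpha>' \<beta> \<gamma> g z0 u"
  obtains p q w where "mild_solution R \<alpha>' \<beta> \<gamma> G p q w" "z0 = (J (p 0), J (q 0), of_hilbert (w 0))"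
    "\<And>t. 0 \<le> t \<Longrightarrow> u t = J (p t)" "\<And>t. 0 \<le> t \<Longrightarrow> time_deriv u t = J (q t)"
    "\<And>t. 0 \<le> t \<Longrightarrow> time_deriv (time_deriv u) t = of_hilbert (w t)"
proof -
  define v where "v = time_deriv u"
  define w where "w = time_deriv v"
  let ?z = "\<lambda>t. (u t, v t, w t)"
  \<comment> \<open>Half-open intervals, because at T the derivative within [0,T] is one-sided and
    says nothing about the derivative within [0,\<infinity>).\<close>
  have loc: "\<exists>\<xi>. (\<forall>t\<in>{0..<T}. (u has_vector_derivative v t) (at t within {0..}) \<and>
        (v has_vector_derivative w t) (at t within {0..}) \<and> ?z t \<in> phase_space A \<and>
        ((\<lambda>s. phase_norm A (?z s - ?z t)) \<longlongrightarrow> 0) (at t within {0..})) \<and> ?z 0 = z0 \<and>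
      (\<forall>\<zeta>\<in>H1 A. set_integrable lborel {0..T} (\<lambda>t. \<xi> t \<zeta>) \<and>
        (\<forall>t\<in>{0..<T}. w t \<bullet> \<zeta> - w 0 \<bullet> \<zeta> = (LINT s:{0..t}|lborel. \<xi> s \<zeta>)) \<and>
        (AE t in lborel. t \<in> {0..<T} \<longrightarrow> \<xi> t \<zeta> + \<alpha>' * (w t \<bullet> \<zeta>) + \<beta> * inner1 A (v t) \<zeta> + \<gamma> * inner1 A (u t) \<zeta>
          - (LINT s:{0..t}|lborel. g s * inner1 A (u (t - s)) \<zeta>) = 0))" if T: "0 < T" for T
  proof -
    obtain v' w' \<xi> where
      d1: "\<And>t. t \<in> {0..T} \<Longrightarrow> (u has_vector_derivative v' t) (at t within {0..T})" and
      d2: "\<And>t. t \<in> {0..T} \<Longrightarrow> (v' has_vector_derivative w' t) (at t within {0..T})" and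
      dd: "has_dual_derivative A T w' \<xi>" and
      cp: "continuous_into_phase_space A {0..T} (\<lambda>t. (u t, v' t, w' t))" and
      i0: "(u 0, v' 0, w' 0) = z0" and
      eq: "\<And>\<zeta>. \<zeta> \<in> H1 A \<Longrightarrow> AE t in lborel. t \<in> {0..T} \<longrightarrow>
        \<xi> t \<zeta> + \<alpha>' * (w' t \<bullet> \<zeta>) + \<beta> * inner1 A (v' t) \<zeta> + \<gamma> * inner1 A (u t) \<zeta>
          - (LINT s:{0..t}|lborel. g s * inner1 A (u (t - s)) \<zeta>) = 0"
      using s T unfolding global_weak_solution_def weak_solution_def by blast
    have at_eq: "at t within {0..T} = at t within {0..}" if "t \<in> {0..<T}" for t
      using that by (intro at_within_Icc_extend) simp
    have du: "(u has_vector_derivative v' t) (at t within {0..})" if "t \<in> {0..<T}" for t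
      using d1[of t] at_eq[OF that] that by simp
    have vv: "v t = v' t" if "t \<in> {0..<T}" for t
      unfolding v_def by (rule time_deriv_eqI[OF du[OF that]]) (use that in simp)
    have dv: "(v has_vector_derivative w' t) (at t within {0..})" if t: "t \<in> {0..<T}" for t
    proof (rule has_vector_derivative_transform_within[of v' _ _ _ "T - t"])
      show "(v' has_vector_derivative w' t) (at t within {0..})" using d2[of t] at_eq[OF t] t by simp
      show "v' s = v s" if "s \<in> {0..}" "dist s t < T - t" for s
        using that t by (intro vv[symmetric]) (auto simp: dist_real_def)
    qed (use t in auto)
    have ww: "w t = w' t" if "t \<in> {0..<T}" for t
      unfolding w_def by (rule time_deriv_eqI[OF dv[OF that]]) (use that in simp)
    show ?thesis
    proof (intro exI[of _ \<xi>] conjI ballI)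
      fix t assume t: "t \<in> {0..<T}"
      show "(u has_vector_derivative v t) (at t within {0..})" using du[OF t] vv[OF t] by simp
      show "(v has_vector_derivative w t) (at t within {0..})" using dv[OF t] ww[OF t] by simp
      have ph: "(u t, v' t, w' t) \<in> phase_space A"
        "((\<lambda>s. phase_norm A ((u s, v' s, w' s) - (u t, v' t, w' t))) \<longlongrightarrow> 0) (at t within {0..T})"
        using cp t unfolding continuous_into_phase_space_def by auto
      show "?z t \<in> phase_space A" using ph(1) vv[OF t] ww[OF t] by simp
      show "((\<lambda>s. phase_norm A (?z s - ?z t)) \<longlongrightarrow> 0) (at t within {0..})"
      proof (rule Lim_transform_within[OF ph(2)[unfolded at_eq[OF t]]])
        show "0 < T - t" using t by simp
        fix s assume "s \<in> {0..}" "0 < dist s t" "dist s t < T - t"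
        then have "s \<in> {0..<T}" using t by (auto simp: dist_real_def)
        then show "phase_norm A ((u s, v' s, w' s) - (u t, v' t, w' t)) = phase_norm A (?z s - ?z t)"
          by (simp add: vv ww vv[OF t] ww[OF t])
      qed
    next
      show "?z 0 = z0" using i0 vv[of 0] ww[of 0] T by simp
    next
      fix \<zeta> assume z: "\<zeta> \<in> H1 A"
      show "set_integrable lborel {0..T} (\<lambda>t. \<xi> t \<zeta>)" using dd z unfolding has_dual_derivative_def by blast
      show "w t \<bullet> \<zeta> - w 0 \<bullet> \<zeta> = (LINT s:{0..t}|lborel. \<xi> s \<zeta>)" if t: "t \<in> {0..<T}" for t
      proof -
        have "t \<in> {0..T}" using t by simp
        then have "w' t \<bullet> \<zeta> - w' 0 \<bullet> \<zeta> = (LINT s:{0..t}|lborel. \<xi> s \<zeta>)"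
          using dd z unfolding has_dual_derivative_def by blast
        then show ?thesis using ww[OF t] ww[of 0] T by simp
      qed
      show "AE t in lborel. t \<in> {0..<T} \<longrightarrow> \<xi> t \<zeta> + \<alpha>' * (w t \<bullet> \<zeta>) + \<beta> * inner1 A (v t) \<zeta> + \<gamma> * inner1 A (u t) \<zeta>
          - (LINT s:{0..t}|lborel. g s * inner1 A (u (t - s)) \<zeta>) = 0"
        using eq[OF z] by eventually_elim (auto simp: vv ww)
    qed
  qed
  have pt: "(u has_vector_derivative v t) (at t within {0..})" "(v has_vector_derivative w t) (at t within {0..})"
    "u t \<in> H1 A" "v t \<in> H1 A" "((\<lambda>s. phase_norm A (?z s - ?z t)) \<longlongrightarrow> 0) (at t within {0..})" if t: "0 \<le> t" for t
  proof -
    have T: "0 < t + 1" "t \<in> {0..<t + 1}" using t by auto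
    from loc[OF T(1)] have "\<forall>t\<in>{0..<t + 1}. (u has_vector_derivative v t) (at t within {0..}) \<and>
        (v has_vector_derivative w t) (at t within {0..}) \<and> ?z t \<in> phase_space A \<and>
        ((\<lambda>s. phase_norm A (?z s - ?z t)) \<longlongrightarrow> 0) (at t within {0..})" by (elim exE conjE)
    from bspec[OF this T(2)] have "(u has_vector_derivative v t) (at t within {0..}) \<and>
        (v has_vector_derivative w t) (at t within {0..}) \<and> ?z t \<in> phase_space A \<and>
        ((\<lambda>s. phase_norm A (?z s - ?z t)) \<longlongrightarrow> 0) (at t within {0..})" .
    then show "(u has_vector_derivative v t) (at t within {0..})" "(v has_vector_derivative w t) (at t within {0..})"
      "u t \<in> H1 A" "v t \<in> H1 A" "((\<lambda>s. phase_norm A (?z s - ?z t)) \<longlongrightarrow> 0) (at t within {0..})"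
      unfolding phase_space_def by auto
  qed
  define p q \<omega> where "p t = coord (u t)" and "q t = coord (v t)" and "\<omega> t = to_hilbert (w t)" for t
  have uJ: "u t = J (p t)" and vJ: "v t = J (q t)" if "0 \<le> t" for t
    unfolding p_def q_def using pt(3,4)[OF that] by (simp_all add: J_coord)
  have lims: "((\<lambda>s. norm (p s - p t)) \<longlongrightarrow> 0) (at t within {0..})" "((\<lambda>s. norm (q s - q t)) \<longlongrightarrow> 0) (at t within {0..})"
    "((\<lambda>s. norm (\<omega> s - \<omega> t)) \<longlongrightarrow> 0) (at t within {0..})" if t: "0 \<le> t" for t
  proof -
    have "((\<lambda>s. sqrt ((norm (p s - p t))\<^sup>2 + (norm (q s - q t))\<^sup>2 + (norm (\<omega> s - \<omega> t))\<^sup>2)) \<longlongrightarrow> 0) (at t within {0..})"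
    proof (rule Lim_transform_within[OF pt(5)[OF t] zero_less_one])
      fix s :: real assume "s \<in> {0..}"
      then have "0 \<le> s" by simp
      moreover have "norm (w s - w t) = norm (\<omega> s - \<omega> t)"
        unfolding \<omega>_def using linear_diff[OF bounded_linear.linear[OF bounded_linear_to_hilbert], of "w s" "w t"]
        by (metis hilbert_simps(4))
      ultimately show "phase_norm A (?z s - ?z t)
          = sqrt ((norm (p s - p t))\<^sup>2 + (norm (q s - q t))\<^sup>2 + (norm (\<omega> s - \<omega> t))\<^sup>2)"
        using t by (simp add: uJ vJ J_diff phase_norm_J)
    qed
    from tendsto_norm_le_phase_norm[OF this]
    show "((\<lambda>s. norm (p s - p t)) \<longlongrightarrow> 0) (at t within {0..})" "((\<lambda>s. norm (q s - q t)) \<longlongrightarrow> 0) (at t within {0..})"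
      "((\<lambda>s. norm (\<omega> s - \<omega> t)) \<longlongrightarrow> 0) (at t within {0..})" .
  qed
  have contI: "continuous_on {0..} f" if "\<And>t. 0 \<le> t \<Longrightarrow> ((\<lambda>s. norm (f s - f t)) \<longlongrightarrow> 0) (at t within {0..})"
    for f :: "real \<Rightarrow> 'a hilbert"
    unfolding continuous_on_def
  proof
    fix t :: real assume "t \<in> {0..}"
    then have "((\<lambda>s. norm (f s - f t)) \<longlongrightarrow> 0) (at t within {0..})" by (intro that) simp
    then have "((\<lambda>s. f s - f t) \<longlongrightarrow> 0) (at t within {0..})" by (rule tendsto_norm_zero_cancel)
    then show "(f \<longlongrightarrow> f t) (at t within {0..})" by (rule LIM_zero_cancel)
  qed
  have c: "continuous_on {0..} p" "continuous_on {0..} q" "continuous_on {0..} \<omega>"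
    using lims by (intro contI; blast)+
  have to_J: "to_hilbert (J x) = R x" for x by (simp add: J_def)
  have dRp: "((\<lambda>t. R (p t)) has_vector_derivative R (q t)) (at t within {0..})" if t: "0 \<le> t" for t
  proof (rule has_vector_derivative_transform[of t "{0..}" _ "\<lambda>t. to_hilbert (u t)"])
    have "((\<lambda>t. to_hilbert (u t)) has_vector_derivative to_hilbert (v t)) (at t within {0..})"
      by (rule bounded_linear.has_vector_derivative[OF bounded_linear_to_hilbert pt(1)[OF t]])
    then show "((\<lambda>t. to_hilbert (u t)) has_vector_derivative R (q t)) (at t within {0..})"
      by (simp add: vJ[OF t] to_J)
    show "R (p s) = to_hilbert (u s)" if "s \<in> {0..}" for s using that by (simp add: uJ to_J)
  qed (use t in simp)
  have dRq: "((\<lambda>t. R (q t)) has_vector_derivative \<omega> t) (at t within {0..})" if t: "0 \<le> t" for t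
  proof (rule has_vector_derivative_transform[of t "{0..}" _ "\<lambda>t. to_hilbert (v t)"])
    show "((\<lambda>t. to_hilbert (v t)) has_vector_derivative \<omega> t) (at t within {0..})"
      unfolding \<omega>_def by (rule bounded_linear.has_vector_derivative[OF bounded_linear_to_hilbert pt(2)[OF t]])
    show "R (q s) = to_hilbert (v s)" if "s \<in> {0..}" for s using that by (simp add: vJ to_J)
  qed (use t in simp)
  have derI: "(f has_vector_derivative h t) (at t within {0..})"
    if h: "continuous_on {0..} h" and f: "\<And>t. 0 \<le> t \<Longrightarrow> f t = f 0 + integral {0..t} h" and t: "0 \<le> t"
    for f h :: "real \<Rightarrow> 'a hilbert" and t
  proof (rule has_vector_derivative_transform[of t "{0..}" _ "\<lambda>t. f 0 + integral {0..t} h"])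
    have "((\<lambda>t. f 0 + integral {0..t} h) has_vector_derivative 0 + h t) (at t within {0..})"
      by (intro has_vector_derivative_add has_vector_derivative_const integral_upper_has_vector_derivative h t)
    then show "((\<lambda>t. f 0 + integral {0..t} h) has_vector_derivative h t) (at t within {0..})" by simp
    show "f s = f 0 + integral {0..s} h" if "s \<in> {0..}" for s using that by (intro f) simp
  qed (use t in simp)
  \<comment> \<open>Injectivity of R lifts the integrated identity for R p to p; the integral of q
    exists because q is continuous.\<close>
  have p_int: "p t = p 0 + integral {0..t} q" if t: "0 \<le> t" for t
  proof (rule injective_blinfunD[OF R(2)])
    have iq: "q integrable_on {0..t}" by (intro integrable_continuous_real continuous_on_subset[OF c(2)]) auto
    have "((\<lambda>t. R (q t)) has_integral (R (p t) - R (p 0))) {0..t}"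
      by (rule fundamental_theorem_of_calculus[OF t], rule has_vector_derivative_within_subset[OF dRp]) auto
    moreover have "((\<lambda>t. R (q t)) has_integral R (integral {0..t} q)) {0..t}"
      using has_integral_linear[OF integrable_integral[OF iq] blinfun.bounded_linear_right] by (simp add: o_def)
    ultimately have "R (p t) - R (p 0) = R (integral {0..t} q)"
      by (rule has_integral_unique)
    then show "R (p t) = R (p 0 + integral {0..t} q)"
      by (simp add: blinfun.add_right algebra_simps)
  qed
  define Y where "Y t = conv G p t - \<alpha>' *\<^sub>R R (\<omega> t) - \<beta> *\<^sub>R q t - \<gamma> *\<^sub>R p t" for t
  have cY: "continuous_on {0..} Y"
    unfolding Y_def[abs_def]
    by (intro continuous_intros continuous_on_conv G_cont c bounded_linear.continuous_on[OF blinfun.bounded_linear_right])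
  have w_int: "R (\<omega> t) = R (\<omega> 0) + integral {0..t} Y" if t: "0 \<le> t" for t
  proof -
    have T: "0 < t + 1" using t by simp
    obtain \<xi> where \<xi>: "\<And>\<zeta>. \<zeta> \<in> H1 A \<Longrightarrow> set_integrable lborel {0..t + 1} (\<lambda>t. \<xi> t \<zeta>)"
      "\<And>\<zeta>. \<zeta> \<in> H1 A \<Longrightarrow> w t \<bullet> \<zeta> - w 0 \<bullet> \<zeta> = (LINT s:{0..t}|lborel. \<xi> s \<zeta>)"
      "\<And>\<zeta>. \<zeta> \<in> H1 A \<Longrightarrow> AE s in lborel. s \<in> {0..<t + 1} \<longrightarrow> \<xi> s \<zeta> + \<alpha>' * (w s \<bullet> \<zeta>) + \<beta> * inner1 A (v s) \<zeta> + \<gamma> * inner1 A (u s) \<zeta>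
          - (LINT r:{0..s}|lborel. g r * inner1 A (u (s - r)) \<zeta>) = 0"
      using loc[OF T] t by fastforce
    \<comment> \<open>The exceptional null set of the weak equation depends on the test vector, but
      integrating for each fixed y first removes it.\<close>
    have "(R (\<omega> t) - R (\<omega> 0) - integral {0..t} Y) \<bullet> y = 0" for y
    proof -
      have yH: "J y \<in> H1 A" unfolding H1_eq by simp
      have sx: "set_integrable lborel {0..t} (\<lambda>s. \<xi> s (J y))"
        by (rule set_integrable_subset[OF \<xi>(1)[OF yH]]) auto
      have "(R (\<omega> t) - R (\<omega> 0)) \<bullet> y = w t \<bullet> J y - w 0 \<bullet> J y"
        by (simp add: inner_J \<omega>_def inner_diff_left)
      also have "\<dots> = (LINT s:{0..t}|lborel. \<xi> s (J y))" by (rule \<xi>(2)[OF yH])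
      also have "\<dots> = (LINT s:{0..t}|lborel. Y s \<bullet> y)"
        unfolding set_lebesgue_integral_def
      proof (rule integral_cong_AE)
        show "AE s in lborel. indicator {0..t} s *\<^sub>R \<xi> s (J y) = indicator {0..t} s *\<^sub>R (Y s \<bullet> y)"
          using \<xi>(3)[OF yH]
        proof eventually_elim
          case (elim s)
          show ?case
          proof (cases "s \<in> {0..t}")
            case True
            have "(LINT r:{0..s}|lborel. g r * inner1 A (u (s - r)) (J y)) = conv G p s \<bullet> y"
              by (rule memory_term_eq[OF c(1)]) (use True uJ in auto)
            then show ?thesis using elim True
              by (simp add: Y_def inner_J uJ vJ inner1_J \<omega>_def inner_diff_left)
          qed simp
        qed
      qed (use sx integral_set_lebesgue_inner(1)[OF cY] in \<open>auto simp: set_integrable_def\<close>)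
      also have "\<dots> = integral {0..t} Y \<bullet> y" by (rule integral_set_lebesgue_inner(2)[OF cY])
      finally show ?thesis by (simp add: inner_diff_left)
    qed
    then have "R (\<omega> t) - R (\<omega> 0) - integral {0..t} Y = 0"
      using inner_eq_zero_iff by blast
    then show ?thesis by (simp add: algebra_simps)
  qed
  have "mild_solution R \<alpha>' \<beta> \<gamma> G p q \<omega>"
    unfolding mild_solution_def
  proof (intro conjI allI impI c)
    fix t :: real assume t: "0 \<le> t"
    show "(p has_vector_derivative q t) (at t within {0..})" by (rule derI[OF c(2) p_int t])
    show "((\<lambda>t. R (q t)) has_vector_derivative \<omega> t) (at t within {0..})" by (rule dRq[OF t])
    show "((\<lambda>t. R (\<omega> t)) has_vector_derivative
        conv G p t - \<alpha>' *\<^sub>R R (\<omega> t) - \<beta> *\<^sub>R q t - \<gamma> *\<^sub>R p t) (at t within {0..})"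
      using derI[where f = "\<lambda>t. R (\<omega> t)", OF cY w_int t] by (simp add: Y_def)
  qed
  moreover have "z0 = (J (p 0), J (q 0), of_hilbert (\<omega> 0))"
    using loc[OF zero_less_one] uJ[of 0] vJ[of 0] by (auto simp: \<omega>_def)
  ultimately show thesis
    by (rule that) (simp_all add: uJ vJ \<omega>_def flip: v_def w_def)
qed

end

section \<open>Well-posedness and energy bound for weak solutions\<close>

context sqrt_representation
begin

lemma energy_eq:
  assumes u: "\<And>t. 0 \<le> t \<Longrightarrow> u t = J (p t)" "\<And>t. 0 \<le> t \<Longrightarrow> time_deriv u t = J (q t)"
    "\<And>t. 0 \<le> t \<Longrightarrow> time_deriv (time_deriv u) t = of_hilbert (w t)" and t: "0 \<le> t"
  shows "energy A g u t = (norm (p t))\<^sup>2 + (norm (q t))\<^sup>2 + (norm (w t))\<^sup>2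
    + (LINT s:{0..t}|lborel. - deriv g s * (norm (p t - p (t - s)))\<^sup>2)"
proof -
  have "(LINT s:{0..t}|lborel. - deriv g s * (norm1 A (u t - u (t - s)))\<^sup>2)
      = (LINT s:{0..t}|lborel. - deriv g s * (norm (p t - p (t - s)))\<^sup>2)"
    by (rule set_lebesgue_integral_cong) (use t in \<open>auto simp: u(1) J_diff norm1_J\<close>)
  then show ?thesis unfolding energy_def using t by (simp add: u norm1_J)
qed

text \<open>The difference of the two mild representations is a mild solution with zero data, which
  the energy bound forces to vanish.\<close>

lemma global_weak_solution_unique:
  assumes par: "0 < \<alpha>" "0 < \<beta>" "0 < \<gamma>" "\<gamma> / \<alpha> < \<beta>" "\<kappa> < \<gamma>"
    and s: "global_weak_solution A \<alpha> \<beta> \<gamma> g z0 u" and s': "global_weak_solution A \<alpha> \<beta> \<gamma> g z0 u'" and t: "0 \<le> t"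
  shows "u' t = u t"
proof -
  obtain p q w where m: "mild_solution R \<alpha> \<beta> \<gamma> G p q w" "z0 = (J (p 0), J (q 0), of_hilbert (w 0))"
    and u: "\<And>t. 0 \<le> t \<Longrightarrow> u t = J (p t)"
    apply (rule global_weak_solution_imp_mild[OF s])
    subgoal premises prems for p q w by (rule prems(1)[OF prems(2-4)])
    done
  obtain p' q' w' where m': "mild_solution R \<alpha> \<beta> \<gamma> G p' q' w'" "z0 = (J (p' 0), J (q' 0), of_hilbert (w' 0))"
    and u': "\<And>t. 0 \<le> t \<Longrightarrow> u' t = J (p' t)"
    apply (rule global_weak_solution_imp_mild[OF s'])
    subgoal premises prems for p q w by (rule prems(1)[OF prems(2-4)])
    done
  have init: "p 0 = p' 0" "q 0 = q' 0" "w 0 = w' 0"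
  proof -
    have "J (p 0) = J (p' 0)" "J (q 0) = J (q' 0)" "of_hilbert (w 0) = of_hilbert (w' 0)"
      using m(2) unfolding m'(2) by simp_all
    note e = this
    show "p 0 = p' 0" by (rule J_inject[OF e(1)])
    show "q 0 = q' 0" by (rule J_inject[OF e(2)])
    show "w 0 = w' 0" using e(3) by (simp only: of_hilbert_inject)
  qed
  obtain M where M: "\<And>p q w t. mild_solution R \<alpha> \<beta> \<gamma> G p q w \<Longrightarrow> 0 \<le> t \<Longrightarrow>
    (norm (p t))\<^sup>2 + (norm (q t))\<^sup>2 + (norm (w t))\<^sup>2
      + (LINT s:{0..t}|lborel. - deriv g s * (norm (p t - p (t - s)))\<^sup>2)
    \<le> M * ((norm (p 0))\<^sup>2 + (norm (q 0))\<^sup>2 + (norm (w 0))\<^sup>2)"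
    apply (rule mild_energy[OF R par])
    subgoal premises prems for M by (rule prems(1)[OF prems(3)])
    done
  have "(norm (p t - p' t))\<^sup>2 + (norm (q t - q' t))\<^sup>2 + (norm (w t - w' t))\<^sup>2 \<le> 0"
    using M[OF mild_solution_diff[OF G_cont m(1) m'(1)] t] memory_nonneg[of t "\<lambda>t. p t - p' t"] by (simp add: init)
  then have "(norm (p t - p' t))\<^sup>2 \<le> 0" using zero_le_power2[of "norm (q t - q' t)"] zero_le_power2[of "norm (w t - w' t)"] by linarith
  then have "p t = p' t" by simp
  then show ?thesis using u[OF t] u'[OF t] by simp
qed

lemma global_weak_solution_exists:
  assumes par: "0 < \<alpha>" "0 < \<beta>" "0 < \<gamma>" "\<gamma> / \<alpha> < \<beta>" "\<kappa> < \<gamma>" and z0: "z0 \<in> phase_space A"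
  shows "\<exists>u. global_weak_solution A \<alpha> \<beta> \<gamma> g z0 u"
proof -
  obtain a b c where z: "z0 = (J a, J b, c)"
    using z0 unfolding phase_space_def H1_eq by auto
  obtain p q w where m: "mild_solution R \<alpha> \<beta> \<gamma> G p q w" "p 0 = a" "q 0 = b" "w 0 = to_hilbert c"
    using mild_solution_exists[OF R par] by blast
  show ?thesis using mild_imp_global_weak_solution[OF m(1)] unfolding z m(2-4) by auto
qed

lemma global_weak_solution_energy:
  assumes par: "0 < \<alpha>" "0 < \<beta>" "0 < \<gamma>" "\<gamma> / \<alpha> < \<beta>" "\<kappa> < \<gamma>"
  shows "\<exists>M\<ge>1. \<forall>z0 u. global_weak_solution A \<alpha> \<beta> \<gamma> g z0 u \<longrightarrow> (\<forall>t\<ge>0. energy A g u t \<le> M * energy A g u 0)"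
proof -
  obtain M where M: "1 \<le> M" "\<And>p q w t. mild_solution R \<alpha> \<beta> \<gamma> G p q w \<Longrightarrow> 0 \<le> t \<Longrightarrow>
    (norm (p t))\<^sup>2 + (norm (q t))\<^sup>2 + (norm (w t))\<^sup>2
      + (LINT s:{0..t}|lborel. - deriv g s * (norm (p t - p (t - s)))\<^sup>2)
    \<le> M * ((norm (p 0))\<^sup>2 + (norm (q 0))\<^sup>2 + (norm (w 0))\<^sup>2)"
    apply (rule mild_energy[OF R par])
    subgoal premises prems for M by (rule prems(1)[OF prems(2,3)])
    done
  show ?thesis
  proof (intro exI[of _ M] conjI allI impI M(1))
    fix z0 u and t :: real assume s: "global_weak_solution A \<alpha> \<beta> \<gamma> g z0 u" and t: "0 \<le> t"
    obtain p q w where m: "mild_solution R \<alpha> \<beta> \<gamma> G p q w"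
      and u: "\<And>t. 0 \<le> t \<Longrightarrow> u t = J (p t)" "\<And>t. 0 \<le> t \<Longrightarrow> time_deriv u t = J (q t)"
        "\<And>t. 0 \<le> t \<Longrightarrow> time_deriv (time_deriv u) t = of_hilbert (w t)"
      apply (rule global_weak_solution_imp_mild[OF s])
      subgoal premises prems for p q w by (rule prems(1)[OF prems(2,4-6)])
      done
    have E: "energy A g u t = (norm (p t))\<^sup>2 + (norm (q t))\<^sup>2 + (norm (w t))\<^sup>2
        + (LINT s:{0..t}|lborel. - deriv g s * (norm (p t - p (t - s)))\<^sup>2)" if "0 \<le> t" for t
      using u that by (rule energy_eq)
    \<comment> \<open>The memory part of the energy is nonnegative, so the initial energy dominates
      the norm of the data.\<close>
    have "(norm (p 0))\<^sup>2 + (norm (q 0))\<^sup>2 + (norm (w 0))\<^sup>2 \<le> energy A g u 0"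
      using E[OF order_refl] memory_nonneg[of 0 p] by linarith
    then have "M * ((norm (p 0))\<^sup>2 + (norm (q 0))\<^sup>2 + (norm (w 0))\<^sup>2) \<le> M * energy A g u 0"
      using M(1) by (intro mult_left_mono) auto
    then show "energy A g u t \<le> M * energy A g u 0"
      unfolding E[OF t] using M(2)[OF m t] by linarith
  qed
qed

end

theorem theorem4p2:
  fixes A :: "'a::{real_inner, complete_space} operator"
    and \<alpha> \<beta> \<gamma> :: real
    and g :: "real \<Rightarrow> real"
  assumes "selfadjoint A" and "strictly_positive A"
    and "\<alpha> > 0" and "\<beta> > 0" and "\<gamma> > 0"
    and "\<beta> - \<gamma> / \<alpha> > 0"
    and "\<exists>s>0. g s \<noteq> 0"
    and "kernel_g1 g \<gamma>" and "kernel_g2 g" and "kernel_g3 g \<alpha>"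
  shows "(\<forall>z\<^sub>0\<in>phase_space A. \<exists>u. global_weak_solution A \<alpha> \<beta> \<gamma> g z\<^sub>0 u \<and>
            (\<forall>u'. global_weak_solution A \<alpha> \<beta> \<gamma> g z\<^sub>0 u' \<longrightarrow> (\<forall>t\<ge>0. u' t = u t))) \<and>
         (\<exists>M\<ge>1. \<forall>z\<^sub>0\<in>phase_space A. \<forall>u. global_weak_solution A \<alpha> \<beta> \<gamma> g z\<^sub>0 u \<longrightarrow>
            (\<forall>t\<ge>0. energy A g u t \<le> M * energy A g u 0))"
proof -
  define \<kappa> where "\<kappa> = (LINT s:{0<..}|lborel. g s)"
  have par: "0 < \<alpha>" "0 < \<beta>" "0 < \<gamma>" "\<gamma> / \<alpha> < \<beta>" "\<kappa> < \<gamma>"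
    using assms(3-6,8) by (simp_all add: \<kappa>_def kernel_g1_def)
  obtain G k k1 k2 e c where K: "regularized_kernel g \<alpha> \<kappa> G k k1 k2 e c"
    unfolding \<kappa>_def by (rule kernel_regularization[OF assms(8-10)])
  obtain R :: "'a hilbert \<Rightarrow>\<^sub>L 'a hilbert" where R: "positive_blinfun R" "injective_blinfun R"
    "sqrt_operator A = {(of_hilbert (R x), of_hilbert x) | x. True}"
    by (rule sqrt_operator_representation[OF assms(1,2)])
  interpret sqrt_representation g \<alpha> \<kappa> G k k1 k2 e c A R
    by (intro sqrt_representation.intro K sqrt_representation_axioms.intro R)
  have "\<exists>u. global_weak_solution A \<alpha> \<beta> \<gamma> g z0 u \<and>
      (\<forall>u'. global_weak_solution A \<alpha> \<beta> \<gamma> g z0 u' \<longrightarrow> (\<forall>t\<ge>0. u' t = u t))" if z0: "z0 \<in> phase_space A" for z0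
  proof -
    obtain u where "global_weak_solution A \<alpha> \<beta> \<gamma> g z0 u" using global_weak_solution_exists[OF par z0] ..
    then show ?thesis using global_weak_solution_unique[OF par] by blast
  qed
  moreover obtain M where "1 \<le> M"
    "\<forall>z0 u. global_weak_solution A \<alpha> \<beta> \<gamma> g z0 u \<longrightarrow> (\<forall>t\<ge>0. energy A g u t \<le> M * energy A g u 0)"
    using global_weak_solution_energy[OF par] by blast
  ultimately show ?thesis by blast
qed

end
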